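(* Let $P\in \mathbb{P}^N(\mathbb{R})$ be such that $r_{\mathbb{C}}(P)+r_{\mathbb{R}}(P)\le 3d-1$ and $r_{\mathbb{C}}(P)\neq r_{\mathbb{R}}(P)$. Fix any set $S_{\mathbb{C}}\subset \mathbb{P}^m(\mathbb{C})$ evincing $r_{\mathbb{C}}(P)$ and any set $S_{\mathbb{R}}\subset \mathbb{P}^m(\mathbb{R})$ evincing $r_{\mathbb{R}}(P)$. For a curve $Y\subset\mathbb{P}^m$ write $S_{\mathbb{C},Y}:=S_{\mathbb{C}}\cap Y$ and $S_{\mathbb{R},Y}:=S_{\mathbb{R}}\cap Y$. Then one of the following cases (a), (b), (c) occurs. (a) There is a line $l\subset\mathbb{P}^m$ defined over $\mathbb{R}$ with the following properties: (i) $S_{\mathbb{C}}$ and $S_{\mathbb{R}}$ coincide outside $l$: $S_{\mathbb{C}}\setminus (S_{\mathbb{C}}\cap l)=S_{\mathbb{R}}\setminus (S_{\mathbb{R}}\cap l)$; (ii) there is a point $P_l\in\langle\nu_d(S_{\mathbb{C},l})\rangle\cap\langle\nu_d(S_{\mathbb{R},l})\rangle$, with $P_l\in\mathbb{P}^N(\mathbb{R})$, such that $S_{\mathbb{C},l}$ evinces $r_{\mathbb{C}}(P_l)$ and $S_{\mathbb{R},l}$ evinces $r_{\mathbb{R}}(P_l)$; (iii) $\sharp(S_{\mathbb{C},l}\cup S_{\mathbb{R},l})\ge d+2$ and $\sharp(S_{\mathbb{C},l})<\sharp(S_{\mathbb{R},l})$. (b) There is a reduced conic $C\subset\mathbb{P}^m$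 defined over $\mathbb{R}$ with the following properties: (i) $S_{\mathbb{C}}$ and $S_{\mathbb{R}}$ coincide outside $C$: $S_{\mathbb{C}}\setminus (S_{\mathbb{C}}\cap C)=S_{\mathbb{R}}\setminus (S_{\mathbb{R}}\cap C)$; (ii) there is a point $P_C\in\langle\nu_d(S_{\mathbb{C},C})\rangle\cap\langle\nu_d(S_{\mathbb{R},C})\rangle$, with $P_C\in\mathbb{P}^N(\mathbb{R})$, such that $S_{\mathbb{C},C}$ evinces $r_{\mathbb{C}}(P_C)$ and $S_{\mathbb{R},C}$ evinces $r_{\mathbb{R}}(P_C)$; (iii) $\sharp(S_{\mathbb{C},C}\cup S_{\mathbb{R},C})\ge 2d+2$ and $\sharp(S_{\mathbb{C},C})<\sharp(S_{\mathbb{R},C})$; (iv) if $C$ is reducible, say $C=l_1\cup l_2$ with $l_1,l_2$ lines and $Q=l_1\cap l_2$, then $\sharp\big((S_{\mathbb{C}}\cup S_{\mathbb{R}})\cap(l_i\setminus Q)\big)\ge d+1$ for $i\in\{1,2\}$. (c) $m\ge 3$ and there are two disjoint lines $l,r\subset\mathbb{P}^m$ defined over $\mathbb{R}$ such that, setting $\Gamma:=l\cup r$, the following properties hold: (i) $S_{\mathbb{C}}$ and $S_{\mathbb{R}}$ coincide outside $\Gamma$: $S_{\mathbb{C}}\setminus (S_{\mathbb{C}}\cap\Gamma)=S_{\mathbb{R}}\setminus (S_{\mathbb{R}}\cap\Gamma)=:S_{\hat\Gamma}$; (ii) $\sharp(S_{\mathbb{C},l}\cup S_{\mathbb{R},l})\ge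 d+2$ and $\sharp(S_{\mathbb{C},r}\cup S_{\mathbb{R},r})\ge d+2$; (iii) the set $\langle\{P\}\cup\nu_d(S_{\hat\Gamma})\rangle\cap\langle\nu_d(\Gamma)\rangle$ is a single point $O_\Gamma\in\mathbb{P}^N(\mathbb{R})$; moreover $S_{\mathbb{C},\Gamma}$ evinces $r_{\mathbb{C}}(O_\Gamma)$ and $S_{\mathbb{R},\Gamma}$ evinces $r_{\mathbb{R}}(O_\Gamma)$; (iv) the set $\langle\{O_\Gamma\}\cup\nu_d(r)\rangle\cap\langle\nu_d(l)\rangle$ (resp. $\langle\{O_\Gamma\}\cup\nu_d(l)\rangle\cap\langle\nu_d(r)\rangle$) consists of a unique point $O_l\in\mathbb{P}^N(\mathbb{R})$ (resp. $O_r\in\mathbb{P}^N(\mathbb{R})$); moreover $S_{\mathbb{C},l}$ (resp. $S_{\mathbb{C},r}$) evinces $r_{\mathbb{C}}(O_l)$ (resp. $r_{\mathbb{C}}(O_r)$), and $S_{\mathbb{R},l}$ (resp. $S_{\mathbb{R},r}$) evinces $r_{\mathbb{R}}(O_l)$ (resp. $r_{\mathbb{R}}(O_r)$).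
   Context: Let $m,d$ be positive integers, $N:=\binom{m+d}{d}-1$, and let $\nu_d:\mathbb{P}^m\to\mathbb{P}^N$ be the degree $d$ Veronese embedding (over $\mathbb{C}$; it is defined over $\mathbb{R}$, so $\nu_d(\mathbb{P}^m(\mathbb{R}))\subset\mathbb{P}^N(\mathbb{R})$). The symbol $\langle\ \rangle$ denotes linear span in $\mathbb{P}^N$ with complex coefficients, and $\langle\ \rangle_{\mathbb{R}}$ denotes linear span with real coefficients. For $P\in\mathbb{P}^N$, the complex symmetric rank $r_{\mathbb{C}}(P)$ is the minimal cardinality of a finite set $S\subset\mathbb{P}^m(\mathbb{C})$ such that $P\in\langle\nu_d(S)\rangle$; a finite set $S\subset\mathbb{P}^m(\mathbb{C})$ with $P\in\langle\nu_d(S)\rangle$ and $\sharp(S)=r_{\mathbb{C}}(P)$ is said to evince $r_{\mathbb{C}}(P)$. For $P\in\mathbb{P}^N(\mathbb{R})$, the real symmetric rank $r_{\mathbb{R}}(P)$ is the minimal cardinality of a finite set $S\subset\mathbb{P}^m(\mathbb{R})$ such that $P\in\langle\nu_d(S)\rangle_{\mathbb{R}}$; such a set of cardinality $r_{\mathbb{R}}(P)$ is said to evince $r_{\mathbb{R}}(P)$. The notation $\sharp$ denotes cardinality. A conic is a plane curve of degree 2 (contained in some plane of $\mathbb{P}^m$). *)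

theory Defs
  imports "HOL-Analysis.Analysis" "HOL-Library.Function_Algebras"
begin

(* For an index set I, the coordinate space "C to the power I" consists of the functions into the
   complex numbers that vanish outside I. Both scalar actions below live on the same functions, so
   that complex and real spans can be compared directly. *)

definition cscale :: "complex \<Rightarrow> ('i \<Rightarrow> complex) \<Rightarrow> 'i \<Rightarrow> complex" where
  "cscale c v = (\<lambda>i. c * v i)"

definition rscale :: "real \<Rightarrow> ('i \<Rightarrow> complex) \<Rightarrow> 'i \<Rightarrow> complex" where
  "rscale c v = (\<lambda>i. of_real c * v i)"

interpretation cvs: vector_space "cscale :: complex \<Rightarrow> ('i \<Rightarrow> complex) \<Rightarrow> 'i \<Rightarrow> complex"
  by unfold_locales (auto simp: cscale_def fun_eq_iff algebra_simps)

interpretation rvs: vector_space "rscale :: real \<Rightarrow> ('i \<Rightarrow> complex) \<Rightarrow> 'i \<Rightarrow> complex"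
  by unfold_locales (auto simp: rscale_def fun_eq_iff algebra_simps)

definition coord_space :: "'i set \<Rightarrow> ('i \<Rightarrow> complex) set" where
  "coord_space I = {v. \<forall>i. i \<notin> I \<longrightarrow> v i = 0}"

definition real_vecs :: "('i \<Rightarrow> complex) set" where
  "real_vecs = {v. \<forall>i. v i \<in> \<real>}"

(* A point of projective space is a one-dimensional complex subspace, zero vector included. *)

type_synonym 'i point = "('i \<Rightarrow> complex) set"

definition point_of :: "('i \<Rightarrow> complex) \<Rightarrow> 'i point" where
  "point_of v = cvs.span {v}"

definition proj :: "'i set \<Rightarrow> 'i point set" where
  "proj I = {point_of v | v. v \<in> coord_space I \<and> v \<noteq> 0}"

definition real_proj :: "'i set \<Rightarrow> 'i point set" where
  "real_proj I = {point_of v | v. v \<in> coord_space I \<inter> real_vecs \<and> v \<noteq> 0}"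

definition lin_span :: "'i set \<Rightarrow> 'i point set \<Rightarrow> 'i point set" where
  "lin_span I A = {Q \<in> proj I. Q \<subseteq> cvs.span (\<Union>A)}"

(* For a set A of real points: the real vectors in a real point are the real multiples of any
   one of its nonzero real representatives. *)

definition real_lin_span :: "'i set \<Rightarrow> 'i point set \<Rightarrow> 'i point set" where
  "real_lin_span I A =
     {Q \<in> real_proj I. Q \<inter> real_vecs \<subseteq> rvs.span (\<Union>A \<inter> real_vecs)}"

(* Projective m-space has homogeneous coordinates indexed by {..m}; the target of the degree d
   Veronese embedding has homogeneous coordinates indexed by the monomials of degree d in these
   m + 1 variables, given by their exponent vectors. *)

definition exps :: "nat \<Rightarrow> nat \<Rightarrow> (nat \<Rightarrow> nat) set" where
  "exps m d = {a. (\<forall>i. m < i \<longrightarrow> a i = 0) \<and> (\<Sum>i\<le>m. a i) = d}"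

abbreviation PP :: "nat \<Rightarrow> nat point set" where
  "PP m \<equiv> proj {..m}"

abbreviation PP_real :: "nat \<Rightarrow> nat point set" where
  "PP_real m \<equiv> real_proj {..m}"

definition monomials :: "nat \<Rightarrow> nat \<Rightarrow> (nat \<Rightarrow> complex) \<Rightarrow> (nat \<Rightarrow> nat) \<Rightarrow> complex" where
  "monomials m d x = (\<lambda>a. if a \<in> exps m d then \<Prod>i\<le>m. x i ^ a i else 0)"

definition veronese :: "nat \<Rightarrow> nat \<Rightarrow> nat point \<Rightarrow> (nat \<Rightarrow> nat) point" where
  "veronese m d p = cvs.span (monomials m d ` p)"

abbreviation vspan :: "nat \<Rightarrow> nat \<Rightarrow> nat point set \<Rightarrow> (nat \<Rightarrow> nat) point set" where
  "vspan m d S \<equiv> lin_span (exps m d) (veronese m d ` S)"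

abbreviation real_vspan :: "nat \<Rightarrow> nat \<Rightarrow> nat point set \<Rightarrow> (nat \<Rightarrow> nat) point set" where
  "real_vspan m d S \<equiv> real_lin_span (exps m d) (veronese m d ` S)"

definition crank :: "nat \<Rightarrow> nat \<Rightarrow> (nat \<Rightarrow> nat) point \<Rightarrow> nat" where
  "crank m d P = (LEAST n. \<exists>S \<subseteq> PP m. finite S \<and> P \<in> vspan m d S \<and> card S = n)"

definition rrank :: "nat \<Rightarrow> nat \<Rightarrow> (nat \<Rightarrow> nat) point \<Rightarrow> nat" where
  "rrank m d P = (LEAST n. \<exists>S \<subseteq> PP_real m. finite S \<and> P \<in> real_vspan m d S \<and> card S = n)"

definition cevinces :: "nat \<Rightarrow> nat \<Rightarrow> nat point set \<Rightarrow> (nat \<Rightarrow> nat) point \<Rightarrow> bool" where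
  "cevinces m d S P \<longleftrightarrow>
     S \<subseteq> PP m \<and> finite S \<and> P \<in> vspan m d S \<and> card S = crank m d P"

definition revinces :: "nat \<Rightarrow> nat \<Rightarrow> nat point set \<Rightarrow> (nat \<Rightarrow> nat) point \<Rightarrow> bool" where
  "revinces m d S P \<longleftrightarrow>
     S \<subseteq> PP_real m \<and> finite S \<and> P \<in> real_vspan m d S \<and> card S = rrank m d P"

(* A homogeneous form of degree e in x 0, ..., x m is given by its coefficient vector, an element
   of coord_space (exps m e). *)

definition form_eval :: "nat \<Rightarrow> nat \<Rightarrow> ((nat \<Rightarrow> nat) \<Rightarrow> complex) \<Rightarrow> (nat \<Rightarrow> complex) \<Rightarrow> complex" where
  "form_eval m e f x = (\<Sum>a\<in>exps m e. f a * (\<Prod>i\<le>m. x i ^ a i))"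

definition form_vanishes :: "nat \<Rightarrow> nat \<Rightarrow> ((nat \<Rightarrow> nat) \<Rightarrow> complex) \<Rightarrow> nat point \<Rightarrow> bool" where
  "form_vanishes m e f p \<longleftrightarrow> (\<forall>x\<in>p. form_eval m e f x = 0)"

(* A reduced closed subscheme is identified with its set of complex points; it is defined over the
   reals iff it is the common zero locus of homogeneous forms with real coefficients. *)

definition defined_over_reals :: "nat \<Rightarrow> nat point set \<Rightarrow> bool" where
  "defined_over_reals m Z \<longleftrightarrow>
     (\<exists>F. (\<forall>(e, f)\<in>F. f \<in> coord_space (exps m e) \<inter> real_vecs) \<and>
          Z = {p \<in> PP m. \<forall>(e, f)\<in>F. form_vanishes m e f p})"

definition linear_subvariety :: "nat \<Rightarrow> nat \<Rightarrow> nat point set \<Rightarrow> bool" where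
  "linear_subvariety m k L \<longleftrightarrow>
     (\<exists>V. cvs.subspace V \<and> V \<subseteq> coord_space {..m} \<and> cvs.dim V = k + 1 \<and>
          L = {p \<in> PP m. p \<subseteq> V})"

abbreviation is_line :: "nat \<Rightarrow> nat point set \<Rightarrow> bool" where
  "is_line m L \<equiv> linear_subvariety m 1 L"

abbreviation is_plane :: "nat \<Rightarrow> nat point set \<Rightarrow> bool" where
  "is_plane m L \<equiv> linear_subvariety m 2 L"

(* A conic is cut out in a plane E by a quadratic form q that is not identically zero on E; it is
   reduced iff q restricted to E has no repeated factor, i.e. is not of the form c * g^2 with a
   linear form g. *)

definition reduced_conic :: "nat \<Rightarrow> nat point set \<Rightarrow> bool" where
  "reduced_conic m C \<longleftrightarrow>
     (\<exists>E. is_plane m E \<and>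
       (\<exists>q \<in> coord_space (exps m 2).
          C = {p \<in> E. form_vanishes m 2 q p} \<and>
          (\<exists>x \<in> \<Union>E. form_eval m 2 q x \<noteq> 0) \<and>
          \<not> (\<exists>c. \<exists>g \<in> coord_space (exps m 1).
                \<forall>x \<in> \<Union>E. form_eval m 2 q x = c * (form_eval m 1 g x)\<^sup>2)))"

lemma card_exps: "card (exps m d) = (m + d) choose d"
proof -
  have "bij_betw (\<lambda>a. map a [0..<Suc m]) (exps m d)
          {l::nat list. length l = Suc m \<and> sum_list l = d}"
  proof (rule bij_betwI[where g = "\<lambda>l i. if i \<le> m then l ! i else 0"])
    show "(\<lambda>a. map a [0..<Suc m]) \<in> exps m d \<rightarrow> {l. length l = Suc m \<and> sum_list l = d}"
      by (auto simp: exps_def interv_sum_list_conv_sum_set_nat atLeast0LessThan lessThan_Suc_atMost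
               simp del: upt_Suc)
    show "(\<lambda>l i. if i \<le> m then l ! i else 0) \<in>
        {l. length l = Suc m \<and> sum_list l = d} \<rightarrow> exps m d"
      by (auto simp: exps_def sum_list_sum_nth atLeast0LessThan lessThan_Suc_atMost)
  qed (auto simp: exps_def fun_eq_iff intro!: nth_equalityI simp del: upt_Suc)
  from bij_betw_same_card[OF this] show ?thesis
    by (simp add: card_length_sum_list add.commute)
qed

lemma veronese_point_of: "veronese m d (point_of x) = point_of (monomials m d x)"
proof -
  have mon: "monomials m d (cscale c x) = cscale (c ^ d) (monomials m d x)" for c
  proof
    fix a
    show "monomials m d (cscale c x) a = cscale (c ^ d) (monomials m d x) a"
      by (auto simp: monomials_def cscale_def power_mult_distrib prod.distrib exps_def
               simp flip: power_sum)
  qed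
  have "monomials m d ` cvs.span {x} \<subseteq> cvs.span {monomials m d x}"
    by (auto simp: cvs.span_singleton mon)
  moreover have "monomials m d x \<in> monomials m d ` cvs.span {x}"
    by (simp add: cvs.span_base)
  ultimately show ?thesis
    unfolding veronese_def point_of_def
    by (meson cvs.span_minimal cvs.span_mono cvs.subspace_span empty_subsetI insert_subset subset_antisym)
qed

end

theory Submission
  imports Defs
begin

text \<open>
Let \<open>v\<close> be a real vector over \<open>P\<close>. A set evincing the complex rank and a set evincing the real
rank write \<open>v\<close> in two ways as a combination of Veronese images, and subtracting them gives a linear
relation. Let \<open>T\<close> be the set of points whose coefficient in this relation is nonzero. Off \<open>T\<close> the two
decompositions agree term by term, and every part of a shortest decomposition is a shortest
decomposition of the partial sum (\<open>spans_minimally_part\<close>). So all rank assertions follow once \<open>T\<close>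
is known to lie on the curve in question, and the theorem is a statement about the position of \<open>T\<close>.

For the classification, all that matters is that \<open>T\<close> has fewer than \<open>3 d\<close> points and is a Cayley--Bacharach
set of degree \<open>d\<close>: a form of degree \<open>d\<close> vanishing at all points of \<open>T\<close> but one vanishes at the last
one, too. Such sets are stable under residuation: the points off a hypersurface of degree \<open>e\<close> form a
Cayley--Bacharach set of degree \<open>d - e\<close>. A nonempty one has at least \<open>d + 2\<close> points, and at least
\<open>2 d + 2\<close> if it is not collinear (\<open>cayley_bacharach_card\<close>, \<open>cayley_bacharach_in_line\<close>). Peeling off
lines, conics and planes that contain many points, and comparing what is left with these bounds, shows
that a set of fewer than \<open>3 d\<close> points lies in two lines or in a plane, and in the latter case on a
conic (\<open>cayley_bacharach_in_plane_or_two_lines\<close>, \<open>cayley_bacharach_on_conic\<close>). Peeling fails only for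
\<open>3 d - 1\<close> points in general position, no six of them on a conic; this case is excluded in
\<open>extremal_general_position_on_conic\<close>.

The curve is real because the real points of \<open>T\<close> outnumber the others. If \<open>T\<close> is contained in two
lines, then projecting one line into the other splits the relation, up to a multiple of the Veronese
image of the common point; were there fewer than two real points on one of the lines, the complex
decomposition could be shortened (\<open>split_relation\<close>, \<open>real_points_on_second_line\<close>). Otherwise the real
points span the plane, and the real or the imaginary part of an equation of the conic already vanishes
on all of \<open>T\<close> (\<open>plane_set_on_real_conic\<close>). If the two lines are disjoint, the relation splits
completely, and the points \<open>O\<close> are unique because the Veronese images of the two lines, and those of
the points off both lines, span independent subspaces (\<open>disjoint_lines_case\<close>).
\<close>

section \<open>Linear functionals and forms\<close>

abbreviation lin_functional :: "(('i \<Rightarrow> complex) \<Rightarrow> complex) \<Rightarrow> bool" where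
  "lin_functional \<equiv> Vector_Spaces.linear cscale (*)"

interpretation functionals:
  vector_space_pair "cscale :: complex \<Rightarrow> ('i \<Rightarrow> complex) \<Rightarrow> 'i \<Rightarrow> complex" "(*) :: complex \<Rightarrow> complex \<Rightarrow> complex"
  by unfold_locales (auto simp: algebra_simps)

lemma functional_vanishing_on_subspace:
  assumes V: "cvs.subspace V" and x: "x \<notin> V"
  shows "\<exists>\<phi>. lin_functional \<phi> \<and> (\<forall>v\<in>V. \<phi> v = 0) \<and> \<phi> x = 1"
proof -
  obtain B where B: "B \<subseteq> V" "cvs.independent B" "V \<subseteq> cvs.span B"
    by (meson cvs.basis_exists)
  have "cvs.span B \<subseteq> V" using B(1) V by (rule cvs.span_minimal)
  then have xB: "x \<notin> cvs.span B" using x by blast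
  then have "cvs.independent (insert x B)" using B(2) cvs.independent_insertI by blast
  then obtain \<phi> where \<phi>: "lin_functional \<phi>" "\<forall>b\<in>insert x B. \<phi> b = (if b = x then 1 else 0)"
    using functionals.linear_independent_extend[of "insert x B" "\<lambda>b. if b = x then 1 else 0"] by blast
  have "x \<notin> B" using xB cvs.span_base by blast
  then have 0: "\<forall>b\<in>B. \<phi> b = 0" using \<phi>(2) by auto
  have "\<phi> v = 0" if "v \<in> V" for v
    using functionals.linear_eq_0_on_span[OF \<phi>(1), of B v] 0 B(3) that by blast
  then show ?thesis using \<phi> by auto
qed

lemma lin_functionalI:
  assumes "\<And>x y. \<phi> (x + y) = \<phi> x + \<phi> y" "\<And>c x. \<phi> (cscale c x) = c * \<phi> x"
  shows "lin_functional \<phi>"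
proof -
  have "vector_space ((*) :: complex \<Rightarrow> complex \<Rightarrow> complex)"
    by unfold_locales (auto simp: algebra_simps)
  then show ?thesis using assms by (simp add: Vector_Spaces.linear_iff cvs.vector_space_axioms)
qed

lemma lin_functional_arith:
  assumes "lin_functional \<phi>"
  shows "\<phi> (x + y) = \<phi> x + \<phi> y" "\<phi> (cscale c x) = c * \<phi> x" "\<phi> 0 = 0"
  using assms by (auto simp: functionals.linear_add functionals.linear_scale functionals.linear_0)

lemma lin_functional_combine:
  assumes "lin_functional \<phi>" "lin_functional \<psi>"
  shows "lin_functional (\<lambda>x. \<phi> x + c * \<psi> x)"
  by (intro functionals.linear_compose_add functionals.linear_compose_scale_right assms)

text \<open>
Projectively: some hyperplane through a given subspace meets a given finite set only inside the
subspace. Adding the points one by one, a correction by a functional that is nonzero at the new point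
spoils the old points for finitely many factors only.
\<close>

lemma functional_separating_finite:
  assumes V: "cvs.subspace V" and F: "finite F" "F \<inter> V = {}"
  shows "\<exists>\<phi>. lin_functional \<phi> \<and> (\<forall>v\<in>V. \<phi> v = 0) \<and> (\<forall>x\<in>F. \<phi> x \<noteq> 0)"
  using F
proof (induction F rule: finite_induct)
  case empty
  have "lin_functional (\<lambda>x. 0)" by (rule functionals.linear_zero)
  then show ?case by (intro exI[of _ "\<lambda>x. 0"]) auto
next
  case (insert x F)
  then obtain \<phi> where \<phi>: "lin_functional \<phi>" "\<forall>v\<in>V. \<phi> v = 0" "\<forall>y\<in>F. \<phi> y \<noteq> 0" by auto
  obtain \<psi> where \<psi>: "lin_functional \<psi>" "\<forall>v\<in>V. \<psi> v = 0" "\<psi> x = 1"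
    using functional_vanishing_on_subspace[OF V, of x] insert.prems by auto
  \<comment> \<open>each point of the set rules out at most one member of the pencil spanned by \<open>\<phi>\<close> and \<open>\<psi>\<close>\<close>
  have "finite ((\<lambda>y. - \<phi> y / \<psi> y) ` insert x F \<union> {0})" using insert by simp
  then obtain c where c: "c \<notin> (\<lambda>y. - \<phi> y / \<psi> y) ` insert x F \<union> {0}"
    using ex_new_if_finite[OF infinite_UNIV_char_0] by blast
  have "\<phi> y + c * \<psi> y \<noteq> 0" if "y \<in> insert x F" for y
  proof (cases "\<psi> y = 0")
    case True
    then show ?thesis using that \<psi> \<phi>(3) by auto
  next
    case False
    moreover have "c \<noteq> - \<phi> y / \<psi> y" using c that by blast
    ultimately show ?thesis by (simp add: field_simps add_eq_0_iff)
  qed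
  then show ?case
    using lin_functional_combine[OF \<phi>(1) \<psi>(1), of c] \<phi>(2) \<psi>(2)
    by (intro exI[of _ "\<lambda>y. \<phi> y + c * \<psi> y"]) auto
qed

text \<open>
Homogeneous forms as functions on the whole space, built from products of linear functionals. Compared
with coefficient vectors, products, residuation and linear substitutions become immediate, and no
dimension has to be fixed.
\<close>

inductive hform :: "nat \<Rightarrow> (('i \<Rightarrow> complex) \<Rightarrow> complex) \<Rightarrow> bool" where
  hform_const: "hform 0 (\<lambda>x. c)"
| hform_mult_lin: "lin_functional \<phi> \<Longrightarrow> hform d f \<Longrightarrow> hform (Suc d) (\<lambda>x. \<phi> x * f x)"
| hform_add: "hform d f \<Longrightarrow> hform d g \<Longrightarrow> hform d (\<lambda>x. f x + g x)"

lemma hform_scale: "hform d f \<Longrightarrow> hform d (\<lambda>x. c * f x)"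
proof (induction rule: hform.induct)
  case (hform_mult_lin \<phi> d f)
  have "hform (Suc d) (\<lambda>x. \<phi> x * (c * f x))" using hform_mult_lin by (intro hform.hform_mult_lin)
  then show ?case by (simp add: mult.left_commute)
qed (auto simp: algebra_simps intro: hform.intros)

lemma hform_diff_scale:
  assumes "hform d f" "hform d g"
  shows "hform d (\<lambda>x. a * f x - b * g x)"
  using hform_add[OF hform_scale[OF assms(1), of a] hform_scale[OF assms(2), of "-b"]] by simp

lemma hform_mult: "hform e g \<Longrightarrow> hform d f \<Longrightarrow> hform (e + d) (\<lambda>x. g x * f x)"
proof (induction rule: hform.induct)
  case (hform_const c) then show ?case by (simp add: hform_scale)
next
  case (hform_mult_lin \<phi> d g)
  then show ?case by (auto simp: mult.assoc intro: hform.hform_mult_lin)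
next
  case (hform_add d g h) then show ?case by (auto simp: distrib_right intro: hform.hform_add)
qed

lemma hform_linear: "lin_functional \<phi> \<Longrightarrow> hform 1 \<phi>"
  using hform_mult_lin[of \<phi> 0 "\<lambda>x. 1"] by (simp add: hform_const)

lemma hform_mult_lin2:
  assumes "lin_functional \<phi>" "lin_functional \<psi>" shows "hform 2 (\<lambda>x. \<phi> x * \<psi> x)"
  using hform_mult_lin[OF assms(1) hform_linear[OF assms(2)]] by (simp add: numeral_2_eq_2)

lemma hform_homogeneous: "hform d f \<Longrightarrow> f (cscale c x) = c ^ d * f x"
  by (induction rule: hform.induct) (auto simp: lin_functional_arith algebra_simps)

lemma hform_at_zero:
  assumes "hform e f" "e \<ge> 1" shows "f 0 = 0"
proof -
  have "f (cscale 0 0) = 0 ^ e * f 0" by (rule hform_homogeneous[OF assms(1)])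
  moreover have "(0 :: complex) ^ e = 0" using assms(2) by (simp add: power_0_left)
  ultimately show ?thesis by simp
qed

text \<open>
Linear substitution is how forms on a line are extended to the whole space: the substituted map is a
projection onto the line.
\<close>

lemma hform_comp_linear:
  assumes "hform d f" and \<pi>: "Vector_Spaces.linear cscale cscale \<pi>"
  shows "hform d (\<lambda>x. f (\<pi> x))"
  using assms(1)
proof (induction rule: hform.induct)
  case (hform_mult_lin \<phi> d f)
  have "lin_functional (\<phi> \<circ> \<pi>)" using \<pi> hform_mult_lin(1) by (rule Vector_Spaces.linear_compose)
  then show ?case using hform.hform_mult_lin[OF _ hform_mult_lin.IH] by (simp add: comp_def)
qed (auto intro: hform.intros)

lemma hform_nonvanishing_at:
  assumes "x \<noteq> 0" shows "\<exists>f. hform d f \<and> f x = 1"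
proof -
  obtain \<phi> where \<phi>: "lin_functional \<phi>" "\<phi> x = 1"
    using functional_vanishing_on_subspace[OF cvs.subspace_single_0, of x] assms by auto
  have "hform d (\<lambda>y. \<phi> y ^ d)"
    by (induction d) (auto intro: hform_const hform_mult_lin[OF \<phi>(1)])
  then show ?thesis using \<phi>(2) by (intro exI[of _ "\<lambda>y. \<phi> y ^ d"]) auto
qed

section \<open>Cayley--Bacharach sets and residuation\<close>

text \<open>
Finite sets of vectors that represent pairwise distinct points.
\<close>

definition proj_distinct :: "('i \<Rightarrow> complex) set \<Rightarrow> bool" where
  "proj_distinct X \<longleftrightarrow> finite X \<and> 0 \<notin> X \<and> (\<forall>x\<in>X. \<forall>y\<in>X. y \<in> cvs.span {x} \<longrightarrow> y = x)"

lemma proj_distinct_subset: "proj_distinct X \<Longrightarrow> Y \<subseteq> X \<Longrightarrow> proj_distinct Y"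
  unfolding proj_distinct_def by (meson finite_subset subset_iff)

lemma proj_distinct_finite: "proj_distinct X \<Longrightarrow> finite X"
  by (simp add: proj_distinct_def)

text \<open>
The vanishing condition of the Cayley--Bacharach theorem. It holds for the support of every linear
relation between evaluations of forms of degree \<open>d\<close>, and it says that the points fail to impose
independent conditions in such a way that no point can be singled out.
\<close>

definition cayley_bacharach :: "nat \<Rightarrow> ('i \<Rightarrow> complex) set \<Rightarrow> bool" where
  "cayley_bacharach d X \<longleftrightarrow>
     (\<forall>x\<in>X. \<forall>f. hform d f \<longrightarrow> (\<forall>y\<in>X - {x}. f y = 0) \<longrightarrow> f x = 0)"

text \<open>
If \<open>f\<close> vanishes at all but one of the points off \<open>g = 0\<close>, then \<open>g f\<close> vanishes at all but one of all
the points.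
\<close>

lemma cayley_bacharach_residual:
  assumes "cayley_bacharach d X" "hform e g" "e \<le> d"
  shows "cayley_bacharach (d - e) {x \<in> X. g x \<noteq> 0}"
  unfolding cayley_bacharach_def
proof (intro ballI allI impI)
  fix x f
  assume x: "x \<in> {x \<in> X. g x \<noteq> 0}" and f: "hform (d - e) f" "\<forall>y\<in>{x \<in> X. g x \<noteq> 0} - {x}. f y = 0"
  have "hform d (\<lambda>x. g x * f x)" using hform_mult[OF assms(2) f(1)] assms(3) by simp
  moreover have "\<forall>y\<in>X - {x}. g y * f y = 0" using f(2) by auto
  ultimately have "g x * f x = 0" using assms(1) x unfolding cayley_bacharach_def by blast
  then show "f x = 0" using x by simp
qed

lemma cayley_bacharach_off_subspace:
  assumes "cayley_bacharach d X" "finite X" "cvs.subspace V" "d \<ge> 1"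
  shows "cayley_bacharach (d - 1) (X - V)"
proof -
  obtain \<phi> where \<phi>: "lin_functional \<phi>" "\<forall>v\<in>V. \<phi> v = 0" "\<forall>x\<in>X - V. \<phi> x \<noteq> 0"
    using functional_separating_finite[OF assms(3), of "X - V"] assms(2) by auto
  have "{x \<in> X. \<phi> x \<noteq> 0} = X - V" using \<phi> by auto
  then show ?thesis using cayley_bacharach_residual[OF assms(1) hform_linear[OF \<phi>(1)] assms(4)] by simp
qed

text \<open>
Each residuation at a single point lowers the degree by one; in degree 0 the nonzero constants show
that one point is not enough.
\<close>

lemma cayley_bacharach_card:
  assumes "cayley_bacharach d X" "proj_distinct X" "X \<noteq> {}"
  shows "card X \<ge> d + 2"
  using assms
proof (induction d arbitrary: X)
  case 0
  then obtain x where x: "x \<in> X" by auto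
  have "\<not> X \<subseteq> {x}"
  proof
    assume "X \<subseteq> {x}"
    then have "(1::complex) = 0" using 0(1) x hform_const[of 1] unfolding cayley_bacharach_def by blast
    then show False by simp
  qed
  then obtain y where "y \<in> X" "y \<noteq> x" by auto
  then show ?case using x card_mono[of X "{x,y}"] proj_distinct_finite[OF 0(2)] by auto
next
  case (Suc d)
  then obtain x where x: "x \<in> X" by auto
  have fin: "finite X" using Suc proj_distinct_finite by blast
  have eq: "X - cvs.span {x} = X - {x}"
    using Suc.prems(2) x cvs.span_base unfolding proj_distinct_def by blast
  have cb: "cayley_bacharach d (X - {x})"
    using cayley_bacharach_off_subspace[OF Suc.prems(1) fin cvs.subspace_span[of "{x}"]] eq by simp
  have "X \<noteq> {x}"
  proof
    assume X: "X = {x}"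
    obtain f where "hform (Suc d) f" "f x = 1"
      using hform_nonvanishing_at[of x "Suc d"] x Suc.prems(2) unfolding proj_distinct_def by blast
    then show False using Suc.prems(1) X unfolding cayley_bacharach_def by auto
  qed
  then have "card (X - {x}) \<ge> d + 2"
    using Suc.IH[OF cb] proj_distinct_subset[OF Suc.prems(2)] x by blast
  then show ?case using x fin by (simp add: card_Diff_singleton)
qed

lemma subset_with_maximal_trace:
  assumes "finite X" "\<V> \<noteq> {}"
  shows "\<exists>V\<in>\<V>. \<forall>V'\<in>\<V>. card (X \<inter> V') \<le> card (X \<inter> V)"
proof -
  obtain V0 where "V0 \<in> \<V>" using assms(2) by blast
  then have "\<exists>V. V \<in> \<V> \<and> (\<forall>V'. V' \<in> \<V> \<longrightarrow> card (X \<inter> V') \<le> card (X \<inter> V))"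
    using assms(1) by (intro ex_has_greatest_nat[of _ V0 _ "Suc (card X)"])
      (auto simp: less_Suc_eq_le intro: card_mono)
  then show ?thesis by blast
qed

text \<open>
Degenerate spans are included, so that sets with at most one point are on a line, too.
\<close>

definition lines :: "('i \<Rightarrow> complex) set set" where
  "lines = {cvs.span {u, v} | u v. True}"

definition planes :: "('i \<Rightarrow> complex) set set" where
  "planes = {cvs.span {u, v, w} | u v w. True}"

definition in_line :: "('i \<Rightarrow> complex) set \<Rightarrow> bool" where
  "in_line X \<longleftrightarrow> (\<exists>V\<in>lines. X \<subseteq> V)"

definition in_two_lines :: "('i \<Rightarrow> complex) set \<Rightarrow> bool" where
  "in_two_lines X \<longleftrightarrow> (\<exists>V\<in>lines. \<exists>V'\<in>lines. X \<subseteq> V \<union> V')"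

lemma lines_subspace: "V \<in> lines \<Longrightarrow> cvs.subspace V"
  by (auto simp: lines_def)

lemma planes_subspace: "V \<in> planes \<Longrightarrow> cvs.subspace V"
  by (auto simp: planes_def)

lemma line_in_plane: "V \<in> lines \<Longrightarrow> \<exists>E\<in>planes. V \<subseteq> E"
proof -
  assume "V \<in> lines"
  then obtain u v where "V = cvs.span {u, v}" unfolding lines_def by blast
  then have "V \<subseteq> cvs.span {u, v, v}" by simp
  then show ?thesis unfolding planes_def by blast
qed

text \<open>
Take a line containing as many points as possible. If points remain off it, then by induction they are
collinear and there are at least \<open>d + 1\<close> of them; by maximality the first line has at least as many
points, which makes \<open>2 d + 2\<close> in total.
\<close>

lemma cayley_bacharach_in_line:
  assumes "cayley_bacharach d X" "proj_distinct X" "card X \<le> 2 * d + 1"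
  shows "in_line X"
  using assms
proof (induction d arbitrary: X)
  case 0
  then have "X = {}" using cayley_bacharach_card[OF 0(1,2)] by fastforce
  then show ?case unfolding in_line_def lines_def by blast
next
  case (Suc d)
  have fin: "finite X" using Suc proj_distinct_finite by blast
  obtain V where V: "V \<in> lines" and max: "\<And>V'. V' \<in> lines \<Longrightarrow> card (X \<inter> V') \<le> card (X \<inter> V)"
    using subset_with_maximal_trace[OF fin, of lines] by (auto simp: lines_def)
  show ?case
  proof (cases "X - V = {}")
    case True
    then show ?thesis using V unfolding in_line_def by blast
  next
    case False
    have cb: "cayley_bacharach d (X - V)"
      using cayley_bacharach_off_subspace[OF Suc.prems(1) fin lines_subspace[OF V]] by simp
    have pd: "proj_distinct (X - V)" using Suc.prems(2) proj_distinct_subset by blast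
    have ge: "card (X - V) \<ge> d + 2" using cayley_bacharach_card[OF cb pd False] .
    have split: "card X = card (X \<inter> V) + card (X - V)"
      using fin by (rule card_Int_Diff)
    obtain Y where Y: "Y \<subseteq> X" "card Y = 2"
      using ge split obtain_subset_with_card_n[of 2 X] by auto
    then obtain u v where "Y = {u, v}" by (auto simp: card_2_iff)
    then have "Y \<subseteq> X \<inter> cvs.span {u, v}" using Y cvs.span_superset[of "{u,v}"] by auto
    then have "2 \<le> card (X \<inter> cvs.span {u, v})" using Y(2) card_mono[of "X \<inter> cvs.span {u, v}" Y] fin by auto
    then have "2 \<le> card (X \<inter> V)" using max[of "cvs.span {u, v}"] unfolding lines_def
      by (metis (mono_tags, lifting) dual_order.trans mem_Collect_eq)
    then have "card (X - V) \<le> 2 * d + 1" using split Suc.prems(3) by simp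
    then obtain V' where V': "V' \<in> lines" "X - V \<subseteq> V'"
      using Suc.IH[OF cb pd] unfolding in_line_def by blast
    have "card (X - V) \<le> card (X \<inter> V')" using V' fin by (intro card_mono) auto
    then have "card (X \<inter> V) \<ge> d + 2" using max[OF V'(1)] ge by simp
    then show ?thesis using split ge Suc.prems(3) by simp
  qed
qed

text \<open>
The way in which dependent conditions are turned into a Cayley--Bacharach set: if \<open>C\<close> does not impose
independent conditions at \<open>y\<close>, then a minimal subset with this defect has the Cayley--Bacharach
property, because a form violating it could be combined with one that isolates \<open>y\<close>.
\<close>

lemma ex_cayley_bacharach_subset:
  assumes "finite C" "y \<in> C"
    and "\<forall>f. hform k f \<longrightarrow> (\<forall>x\<in>C - {y}. f x = 0) \<longrightarrow> f y = 0"
  shows "\<exists>C'\<subseteq>C. y \<in> C' \<and> cayley_bacharach k C'"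
  using assms
proof (induction C rule: finite_psubset_induct)
  case (psubset C)
  show ?case
  proof (cases "\<exists>z\<in>C - {y}. \<forall>f. hform k f \<longrightarrow> (\<forall>x\<in>C - {z} - {y}. f x = 0) \<longrightarrow> f y = 0")
    case True
    then obtain z where "z \<in> C - {y}" "\<forall>f. hform k f \<longrightarrow> (\<forall>x\<in>C - {z} - {y}. f x = 0) \<longrightarrow> f y = 0" by blast
    then show ?thesis using psubset.IH[of "C - {z}"] psubset.prems by blast
  next
    case False
    have "f z = 0" if z: "z \<in> C" and f: "hform k f" "\<forall>x\<in>C - {z}. f x = 0" for z f
    proof (cases "z = y")
      case True
      then show ?thesis using psubset.prems(2) f by blast
    next
      case zy: False
      then obtain g where g: "hform k g" "\<forall>x\<in>C - {z} - {y}. g x = 0" "g y \<noteq> 0" using False z by blast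
      show ?thesis
      proof (rule ccontr)
        assume fz: "f z \<noteq> 0"
        let ?h = "\<lambda>x. f z * g x - g z * f x"
        have "hform k ?h" using hform_diff_scale[OF g(1) f(1)] .
        moreover have "\<forall>x\<in>C - {y}. ?h x = 0"
        proof
          fix x assume "x \<in> C - {y}"
          then show "?h x = 0" using f(2) g(2) by (cases "x = z") auto
        qed
        ultimately have "?h y = 0" using psubset.prems(2) by blast
        then show False using f(2) g(3) fz zy psubset.prems(1) by auto
      qed
    qed
    then have "cayley_bacharach k C" unfolding cayley_bacharach_def by blast
    then show ?thesis using psubset.prems by blast
  qed
qed

section \<open>Cayley--Bacharach sets with fewer than \<open>3 d\<close> points\<close>

text \<open>
No three points on a line.
\<close>

definition general_position :: "('i \<Rightarrow> complex) set \<Rightarrow> bool" where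
  "general_position X \<longleftrightarrow> (\<forall>V\<in>lines. card (X \<inter> V) \<le> 2)"

lemma cayley_bacharach_general_position_card:
  assumes "cayley_bacharach e Y" "proj_distinct X" "general_position X" "Y \<subseteq> X" "Y \<noteq> {}"
  shows "card Y \<ge> 2 * e + 2"
proof (rule ccontr)
  assume less: "\<not> ?thesis"
  have pd: "proj_distinct Y" using assms proj_distinct_subset by blast
  obtain V where V: "V \<in> lines" "Y \<subseteq> V"
    using cayley_bacharach_in_line[OF assms(1) pd] less unfolding in_line_def by auto
  have "card Y \<le> card (X \<inter> V)"
    using V assms(4) proj_distinct_finite[OF assms(2)] by (intro card_mono) auto
  then have "card Y \<le> 2" using assms(3) V(1) unfolding general_position_def by force
  moreover have "card Y \<ge> e + 2" using cayley_bacharach_card[OF assms(1) pd assms(5)] .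
  ultimately show False using less by simp
qed

text \<open>
A choice of linear equations: \<open>L a b\<close> cuts out, on \<open>X\<close>, exactly the pair \<open>a\<close>, \<open>b\<close>.
\<close>

definition joins :: "('i \<Rightarrow> complex) set \<Rightarrow> (('i \<Rightarrow> complex) \<Rightarrow> ('i \<Rightarrow> complex) \<Rightarrow> ('i \<Rightarrow> complex) \<Rightarrow> complex) \<Rightarrow> bool" where
  "joins X L \<longleftrightarrow> (\<forall>a\<in>X. \<forall>b\<in>X. a \<noteq> b \<longrightarrow> lin_functional (L a b) \<and> L a b a = 0 \<and> L a b b = 0 \<and>
      (\<forall>c\<in>X - {a, b}. L a b c \<noteq> 0))"

lemma ex_joins:
  assumes "proj_distinct X" "general_position X"
  shows "\<exists>L. joins X L"
proof -
  have "\<exists>\<phi>. lin_functional \<phi> \<and> \<phi> a = 0 \<and> \<phi> b = 0 \<and> (\<forall>c\<in>X - {a, b}. \<phi> c \<noteq> 0)"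
    if ab: "a \<in> X" "b \<in> X" "a \<noteq> b" for a b
  proof -
    have fin: "finite X" using assms proj_distinct_finite by blast
    have sub: "{a, b} \<subseteq> cvs.span {a, b}" by (rule cvs.span_superset)
    have "(X - {a, b}) \<inter> cvs.span {a, b} = {}"
    proof (rule ccontr)
      assume "\<not> ?thesis"
      then obtain c where c: "c \<in> X" "c \<noteq> a" "c \<noteq> b" "c \<in> cvs.span {a, b}" by blast
      have "card {a, b, c} \<le> card (X \<inter> cvs.span {a, b})"
        using ab c sub fin by (intro card_mono) auto
      moreover have "card (X \<inter> cvs.span {a, b}) \<le> 2"
        using assms(2) unfolding general_position_def lines_def by blast
      ultimately show False using c ab by auto
    qed
    then obtain \<phi> where "lin_functional \<phi>" "\<forall>v\<in>cvs.span {a, b}. \<phi> v = 0" "\<forall>x\<in>X - {a, b}. \<phi> x \<noteq> 0"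
      using functional_separating_finite[OF cvs.subspace_span, of "X - {a, b}" "{a, b}"] fin by auto
    then show ?thesis using sub by auto
  qed
  then show ?thesis unfolding joins_def by metis
qed

text \<open>
A member of the pencil through four points that is spanned by two pairs of opposite sides of the
quadrangle. It is not the zero form on the plane: at \<open>x + y'\<close>, a point on a side belonging to the
second pair, the second product vanishes but the first one does not.
\<close>

lemma pencil_of_conics:
  fixes \<beta> :: complex
  assumes L: "joins X L" and E: "cvs.subspace E" "X \<subseteq> E"
    and p: "x \<in> X" "y \<in> X" "x' \<in> X" "y' \<in> X" "distinct [x, y, x', y']" and \<alpha>: "\<alpha> \<noteq> 0"
  defines "q \<equiv> \<lambda>w. \<alpha> * (L x y w * L x' y' w) - \<beta> * (L x y' w * L x' y w)"
  shows "hform 2 q \<and> (\<exists>v\<in>E. q v \<noteq> 0) \<and> q x = 0 \<and> q y = 0 \<and> q x' = 0 \<and> q y' = 0"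
proof -
  have lin: "lin_functional (L a b)" if "a \<in> X" "b \<in> X" "a \<noteq> b" for a b
    using L that unfolding joins_def by blast
  have zero: "L a b a = 0" "L a b b = 0" if "a \<in> X" "b \<in> X" "a \<noteq> b" for a b
    using L that unfolding joins_def by blast+
  have nz: "L a b c \<noteq> 0" if "a \<in> X" "b \<in> X" "a \<noteq> b" "c \<in> X" "c \<noteq> a" "c \<noteq> b" for a b c
    using L that unfolding joins_def by blast
  have "hform 2 q" unfolding q_def
    using p by (intro hform_diff_scale hform_mult_lin2 lin) auto
  moreover have "q (x + y') = \<alpha> * (L x y y' * L x' y' x)"
    using p zero lin by (simp add: q_def lin_functional_arith)
  then have "q (x + y') \<noteq> 0" using \<alpha> nz p by auto
  moreover have "x + y' \<in> E" using E p cvs.subspace_add by blast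
  ultimately show ?thesis using p zero by (auto simp: q_def)
qed

lemma conic_through_five_points:
  assumes "proj_distinct X" "general_position X" "cvs.subspace E" "X \<subseteq> E" "card X \<ge> 5"
  shows "\<exists>q. hform 2 q \<and> (\<exists>v\<in>E. q v \<noteq> 0) \<and> card {x \<in> X. q x = 0} \<ge> 5"
proof -
  obtain L where L: "joins X L" using ex_joins assms by blast
  obtain Y where Y: "Y \<subseteq> X" "card Y = 5" "finite Y" using assms(5) obtain_subset_with_card_n[of 5 X] by blast
  obtain xs where xs: "set xs = Y" "distinct xs" using finite_distinct_list[OF Y(3)] by blast
  then have "length xs = 5" using Y(2) distinct_card by fastforce
  then obtain x y x' y' z where "xs = [x, y, x', y', z]"
    by (auto simp: numeral_eq_Suc length_Suc_conv)
  then have Yeq: "Y = {x, y, x', y', z}" and dist: "distinct [x, y, x', y', z]" using xs by auto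
  let ?\<alpha> = "L x y' z * L x' y z" and ?\<beta> = "L x y z * L x' y' z"
  \<comment> \<open>the member of the pencil through the first four points that contains the fifth\<close>
  let ?q = "\<lambda>w. ?\<alpha> * (L x y w * L x' y' w) - ?\<beta> * (L x y' w * L x' y w)"
  have "?\<alpha> \<noteq> 0" using L Yeq Y(1) dist unfolding joins_def by auto
  then have q: "hform 2 ?q \<and> (\<exists>v\<in>E. ?q v \<noteq> 0) \<and> ?q x = 0 \<and> ?q y = 0 \<and> ?q x' = 0 \<and> ?q y' = 0"
    using Yeq Y(1) dist by (intro pencil_of_conics[OF L assms(3,4)]) auto
  have "?q z = 0" by (simp add: algebra_simps)
  then have "Y \<subseteq> {x \<in> X. ?q x = 0}" using q Yeq Y(1) by auto
  then have "5 \<le> card {x \<in> X. ?q x = 0}"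
    using card_mono[of "{x \<in> X. ?q x = 0}" Y] Y(2) proj_distinct_finite[OF assms(1)] by simp
  then show ?thesis using q by blast
qed

lemma card_zeros_nonzeros:
  assumes "finite X"
  shows "card X = card {x \<in> X. g x = 0} + card {x \<in> X. g x \<noteq> (0::complex)}"
proof -
  have "card X = card ({x \<in> X. g x = 0} \<union> {x \<in> X. g x \<noteq> 0})" by (rule arg_cong[of _ _ card]) auto
  also have "\<dots> = card {x \<in> X. g x = 0} + card {x \<in> X. g x \<noteq> 0}"
    using assms by (intro card_Un_disjoint) auto
  finally show ?thesis .
qed

text \<open>
Suppose that no conic contains six of the \<open>3 d - 1\<close> points. Then residuation and the classification
in lower degrees imply that a form of degree \<open>i\<close>, \<open>0 < i < d\<close>, with at least \<open>3 i\<close> zeros on \<open>X\<close> vanishes on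
\<open>X\<close>. Let \<open>\<Phi> k\<close> say that already \<open>3 k - 1\<close> zeros suffice for forms of degree \<open>k\<close>. This is true for
\<open>k = d - 1\<close> and, since there are conics through any five points, false for \<open>k = 2\<close>; so for some \<open>k\<close> it
fails for \<open>k\<close> and holds for \<open>k + 1\<close>.

Take \<open>G\<close> of degree \<open>k\<close> with zero set \<open>C\<close> of exactly \<open>3 k - 1\<close> points, and \<open>G'\<close> whose zero set arises
from \<open>C\<close> by exchanging one point \<open>y'\<close> for another point \<open>y\<close>. For a further point \<open>x\<close>, the forms
\<open>L x y * G\<close> and \<open>L x y' * G'\<close> have the same \<open>3 k + 1\<close> zeros, hence by \<open>\<Phi> (k + 1)\<close> are proportional
on \<open>X\<close>. The quotient of \<open>G\<close> and \<open>G'\<close> does not depend on \<open>x\<close>, so comparing two choices \<open>x\<close>, \<open>x'\<close>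
eliminates it and leaves a conic of the pencil through \<open>x\<close>, \<open>y\<close>, \<open>x'\<close>, \<open>y'\<close> that contains
\<open>X - C\<close> and \<open>y'\<close>: at least seven points.
\<close>

lemma extremal_general_position_on_conic:
  assumes cb: "cayley_bacharach d X" and pd: "proj_distinct X" and gp: "general_position X"
    and E: "cvs.subspace E" "X \<subseteq> E" and card: "card X + 1 = 3 * d" and d: "d \<ge> 3"
    and conic: "\<And>k Y. k < d \<Longrightarrow> Y \<subseteq> X \<Longrightarrow> cayley_bacharach k Y \<Longrightarrow> card Y < 3 * k \<Longrightarrow>
          \<exists>q. hform 2 q \<and> (\<exists>v\<in>E. q v \<noteq> 0) \<and> (\<forall>y\<in>Y. q y = 0)"
  shows "\<exists>q. hform 2 q \<and> (\<exists>v\<in>E. q v \<noteq> 0) \<and> card {x \<in> X. q x = 0} \<ge> 6"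
proof (rule ccontr)
  assume neg: "\<not> ?thesis"
  have fin: "finite X" using pd proj_distinct_finite by blast
  have no6: "card {x \<in> X. q x = 0} \<le> 5" if "hform 2 q" "\<exists>v\<in>E. q v \<noteq> 0" for q
  proof -
    have "\<not> 6 \<le> card {x \<in> X. q x = 0}"
    proof
      assume "6 \<le> card {x \<in> X. q x = 0}"
      with that have "\<exists>q. hform 2 q \<and> (\<exists>v\<in>E. q v \<noteq> 0) \<and> 6 \<le> card {x \<in> X. q x = 0}"
        by (intro exI[of _ q] conjI)
      with neg show False ..
    qed
    then show ?thesis by simp
  qed
  have small_empty: "Y = {}" if Y: "k < d" "Y \<subseteq> X" "cayley_bacharach k Y" "card Y < 3 * k" for k Y
  proof (rule ccontr)
    assume "Y \<noteq> {}"
    then have ge: "card Y \<ge> 2 * k + 2"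
      using cayley_bacharach_general_position_card[OF Y(3) pd gp Y(2)] by simp
    obtain q where q: "hform 2 q" "\<exists>v\<in>E. q v \<noteq> 0" "\<forall>y\<in>Y. q y = 0" using conic[OF Y] by blast
    have "card Y \<le> card {x \<in> X. q x = 0}" using q(3) Y(2) fin by (intro card_mono) auto
    then have "card Y \<le> 5" using no6[OF q(1,2)] by simp
    then show False using ge Y(4) by simp
  qed
  have zeros_bound: "\<forall>x\<in>X. G x = 0"
    if G: "hform i G" "1 \<le> i" "i < d" "3 * i \<le> card {x \<in> X. G x = 0}" for i G
  proof -
    have cbi: "cayley_bacharach (d - i) {x \<in> X. G x \<noteq> 0}"
      using cayley_bacharach_residual[OF cb G(1)] G(3) by simp
    have "card {x \<in> X. G x \<noteq> 0} < 3 * (d - i)"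
      using G(3,4) card card_zeros_nonzeros[OF fin, of G] by simp
    then have "{x \<in> X. G x \<noteq> 0} = {}" using small_empty[OF _ _ cbi] G(2,3) by auto
    then show ?thesis by blast
  qed
  define \<Phi> where "\<Phi> k \<longleftrightarrow> (\<forall>G. hform k G \<longrightarrow> 3 * k \<le> card {x \<in> X. G x = 0} + 1 \<longrightarrow> (\<forall>x\<in>X. G x = 0))" for k
  have top: "\<Phi> (d - 1)"
    unfolding \<Phi>_def
  proof (intro allI impI)
    fix G assume G: "hform (d - 1) G" "3 * (d - 1) \<le> card {x \<in> X. G x = 0} + 1"
    have cb1: "cayley_bacharach 1 {x \<in> X. G x \<noteq> 0}"
      using cayley_bacharach_residual[OF cb G(1)] d by simp
    have "card {x \<in> X. G x \<noteq> 0} \<le> 3" using G(2) card card_zeros_nonzeros[OF fin, of G] by simp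
    then have "{x \<in> X. G x \<noteq> 0} = {}"
      using cayley_bacharach_general_position_card[OF cb1 pd gp] by fastforce
    then show "\<forall>x\<in>X. G x = 0" by blast
  qed
  have bottom: "\<not> \<Phi> 2"
  proof
    assume "\<Phi> 2"
    obtain q where q: "hform 2 q" "\<exists>v\<in>E. q v \<noteq> 0" "card {x \<in> X. q x = 0} \<ge> 5"
      using conic_through_five_points[OF pd gp E] card d by auto
    then have "\<forall>x\<in>X. q x = 0" using \<open>\<Phi> 2\<close>[unfolded \<Phi>_def, THEN spec, of q] by linarith
    then have "{x \<in> X. q x = 0} = X" by auto
    then show False using no6[OF q(1,2)] card d by simp
  qed
  have "\<exists>k. 2 \<le> k \<and> k < d - 1 \<and> \<not> \<Phi> k \<and> \<Phi> (Suc k)"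
  proof (rule ccontr)
    assume none: "\<not> ?thesis"
    have "\<not> \<Phi> k" if "2 \<le> k" "k \<le> d - 1" for k
      using that
    proof (induction k rule: dec_induct)
      case base then show ?case using bottom by blast
    next
      case (step n)
      then have "2 \<le> n" "n < d - 1" "\<not> \<Phi> n" by auto
      then show ?case using none by blast
    qed
    then show False using top d by auto
  qed
  then obtain k where k: "2 \<le> k" "k < d - 1" and nk: "\<not> \<Phi> k" and Sk: "\<Phi> (Suc k)" by blast
  then obtain G where G: "hform k G" "3 * k \<le> card {x \<in> X. G x = 0} + 1" "\<not> (\<forall>x\<in>X. G x = 0)" unfolding \<Phi>_def by blast
  define C where "C = {x \<in> X. G x = 0}"
  have C_card: "card C + 1 = 3 * k" using zeros_bound[OF G(1)] G(2,3) k unfolding C_def by fastforce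
  have C_X: "C \<subseteq> X" "finite C" using fin by (auto simp: C_def)
  obtain y' where y': "y' \<in> C" using C_card k by fastforce
  have rest: "card (X - C) \<ge> 6"
    using C_card card k card_Diff_subset[OF C_X(2,1)] by linarith
  then have "X - C \<noteq> {}" by (metis card.empty not_numeral_le_zero)
  then obtain y where y: "y \<in> X - C" by blast
  \<comment> \<open>\<open>C\<close> imposes independent conditions, so some form separates \<open>y'\<close> from the rest of \<open>C\<close>\<close>
  have "\<exists>F. hform k F \<and> (\<forall>x\<in>C - {y'}. F x = 0) \<and> F y' \<noteq> 0"
  proof (rule ccontr)
    assume "\<not> ?thesis"
    then obtain C' where C': "C' \<subseteq> C" "y' \<in> C'" "cayley_bacharach k C'"
      using ex_cayley_bacharach_subset[OF C_X(2) y', of k] by blast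
    have "card C' \<le> card C" using C' C_X by (intro card_mono)
    then have "C' = {}" using small_empty[OF _ _ C'(3)] C' C_X C_card k by auto
    then show False using C' by blast
  qed
  then obtain F where F: "hform k F" "\<forall>x\<in>C - {y'}. F x = 0" "F y' \<noteq> 0" by blast
  have Gy: "G y \<noteq> 0" using y by (auto simp: C_def)
  \<comment> \<open>\<open>G'\<close> is zero on \<open>C\<close> with \<open>y'\<close> exchanged for \<open>y\<close>\<close>
  define G' where "G' = (\<lambda>x. G y * F x - F y * G x)"
  have G': "hform k G'" unfolding G'_def by (rule hform_diff_scale[OF F(1) G(1)])
  have G'_zero: "G' x = 0" if "x \<in> C - {y'}" for x using that F(2) by (auto simp: G'_def C_def)
  have G'_y: "G' y = 0" by (simp add: G'_def)
  have G'_y': "G' y' \<noteq> 0" using y' Gy F(3) by (simp add: G'_def C_def)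
  have G'_nz: "G' w \<noteq> 0" if w: "w \<in> X" "w \<notin> C" "w \<noteq> y" for w
  proof
    assume "G' w = 0"
    then have "insert w (insert y (C - {y'})) \<subseteq> {x \<in> X. G' x = 0}"
      using G'_zero G'_y w y C_X by auto
    then have "card (insert w (insert y (C - {y'}))) \<le> card {x \<in> X. G' x = 0}"
      using fin by (intro card_mono) auto
    moreover have "card (insert w (insert y (C - {y'}))) = Suc (Suc (card C - 1))"
      using w y y' C_X(2) by simp
    ultimately have many: "3 * k \<le> card {x \<in> X. G' x = 0}" using C_card by linarith
    have "1 \<le> k" "k < d" using k by simp_all
    from zeros_bound[OF G' this many] have "\<forall>x\<in>X. G' x = 0" .
    then show False using G'_y' y' C_X by blast
  qed
  have G_nz: "G w \<noteq> 0" if "w \<in> X" "w \<notin> C" for w using that by (simp add: C_def)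
  have "card (X - C - {y}) \<ge> 3" using rest y fin by simp
  from obtain_subset_with_card_n[OF this]
  obtain Y where Y: "Y \<subseteq> X - C - {y}" "card Y = 3" by metis
  then obtain x x' z where "Y = {x, x', z}" "x \<noteq> x'" "x' \<noteq> z" "x \<noteq> z" by (auto simp: card_3_iff)
  then have xxz: "x \<in> X - C - {y}" "x' \<in> X - C - {y}" "z \<in> X - C - {y}" "x \<noteq> x'" "x' \<noteq> z" "x \<noteq> z"
    using Y by auto
  obtain L where L: "joins X L" using ex_joins pd gp by blast
  have lin: "lin_functional (L a b)" if "a \<in> X" "b \<in> X" "a \<noteq> b" for a b
    using L that unfolding joins_def by blast
  have Lzero: "L a b a = 0" "L a b b = 0" if "a \<in> X" "b \<in> X" "a \<noteq> b" for a b
    using L that unfolding joins_def by blast+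
  have Lnz: "L a b c \<noteq> 0" if "a \<in> X" "b \<in> X" "a \<noteq> b" "c \<in> X" "c \<noteq> a" "c \<noteq> b" for a b c
    using L that unfolding joins_def by blast
  have yy: "y \<in> X" "y' \<in> X" "y \<noteq> y'" using y y' C_X by auto
  \<comment> \<open>Two forms of degree \<open>k + 1\<close> through the same \<open>3 k + 1\<close> points are proportional on \<open>X\<close>\<close>
  have proportional: "L s y w * G w * (L s y' z * G' z) = L s y z * G z * (L s y' w * G' w)"
    if s: "s \<in> X - C - {y}" "s \<noteq> z" and w: "w \<in> X" for s w
  proof -
    have sy: "s \<in> X" "s \<noteq> y" "s \<noteq> y'" using s y' by auto
    let ?H = "\<lambda>w. (L s y' z * G' z) * (L s y w * G w) - (L s y z * G z) * (L s y' w * G' w)"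
    have "hform (Suc k) ?H"
      using sy yy by (intro hform_diff_scale hform_mult_lin lin G(1) G') auto
    moreover have "insert z (insert s (insert y C)) \<subseteq> {x \<in> X. ?H x = 0}"
    proof -
      have "?H c = 0" if "c \<in> C" for c
      proof (cases "c = y'")
        case True
        then show ?thesis using that Lzero sy yy by (simp add: C_def)
      next
        case False
        then show ?thesis using that G'_zero by (simp add: C_def)
      qed
      moreover have "?H z = 0" by simp
      moreover have "?H s = 0" "?H y = 0" using Lzero sy yy G'_y by auto
      ultimately show ?thesis using sy yy xxz C_X by auto
    qed
    then have "card (insert z (insert s (insert y C))) \<le> card {x \<in> X. ?H x = 0}"
      using fin by (intro card_mono) auto
    then have "3 * Suc k \<le> card {x \<in> X. ?H x = 0} + 1"
      using s y xxz C_X C_card by auto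
    ultimately have "?H w = 0" using Sk[unfolded \<Phi>_def, THEN spec, of ?H] w by blast
    then show ?thesis by (simp add: algebra_simps)
  qed
  let ?\<alpha> = "L x y' z * L x' y z" and ?\<beta> = "L x y z * L x' y' z"
  let ?q = "\<lambda>w. ?\<alpha> * (L x y w * L x' y' w) - ?\<beta> * (L x y' w * L x' y w)"
  have dist: "distinct [x, y, x', y']" using xxz y y' by auto
  have "?\<alpha> \<noteq> 0" using Lnz xxz yy y' by auto
  then have q: "hform 2 ?q \<and> (\<exists>v\<in>E. ?q v \<noteq> 0) \<and> ?q x = 0 \<and> ?q y = 0 \<and> ?q x' = 0 \<and> ?q y' = 0"
    using xxz yy dist by (intro pencil_of_conics[OF L E]) auto
  have "?q w = 0" if w: "w \<in> X - C" for w
  proof (cases "w = y")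
    case True then show ?thesis using q by blast
  next
    case False
    have nz: "G w \<noteq> 0" "G' w \<noteq> 0" "G z \<noteq> 0" "G' z \<noteq> 0" using G_nz G'_nz w xxz False by auto
    have 1: "L x y w * G w * (L x y' z * G' z) = L x y z * G z * (L x y' w * G' w)"
      using proportional[of x w] xxz w by auto
    have 2: "L x' y w * G w * (L x' y' z * G' z) = L x' y z * G z * (L x' y' w * G' w)"
      using proportional[of x' w] xxz w by auto
    have "(L x y w * G w * (L x y' z * G' z)) * (L x' y z * G z * (L x' y' w * G' w))
       = (L x y z * G z * (L x y' w * G' w)) * (L x' y w * G w * (L x' y' z * G' z))"
      using 1 2 by simp
    then have "(G w * G' w * G z * G' z) * ?q w = 0" by (simp add: algebra_simps)
    then show ?thesis using nz by simp
  qed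
  then have "insert y' (X - C) \<subseteq> {x \<in> X. ?q x = 0}" using q yy by auto
  then have "card (insert y' (X - C)) \<le> card {x \<in> X. ?q x = 0}" using fin by (intro card_mono) auto
  then have "card {x \<in> X. ?q x = 0} \<ge> 6" using rest y' fin by simp
  then show False using no6 q by force
qed

lemma product_nonzero_on_subspace:
  assumes "lin_functional \<phi>" "lin_functional \<psi>" "cvs.subspace E" "\<exists>v\<in>E. \<phi> v \<noteq> 0" "\<exists>v\<in>E. \<psi> v \<noteq> 0"
  shows "\<exists>v\<in>E. \<phi> v * \<psi> v \<noteq> 0"
proof -
  obtain u v where uv: "u \<in> E" "\<phi> u \<noteq> 0" "v \<in> E" "\<psi> v \<noteq> 0" using assms by blast
  have "u + v \<in> E" using uv assms(3) cvs.subspace_add by blast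
  moreover have "\<phi> u * \<psi> u \<noteq> 0 \<or> \<phi> v * \<psi> v \<noteq> 0 \<or> \<phi> (u + v) * \<psi> (u + v) \<noteq> 0"
    using uv assms(1,2) by (auto simp: lin_functional_arith)
  ultimately show ?thesis using uv by blast
qed

lemma functional_vanishing_on_line:
  assumes "\<not> in_line E" "V \<in> lines"
  shows "\<exists>\<phi>. lin_functional \<phi> \<and> (\<forall>v\<in>V. \<phi> v = 0) \<and> (\<exists>v\<in>E. \<phi> v \<noteq> 0)"
proof -
  obtain x where "x \<in> E" "x \<notin> V" using assms unfolding in_line_def by blast
  then show ?thesis using functional_vanishing_on_subspace[OF lines_subspace[OF assms(2)], of x] by force
qed

lemma two_lines_on_conic:
  assumes "\<not> in_line E" "cvs.subspace E" "X \<subseteq> V \<union> V'" "V \<in> lines" "V' \<in> lines"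
  shows "\<exists>q. hform 2 q \<and> (\<exists>v\<in>E. q v \<noteq> 0) \<and> (\<forall>y\<in>X. q y = 0)"
proof -
  obtain \<phi> where \<phi>: "lin_functional \<phi>" "\<forall>v\<in>V. \<phi> v = 0" "\<exists>v\<in>E. \<phi> v \<noteq> 0"
    using functional_vanishing_on_line assms by blast
  obtain \<psi> where \<psi>: "lin_functional \<psi>" "\<forall>v\<in>V'. \<psi> v = 0" "\<exists>v\<in>E. \<psi> v \<noteq> 0"
    using functional_vanishing_on_line assms by blast
  show ?thesis
    using hform_mult_lin2[OF \<phi>(1) \<psi>(1)] product_nonzero_on_subspace[OF \<phi>(1) \<psi>(1) assms(2) \<phi>(3) \<psi>(3)]
      \<phi>(2) \<psi>(2) assms(3) by (intro exI[of _ "\<lambda>x. \<phi> x * \<psi> x"]) auto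
qed

text \<open>
If a line contains three points, the rest is on a conic by induction, and the points off that conic are
too few in degree \<open>d - 2\<close>. In general position, once some conic leaves out fewer than \<open>3 (d - 2)\<close>
points, those are on a second conic by induction; as there are at least \<open>2 d - 2\<close> of them, the second
conic contains all of \<open>X\<close>. A conic through five points serves as the first one unless \<open>X\<close> has
exactly \<open>3 d - 1\<close> points.
\<close>

lemma cayley_bacharach_on_conic:
  assumes "cayley_bacharach d X" "proj_distinct X" "card X < 3 * d"
    and E: "cvs.subspace E" "\<not> in_line E" and "X \<subseteq> E"
  shows "\<exists>q. hform 2 q \<and> (\<exists>v\<in>E. q v \<noteq> 0) \<and> (\<forall>y\<in>X. q y = 0)"
  using assms(1-3,6)
proof (induction d arbitrary: X rule: less_induct)
  case (less d X)
  have fin: "finite X" using less.prems proj_distinct_finite by blast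
  have d: "d \<ge> 1" using less.prems by auto
  show ?case
  proof (cases "in_line X")
    case True
    then show ?thesis unfolding in_line_def using two_lines_on_conic[OF E(2,1)] by blast
  next
    case nl: False
    have big: "card X \<ge> 2 * d + 2"
      using cayley_bacharach_in_line[OF less.prems(1,2)] nl by fastforce
    then have d3: "d \<ge> 3" using less.prems(3) by simp
    show ?thesis
    proof (cases "general_position X")
      case False
      then obtain V where V: "V \<in> lines" "card (X \<inter> V) \<ge> 3" unfolding general_position_def by fastforce
      have cbV: "cayley_bacharach (d - 1) (X - V)"
        using cayley_bacharach_off_subspace[OF less.prems(1) fin lines_subspace[OF V(1)] d] .
      have pdV: "proj_distinct (X - V)" using proj_distinct_subset[OF less.prems(2)] by blast
      have split: "card X = card (X \<inter> V) + card (X - V)"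
        using fin by (rule card_Int_Diff)
      show ?thesis
      proof (cases "in_line (X - V)")
        case True
        then obtain V' where "V' \<in> lines" "X - V \<subseteq> V'" unfolding in_line_def by blast
        then show ?thesis using two_lines_on_conic[OF E(2,1) _ V(1)] by blast
      next
        case False
        then have large: "card (X - V) \<ge> 2 * d"
          using cayley_bacharach_in_line[OF cbV pdV] d by linarith
        have small: "card (X - V) < 3 * (d - 1)" using split V(2) less.prems(3) by simp
        obtain q where q: "hform 2 q" "\<exists>v\<in>E. q v \<noteq> 0" "\<forall>y\<in>X - V. q y = 0"
        proof -
          have "d - 1 < d" "X - V \<subseteq> E" using d less.prems(4) by auto
          from less.IH[OF this(1) cbV pdV small this(2)] show ?thesis using that by blast
        qed
        let ?Y = "{x \<in> X. q x \<noteq> 0}"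
        have cbY: "cayley_bacharach (d - 2) ?Y"
          using cayley_bacharach_residual[OF less.prems(1) q(1)] d3 by simp
        have "?Y \<subseteq> X \<inter> V" using q(3) by auto
        then have "card ?Y \<le> card (X \<inter> V)" using fin by (intro card_mono) auto
        then have "card ?Y < d" using split large less.prems(3) by simp
        then have "?Y = {}"
          using cayley_bacharach_card[OF cbY proj_distinct_subset[OF less.prems(2)]] d3 by fastforce
        then show ?thesis using q by blast
      qed
    next
      case gp: True
      note gp_card = cayley_bacharach_general_position_card[OF _ less.prems(2) gp]
      have "\<exists>q. hform 2 q \<and> (\<exists>v\<in>E. q v \<noteq> 0) \<and> card {x \<in> X. q x \<noteq> 0} < 3 * (d - 2)"
      proof (cases "card X + 1 = 3 * d")
        case True
        have conic: "\<exists>q. hform 2 q \<and> (\<exists>v\<in>E. q v \<noteq> 0) \<and> (\<forall>y\<in>Y. q y = 0)"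
          if Y: "k < d" "Y \<subseteq> X" "cayley_bacharach k Y" "card Y < 3 * k" for k Y
          by (rule less.IH[OF Y(1,3) proj_distinct_subset[OF less.prems(2) Y(2)] Y(4)
                subset_trans[OF Y(2) less.prems(4)]])
        have "\<exists>q. hform 2 q \<and> (\<exists>v\<in>E. q v \<noteq> 0) \<and> card {x \<in> X. q x = 0} \<ge> 6"
          by (rule extremal_general_position_on_conic[OF less.prems(1,2) gp E(1) less.prems(4) True d3])
            (rule conic)
        then obtain q where q: "hform 2 q" "\<exists>v\<in>E. q v \<noteq> 0" "card {x \<in> X. q x = 0} \<ge> 6"
          by blast
        then have "card {x \<in> X. q x \<noteq> 0} < 3 * (d - 2)"
          using card_zeros_nonzeros[OF fin, of q] less.prems(3) d3 by linarith
        then show ?thesis using q by blast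
      next
        case False
        obtain q where q: "hform 2 q" "\<exists>v\<in>E. q v \<noteq> 0" "card {x \<in> X. q x = 0} \<ge> 5"
          using conic_through_five_points[OF less.prems(2) gp E(1) less.prems(4)] big d3 by auto
        then have "card {x \<in> X. q x \<noteq> 0} < 3 * (d - 2)"
          using card_zeros_nonzeros[OF fin, of q] less.prems(3) False d3 by linarith
        then show ?thesis using q by blast
      qed
      then obtain q where q: "hform 2 q" "\<exists>v\<in>E. q v \<noteq> 0" "card {x \<in> X. q x \<noteq> 0} < 3 * (d - 2)" by blast
      let ?Y = "{x \<in> X. q x \<noteq> 0}"
      have cbY: "cayley_bacharach (d - 2) ?Y"
        using cayley_bacharach_residual[OF less.prems(1) q(1)] d3 by simp
      show ?thesis
      proof (cases "?Y = {}")
        case True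
        then show ?thesis using q by blast
      next
        case False
        then have Y: "card ?Y \<ge> 2 * (d - 2) + 2" using gp_card[OF cbY] by blast
        obtain q' where q': "hform 2 q'" "\<exists>v\<in>E. q' v \<noteq> 0" "\<forall>y\<in>?Y. q' y = 0"
        proof -
          have "d - 2 < d" "?Y \<subseteq> X" "?Y \<subseteq> E" using d3 less.prems(4) by auto
          from less.IH[OF this(1) cbY proj_distinct_subset[OF less.prems(2) this(2)] q(3) this(3)]
          show ?thesis using that by blast
        qed
        let ?Z = "{x \<in> X. q' x \<noteq> 0}"
        have cbZ: "cayley_bacharach (d - 2) ?Z"
          using cayley_bacharach_residual[OF less.prems(1) q'(1)] d3 by simp
        have "card ?Y \<le> card {x \<in> X. q' x = 0}" using q'(3) fin by (intro card_mono) auto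
        then have "card ?Z < 2 * (d - 2) + 2"
          using card_zeros_nonzeros[OF fin, of q'] Y q(3) less.prems(3) d3 by linarith
        then have "?Z = {}" using gp_card[OF cbZ] by fastforce
        then show ?thesis using q' by blast
      qed
    qed
  qed
qed

text \<open>
Take a plane with as many points as possible. The points off it are collinear: otherwise there are
at least \<open>2 d\<close> of them, in a plane or in two lines by induction, which puts too many points into the
first plane. So at least \<open>d + 1\<close> points are on a line, and at most \<open>2 (d - 1)\<close> are left for the second
line.
\<close>

lemma cayley_bacharach_in_plane_or_two_lines:
  assumes "cayley_bacharach d X" "proj_distinct X" "card X < 3 * d"
  shows "in_two_lines X \<or> (\<exists>E\<in>planes. X \<subseteq> E)"
  using assms
proof (induction d arbitrary: X rule: less_induct)
  case (less d X)
  have fin: "finite X" using less.prems proj_distinct_finite by blast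
  have d: "d \<ge> 1" using less.prems by auto
  obtain E where E: "E \<in> planes" and max: "\<And>E'. E' \<in> planes \<Longrightarrow> card (X \<inter> E') \<le> card (X \<inter> E)"
  proof -
    have "cvs.span {0 :: 'a \<Rightarrow> complex, 0, 0} \<in> planes" unfolding planes_def by blast
    then have "(planes :: ('a \<Rightarrow> complex) set set) \<noteq> {}" by (metis empty_iff)
    from subset_with_maximal_trace[OF fin this] obtain E
      where E: "E \<in> planes" "\<forall>E'\<in>planes. card (X \<inter> E') \<le> card (X \<inter> E)" ..
    show ?thesis by (rule that[OF E(1)]) (rule bspec[OF E(2)])
  qed
  show ?case
  proof (cases "X \<subseteq> E")
    case True
    then show ?thesis using E by blast
  next
    case False
    have cbE: "cayley_bacharach (d - 1) (X - E)"
      using cayley_bacharach_off_subspace[OF less.prems(1) fin planes_subspace[OF E] d] .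
    have pdE: "proj_distinct (X - E)" using proj_distinct_subset[OF less.prems(2)] by blast
    have split: "card X = card (X \<inter> V) + card (X - V)" for V
      using fin by (rule card_Int_Diff)
    have card_X: "card X \<ge> 3"
    proof -
      have "X \<noteq> {}" using False by blast
      from cayley_bacharach_card[OF less.prems(1,2) this] show ?thesis using d by simp
    qed
    have E3: "card (X \<inter> E) \<ge> 3"
    proof -
      from obtain_subset_with_card_n[OF card_X] obtain Y where Y: "Y \<subseteq> X" "card Y = 3" by metis
      then obtain u v w where uvw: "Y = {u, v, w}" by (auto simp: card_3_iff)
      then have "Y \<subseteq> X \<inter> cvs.span {u, v, w}" using Y(1) cvs.span_superset[of Y] by simp
      then have "card Y \<le> card (X \<inter> cvs.span {u, v, w})" using fin by (intro card_mono) auto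
      also have "\<dots> \<le> card (X \<inter> E)" by (rule max) (auto simp: planes_def)
      finally show ?thesis using Y by simp
    qed
    have "in_line (X - E)"
    proof (rule ccontr)
      assume nl: "\<not> in_line (X - E)"
      then have large: "card (X - E) \<ge> 2 * d"
        using cayley_bacharach_in_line[OF cbE pdE] d by linarith
      have half: "card (X \<inter> E) \<ge> d" 
      proof -
        have "in_two_lines (X - E) \<or> (\<exists>E'\<in>planes. X - E \<subseteq> E')"
          by (rule less.IH[OF _ cbE pdE]) (use split[of E] E3 d less.prems(3) in linarith)+
        then show ?thesis
        proof
          assume "in_two_lines (X - E)"
          then obtain V V' where V: "V \<in> lines" "V' \<in> lines" "X - E \<subseteq> V \<union> V'"
            unfolding in_two_lines_def by blast
          have "card (X - E) \<le> card ((X \<inter> V) \<union> (X \<inter> V'))" using V fin by (intro card_mono) auto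
          also have "\<dots> \<le> card (X \<inter> V) + card (X \<inter> V')" by (rule card_Un_le)
          finally have "d \<le> card (X \<inter> V) \<or> d \<le> card (X \<inter> V')" using large by linarith
          then obtain V'' where V'': "V'' \<in> lines" "d \<le> card (X \<inter> V'')" using V by blast
          obtain E' where E': "E' \<in> planes" "V'' \<subseteq> E'" using line_in_plane[OF V''(1)] by blast
          have "card (X \<inter> V'') \<le> card (X \<inter> E')" using E' fin by (intro card_mono) auto
          then show ?thesis using V'' max[OF E'(1)] by linarith
        next
          assume "\<exists>E'\<in>planes. X - E \<subseteq> E'"
          then obtain E' where E': "E' \<in> planes" "X - E \<subseteq> E'" by blast
          have "card (X - E) \<le> card (X \<inter> E')" using E' fin by (intro card_mono) auto
          then show ?thesis using large max[OF E'(1)] by linarith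
        qed
      qed
      then show False using large split[of E] less.prems(3) by simp
    qed
    then obtain V where V: "V \<in> lines" "X - E \<subseteq> V" unfolding in_line_def by blast
    have "card (X - E) \<ge> (d - 1) + 2" using cayley_bacharach_card[OF cbE pdE] False by blast
    moreover have "card (X - E) \<le> card (X \<inter> V)" using V fin by (intro card_mono) auto
    ultimately have "card (X - V) \<le> 2 * (d - 1) + 1" using split[of V] less.prems(3) by simp
    then have "in_line (X - V)"
      using cayley_bacharach_off_subspace[OF less.prems(1) fin lines_subspace[OF V(1)] d]
        proj_distinct_subset[OF less.prems(2)] by (intro cayley_bacharach_in_line) auto
    then show ?thesis using V(1) unfolding in_line_def in_two_lines_def by blast
  qed
qed

section \<open>Coefficients of forms\<close>

lemma finite_exps: "finite (exps m d)"
  using card_exps[of m d] by (intro card_ge_0_finite) simp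

lemma lin_functional_coordinate: "lin_functional (\<lambda>x. x i)"
  by (rule lin_functionalI) (simp_all add: cscale_def)

lemma lin_functional_coefficients: "lin_functional (\<lambda>x. \<Sum>i\<in>I. h i * x i)"
  by (rule lin_functionalI) (simp_all add: cscale_def sum.distrib sum_distrib_left algebra_simps)

lemma hform_zero: "hform d (\<lambda>x. 0)"
proof (induction d)
  case 0 show ?case by (rule hform_const)
next
  case (Suc d)
  have "lin_functional (\<lambda>x. 0)" by (rule functionals.linear_zero)
  from hform_mult_lin[OF this Suc] show ?case by simp
qed

lemma hform_sum: "(\<And>a. a \<in> A \<Longrightarrow> hform d (f a)) \<Longrightarrow> hform d (\<lambda>x. \<Sum>a\<in>A. f a x)"
  by (induction A rule: infinite_finite_induct) (auto intro: hform_zero hform_add)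

lemma hform_prod_powers:
  "finite F \<Longrightarrow> hform (\<Sum>i\<in>F. a i) (\<lambda>x. \<Prod>i\<in>F. x i ^ a i)"
proof (induction F rule: finite_induct)
  case empty show ?case using hform_const[of 1] by simp
next
  case (insert i F)
  have "hform n (\<lambda>x. x i ^ n)" for n
    by (induction n) (auto intro: hform_const hform_mult_lin[OF lin_functional_coordinate])
  from hform_mult[OF this[of "a i"] insert.IH] show ?case using insert by simp
qed

lemma hform_monomial: "a \<in> exps m d \<Longrightarrow> hform d (\<lambda>x. \<Prod>i\<le>m. x i ^ a i)"
  using hform_prod_powers[of "{..m}" a] by (simp add: exps_def)

lemma hform_form_eval: "hform d (form_eval m d g)"
  unfolding form_eval_def[abs_def] by (intro hform_sum hform_scale hform_monomial)

lemma form_eval_monomials: "form_eval m d g x = (\<Sum>a\<in>exps m d. g a * monomials m d x a)"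
  unfolding form_eval_def monomials_def by (intro sum.cong) auto

text \<open>
The coefficients of the product are real if those of the factors are; this is what makes a product of
two real linear forms a real conic.
\<close>

lemma form_eval_mult_linear:
  assumes "g \<in> coord_space (exps m d)"
  shows "\<exists>g'\<in>coord_space (exps m (Suc d)).
     (g \<in> real_vecs \<longrightarrow> (\<forall>i. h i \<in> \<real>) \<longrightarrow> g' \<in> real_vecs) \<and>
     (\<forall>x. (\<Sum>i\<le>m. h i * x i) * form_eval m d g x = form_eval m (Suc d) g' x)"
proof -
  define g' where "g' = (\<lambda>b. if b \<in> exps m (Suc d) then
      \<Sum>i\<le>m. if b i > 0 then h i * g (b(i := b i - 1)) else 0 else 0)"
  have "g' \<in> coord_space (exps m (Suc d))" by (auto simp: coord_space_def g'_def)
  moreover have "g' \<in> real_vecs" if "g \<in> real_vecs" "\<forall>i. h i \<in> \<real>"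
    using that by (auto simp: real_vecs_def g'_def intro!: sum_in_Reals)
  moreover have "(\<Sum>i\<le>m. h i * x i) * form_eval m d g x = form_eval m (Suc d) g' x" for x
  proof -
    let ?mon = "\<lambda>a. \<Prod>j\<le>m. x j ^ a j"
    have step: "x i * form_eval m d g x
        = (\<Sum>b\<in>exps m (Suc d). (if b i > 0 then g (b(i := b i - 1)) else 0) * ?mon b)" if i: "i \<le> m" for i
    proof -
      have mon: "?mon (a(i := Suc (a i))) = x i * ?mon a" for a
      proof -
        have "?mon (a(i := Suc (a i))) = x i ^ Suc (a i) * (\<Prod>j\<in>{..m} - {i}. x j ^ (a(i := Suc (a i))) j)"
          using i by (subst prod.remove[of _ i]) auto
        also have "(\<Prod>j\<in>{..m} - {i}. x j ^ (a(i := Suc (a i))) j) = (\<Prod>j\<in>{..m} - {i}. x j ^ a j)"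
          by (intro prod.cong) auto
        also have "x i ^ Suc (a i) * \<dots> = x i * ?mon a"
          using i by (subst (2) prod.remove[of _ i]) auto
        finally show ?thesis .
      qed
      have sum_upd: "(\<Sum>j\<le>m. (a(i := k)) j) + a i = (\<Sum>j\<le>m. a j) + k" for a :: "nat \<Rightarrow> nat" and k
      proof -
        have "(\<Sum>j\<le>m. (a(i := k)) j) = k + (\<Sum>j\<in>{..m} - {i}. (a(i := k)) j)"
          using i by (subst sum.remove[of _ i]) auto
        also have "(\<Sum>j\<in>{..m} - {i}. (a(i := k)) j) = (\<Sum>j\<in>{..m} - {i}. a j)"
          by (intro sum.cong) auto
        finally show ?thesis using i by (subst (2) sum.remove[of _ i]) auto
      qed
      have "x i * form_eval m d g x = (\<Sum>a\<in>exps m d. g a * ?mon (a(i := Suc (a i))))"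
        unfolding form_eval_def sum_distrib_left by (intro sum.cong) (simp_all only: mon mult.left_commute)
      also have "\<dots> = (\<Sum>b\<in>{b \<in> exps m (Suc d). b i > 0}. g (b(i := b i - 1)) * ?mon b)"
      proof (rule sum.reindex_bij_witness[of _ "\<lambda>b. b(i := b i - 1)" "\<lambda>a. a(i := Suc (a i))"])
        fix a assume a: "a \<in> exps m d"
        show "a(i := Suc (a i)) \<in> {b \<in> exps m (Suc d). b i > 0}"
          using a sum_upd[of a "Suc (a i)"] i by (auto simp: exps_def)
      next
        fix b assume b: "b \<in> {b \<in> exps m (Suc d). b i > 0}"
        show "b(i := b i - 1) \<in> exps m d"
          using b sum_upd[of b "b i - 1"] i by (auto simp: exps_def)
      qed (auto simp: fun_eq_iff)
      also have "\<dots> = (\<Sum>b\<in>exps m (Suc d). (if b i > 0 then g (b(i := b i - 1)) else 0) * ?mon b)"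
        by (intro sum.mono_neutral_cong_left finite_exps) auto
      finally show ?thesis .
    qed
    have "(\<Sum>i\<le>m. h i * x i) * form_eval m d g x = (\<Sum>i\<le>m. h i * (x i * form_eval m d g x))"
      by (simp add: sum_distrib_right mult.assoc)
    also have "\<dots> = (\<Sum>i\<le>m. \<Sum>b\<in>exps m (Suc d). (if b i > 0 then h i * g (b(i := b i - 1)) else 0) * ?mon b)"
      by (intro sum.cong refl) (auto simp: step sum_distrib_left intro!: sum.cong)
    also have "\<dots> = (\<Sum>b\<in>exps m (Suc d). g' b * ?mon b)"
      by (subst sum.swap) (auto simp: g'_def sum_distrib_right intro!: sum.cong)
    finally show ?thesis by (simp add: form_eval_def)
  qed
  ultimately show ?thesis by blast
qed

definition unit_vec :: "nat \<Rightarrow> nat \<Rightarrow> complex" where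
  "unit_vec i = (\<lambda>j. if j = i then 1 else 0)"

lemma coord_space_unit_vec:
  assumes "x \<in> coord_space {..m}"
  shows "x = (\<Sum>i\<le>m. cscale (x i) (unit_vec i))"
proof
  fix j
  have "(\<Sum>i\<le>m. cscale (x i) (unit_vec i)) j = (\<Sum>i\<le>m. cscale (x i) (unit_vec i) j)"
    by (induction m) auto
  also have "\<dots> = (\<Sum>i\<le>m. if i = j then x i else 0)"
    by (intro sum.cong) (auto simp: cscale_def unit_vec_def)
  also have "\<dots> = x j" using assms by (auto simp: coord_space_def)
  finally show "x j = (\<Sum>i\<le>m. cscale (x i) (unit_vec i)) j" ..
qed

lemma lin_functional_on_coord_space:
  assumes "lin_functional \<phi>" "x \<in> coord_space {..m}"
  shows "\<phi> x = (\<Sum>i\<le>m. \<phi> (unit_vec i) * x i)"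
proof -
  have "\<phi> x = \<phi> (\<Sum>i\<le>m. cscale (x i) (unit_vec i))" using coord_space_unit_vec[OF assms(2)] by simp
  also have "\<dots> = (\<Sum>i\<le>m. \<phi> (cscale (x i) (unit_vec i)))" by (rule functionals.linear_sum[OF assms(1)])
  finally show ?thesis by (simp add: lin_functional_arith(2)[OF assms(1)] mult.commute)
qed

lemma form_eval_degree_0: "form_eval m 0 (\<lambda>a. if a \<in> exps m 0 then c else 0) x = c"
proof -
  have "exps m 0 = {\<lambda>i. 0}" by (auto simp: exps_def fun_eq_iff) (metis atMost_iff not_le)
  then show ?thesis by (simp add: form_eval_def)
qed

text \<open>
Coefficient vectors are what conics and real loci are made of, and they turn the evaluation of a form
into a linear functional on Veronese images.
\<close>

lemma hform_has_coefficients: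
  assumes "hform d f"
  shows "\<exists>g\<in>coord_space (exps m d). \<forall>x\<in>coord_space {..m}. f x = form_eval m d g x"
  using assms
proof (induction rule: hform.induct)
  case (hform_const c)
  show ?case
    by (intro bexI[of _ "\<lambda>a. if a \<in> exps m 0 then c else 0"]) (auto simp: form_eval_degree_0 coord_space_def)
next
  case (hform_mult_lin \<phi> d f)
  then obtain g where g: "g \<in> coord_space (exps m d)" "\<forall>x\<in>coord_space {..m}. f x = form_eval m d g x" by blast
  show ?case
    using form_eval_mult_linear[OF g(1), of "\<lambda>i. \<phi> (unit_vec i)"] g(2)
      lin_functional_on_coord_space[OF hform_mult_lin(1)] by metis
next
  case (hform_add d f f')
  then obtain g g' where "g \<in> coord_space (exps m d)" "\<forall>x\<in>coord_space {..m}. f x = form_eval m d g x"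
    "g' \<in> coord_space (exps m d)" "\<forall>x\<in>coord_space {..m}. f' x = form_eval m d g' x" by blast
  then show ?case
    by (intro bexI[of _ "\<lambda>a. g a + g' a"])
      (auto simp: coord_space_def form_eval_def sum.distrib distrib_right)
qed

lemma hform_1_linear:
  assumes "hform 1 f" shows "lin_functional f"
proof -
  have "(d = 0 \<longrightarrow> (\<exists>c. f = (\<lambda>x. c))) \<and> (d = 1 \<longrightarrow> lin_functional f)" if "hform d f" for d f
    using that
  proof (induction rule: hform.induct)
    case (hform_const c) then show ?case by auto
  next
    case (hform_mult_lin \<phi> d f)
    have "lin_functional (\<lambda>x. c * \<phi> x)" for c
      by (rule functionals.linear_compose_scale_right[OF hform_mult_lin(1)])
    then show ?case using hform_mult_lin by (auto simp: mult.commute)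
  next
    case (hform_add d f g)
    then show ?case by (auto intro: functionals.linear_compose_add)
  qed
  then show ?thesis using assms by blast
qed

section \<open>Shortest decompositions in a vector space\<close>

lemma (in vector_space) span_image_sum:
  assumes "finite S"
  shows "v \<in> span (g ` S) \<longleftrightarrow> (\<exists>a. v = (\<Sum>s\<in>S. scale (a s) (g s)))"
proof
  show "\<exists>a. v = (\<Sum>s\<in>S. scale (a s) (g s))" if "v \<in> span (g ` S)"
    using assms that
  proof (induction S arbitrary: v rule: finite_induct)
    case (insert s S)
    then obtain k where "v - scale k (g s) \<in> span (g ` S)" using span_breakdown_eq by auto
    then obtain a where a: "v - scale k (g s) = (\<Sum>s\<in>S. scale (a s) (g s))" using insert.IH by blast
    have "(\<Sum>t\<in>S. scale ((a(s := k)) t) (g t)) = (\<Sum>t\<in>S. scale (a t) (g t))"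
      using insert.hyps by (intro sum.cong) auto
    then have "v = (\<Sum>t\<in>insert s S. scale ((a(s := k)) t) (g t))"
      using insert.hyps a by (simp add: algebra_simps)
    then show ?case by blast
  qed simp
next
  assume "\<exists>a. v = (\<Sum>s\<in>S. scale (a s) (g s))"
  then obtain a where "v = (\<Sum>s\<in>S. scale (a s) (g s))" ..
  moreover have "(\<Sum>s\<in>S. scale (a s) (g s)) \<in> span (g ` S)"
    by (intro span_sum span_scale span_base) auto
  ultimately show "v \<in> span (g ` S)" by simp
qed

text \<open>
The common form of both ranks: over the complex or the real numbers, \<open>S\<close> is a smallest set of
admissible points with \<open>v\<close> in the span of their images under \<open>g\<close>.
\<close>

definition (in vector_space) spans_minimally :: "'p set \<Rightarrow> ('p \<Rightarrow> 'b) \<Rightarrow> 'p set \<Rightarrow> 'b \<Rightarrow> bool" where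
  "spans_minimally U g S v \<longleftrightarrow> S \<subseteq> U \<and> finite S \<and> v \<in> span (g ` S) \<and>
     (\<forall>S'. S' \<subseteq> U \<longrightarrow> finite S' \<longrightarrow> v \<in> span (g ` S') \<longrightarrow> card S \<le> card S')"

text \<open>
A shorter decomposition of the partial sum, completed by the other summands, would be a shorter
decomposition of the whole.
\<close>

lemma (in vector_space) spans_minimally_part:
  assumes "spans_minimally U g S (\<Sum>s\<in>S. scale (a s) (g s))"
  shows "spans_minimally U g (S \<inter> Y) (\<Sum>s\<in>S \<inter> Y. scale (a s) (g s))"
proof -
  have S: "S \<subseteq> U" "finite S" using assms by (auto simp: spans_minimally_def)
  have "card (S \<inter> Y) \<le> card S'"
    if S': "S' \<subseteq> U" "finite S'" "(\<Sum>s\<in>S \<inter> Y. scale (a s) (g s)) \<in> span (g ` S')" for S'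
  proof -
    have "(\<Sum>s\<in>S. scale (a s) (g s))
        = (\<Sum>s\<in>S \<inter> Y. scale (a s) (g s)) + (\<Sum>s\<in>S - Y. scale (a s) (g s))"
      using sum.Int_Diff[OF S(2)] by blast
    moreover have "(\<Sum>s\<in>S \<inter> Y. scale (a s) (g s)) \<in> span (g ` (S' \<union> (S - Y)))"
      using S'(3) span_mono[of "g ` S'" "g ` (S' \<union> (S - Y))"] by blast
    moreover have "(\<Sum>s\<in>S - Y. scale (a s) (g s)) \<in> span (g ` (S' \<union> (S - Y)))"
      by (intro span_sum span_scale span_base) auto
    ultimately have "(\<Sum>s\<in>S. scale (a s) (g s)) \<in> span (g ` (S' \<union> (S - Y)))"
      using span_add by metis
    then have "card S \<le> card (S' \<union> (S - Y))"
      using assms S S' unfolding spans_minimally_def by (metis Diff_subset Un_least finite_Diff finite_Un subset_trans)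
    also have "\<dots> \<le> card S' + card (S - Y)" by (rule card_Un_le)
    finally show ?thesis
      using card_Diff_subset_Int[of S Y] S(2) card_mono[of S "S \<inter> Y"] by (simp add: le_diff_conv)
  qed
  moreover have "(\<Sum>s\<in>S \<inter> Y. scale (a s) (g s)) \<in> span (g ` (S \<inter> Y))"
    by (intro span_sum span_scale span_base) auto
  ultimately show ?thesis using S unfolding spans_minimally_def by auto
qed

lemma (in vector_space) spans_minimally_nonzero:
  assumes "spans_minimally U g S v" "S \<noteq> {}" shows "v \<noteq> 0"
proof
  assume "v = 0"
  have "v \<in> span (g ` {})" using \<open>v = 0\<close> by simp
  then have "card S \<le> card ({} :: 'c set)"
    using assms(1)[unfolded spans_minimally_def, THEN conjunct2, THEN conjunct2, THEN conjunct2,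
        rule_format, of "{}"] by simp
  moreover have "finite S" using assms(1) by (simp add: spans_minimally_def)
  ultimately show False using assms(2) by simp
qed

lemma (in vector_space) spans_minimally_coefficient:
  assumes "spans_minimally U g S (\<Sum>s\<in>S. scale (a s) (g s))" "s \<in> S"
  shows "a s \<noteq> 0"
  using spans_minimally_nonzero[OF spans_minimally_part[OF assms(1), of "{s}"]] assms(2) by auto

lemma (in vector_space) independent_spans:
  assumes "independent B" "finite A" "B \<subseteq> span A" "card A \<le> card B"
  shows "span B = span A"
proof -
  have "z \<in> span B" if "z \<in> A" for z
  proof (rule ccontr)
    assume z: "z \<notin> span B"
    then have "independent (insert z B)" using assms(1) independent_insertI by blast
    moreover have "insert z B \<subseteq> span A" using assms(3) that span_base by blast
    ultimately have "finite (insert z B) \<and> card (insert z B) \<le> card A"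
      by (rule independent_span_bound[OF assms(2)])
    moreover have "z \<notin> B" using z span_base by blast
    ultimately show False using assms(4) by auto
  qed
  then have "span A \<subseteq> span B" by (meson span_minimal subsetI subspace_span)
  moreover have "span B \<subseteq> span A" using assms(3) by (simp add: span_minimal)
  ultimately show ?thesis by blast
qed

section \<open>Ranks in terms of representing vectors\<close>

lemma coord_space_subspace: "cvs.subspace (coord_space I)"
  by (auto simp: cvs.subspace_def coord_space_def cscale_def)

lemma rscale_cscale: "rscale r = cscale (of_real r)"
  by (simp add: rscale_def cscale_def fun_eq_iff)

lemma real_vecs_subspace: "rvs.subspace real_vecs"
  by (auto simp: rvs.subspace_def real_vecs_def rscale_def)

lemma point_of_subset: "cvs.subspace V \<Longrightarrow> point_of v \<subseteq> V \<longleftrightarrow> v \<in> V"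
  unfolding point_of_def using cvs.span_minimal[of "{v}" V] cvs.span_base[of v "{v}"] by blast

lemma rvs_span_subset_cvs_span: "rvs.span A \<subseteq> cvs.span A"
proof (rule rvs.span_minimal)
  show "A \<subseteq> cvs.span A" by (rule cvs.span_superset)
  show "rvs.subspace (cvs.span A)"
    by (auto simp: rvs.subspace_def rscale_cscale intro: cvs.span_zero cvs.span_add cvs.span_scale)
qed

lemma point_of_real_vecs:
  assumes "w \<in> real_vecs"
  shows "point_of w \<inter> real_vecs = rvs.span {w}"
proof
  show "rvs.span {w} \<subseteq> point_of w \<inter> real_vecs"
    unfolding point_of_def
    using rvs_span_subset_cvs_span[of "{w}"] rvs.span_minimal[OF _ real_vecs_subspace, of "{w}"] assms by auto
  show "point_of w \<inter> real_vecs \<subseteq> rvs.span {w}"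
  proof
    fix u assume "u \<in> point_of w \<inter> real_vecs"
    then obtain c where u: "u = cscale c w" "u \<in> real_vecs" by (auto simp: point_of_def cvs.span_singleton)
    show "u \<in> rvs.span {w}"
    proof (cases "w = 0")
      case True then show ?thesis using u by (simp add: cvs.scale_zero_right rvs.span_zero)
    next
      case False
      then obtain i where i: "w i \<noteq> 0" by (auto simp: fun_eq_iff)
      have "c * w i \<in> \<real>" "w i \<in> \<real>" using u assms by (auto simp: real_vecs_def cscale_def)
      then have "c * w i / w i \<in> \<real>" by (rule Reals_divide)
      then have "c \<in> \<real>" using i by simp
      then obtain r where "c = of_real r" by (auto simp: Reals_def)
      then show ?thesis using u(1) by (auto simp: rvs.span_singleton rscale_cscale)
    qed
  qed
qed

lemma point_of_eq:
  assumes "x \<in> point_of v" "x \<noteq> 0" shows "point_of x = point_of v"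
proof -
  obtain c where c: "x = cscale c v" using assms(1) by (auto simp: point_of_def cvs.span_singleton)
  then have "c \<noteq> 0" using assms(2) by (metis cvs.scale_zero_left)
  then have "v = cscale (1 / c) x" using c by (simp add: cscale_def fun_eq_iff)
  then have "v \<in> point_of x" by (auto simp: point_of_def cvs.span_singleton)
  then show ?thesis
    unfolding point_of_def using c cvs.span_minimal[of "{v}" "cvs.span {x}"] cvs.span_minimal[of "{x}" "cvs.span {v}"]
      assms(1) by (auto simp: point_of_def)
qed

text \<open>
A representing vector, chosen real for real points, so that one choice serves both decompositions.
\<close>

definition rep :: "'i point \<Rightarrow> 'i \<Rightarrow> complex" where
  "rep p = (if \<exists>v. v \<in> real_vecs \<and> v \<noteq> 0 \<and> p = point_of v
     then SOME v. v \<in> real_vecs \<and> v \<noteq> 0 \<and> p = point_of v else SOME v. v \<noteq> 0 \<and> p = point_of v)"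

lemma rep_props:
  assumes "p \<in> proj I"
  shows "rep p \<noteq> 0" "point_of (rep p) = p" "rep p \<in> coord_space I"
proof -
  have 1: "rep p \<noteq> 0 \<and> p = point_of (rep p)"
  proof (cases "\<exists>v. v \<in> real_vecs \<and> v \<noteq> 0 \<and> p = point_of v")
    case True
    then show ?thesis using someI_ex[OF True] by (simp add: rep_def)
  next
    case False
    have "\<exists>v. v \<noteq> 0 \<and> p = point_of v" using assms by (auto simp: proj_def)
    then show ?thesis using someI_ex[of "\<lambda>v. v \<noteq> 0 \<and> p = point_of v"] False unfolding rep_def by argo
  qed
  then show "rep p \<noteq> 0" "point_of (rep p) = p" by auto
  obtain v where v: "v \<in> coord_space I" "p = point_of v" using assms by (auto simp: proj_def)
  then have "p \<subseteq> coord_space I" using point_of_subset[OF coord_space_subspace] by blast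
  then show "rep p \<in> coord_space I" using 1 point_of_subset[OF coord_space_subspace] by metis
qed

lemma real_proj_subset: "real_proj I \<subseteq> proj I"
  by (auto simp: real_proj_def proj_def)

lemma rep_real:
  assumes "p \<in> real_proj I" shows "rep p \<in> real_vecs"
proof -
  have ex: "\<exists>v. v \<in> real_vecs \<and> v \<noteq> 0 \<and> p = point_of v" using assms by (auto simp: real_proj_def)
  then show ?thesis using someI_ex[OF ex] by (simp add: rep_def)
qed

lemma rep_subspace:
  assumes "p \<in> proj I" "cvs.subspace V" shows "p \<subseteq> V \<longleftrightarrow> rep p \<in> V"
  using point_of_subset[OF assms(2), of "rep p"] rep_props(2)[OF assms(1)] by simp

lemma rep_eqI:
  assumes "p \<in> proj I" "q \<in> proj I" "rep q \<in> cvs.span {rep p}" shows "q = p"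
  using point_of_eq[of "rep q" "rep p"] assms rep_props[of _ I] by (metis point_of_def)

definition veronese_vec :: "nat \<Rightarrow> nat \<Rightarrow> nat point \<Rightarrow> (nat \<Rightarrow> nat) \<Rightarrow> complex" where
  "veronese_vec m d p = monomials m d (rep p)"

lemma veronese_rep: "p \<in> PP m \<Longrightarrow> veronese m d p = cvs.span {veronese_vec m d p}"
  using veronese_point_of[of m d "rep p"] rep_props(2)[of p] by (simp add: veronese_vec_def point_of_def)

lemma monomials_coord_space: "monomials m d x \<in> coord_space (exps m d)"
  by (simp add: monomials_def coord_space_def)

lemma monomials_real: "x \<in> real_vecs \<Longrightarrow> monomials m d x \<in> real_vecs"
  by (auto simp: monomials_def real_vecs_def intro!: prod_in_Reals Reals_power)

lemma veronese_vec_real: "p \<in> PP_real m \<Longrightarrow> veronese_vec m d p \<in> real_vecs"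
  by (simp add: veronese_vec_def monomials_real rep_real)

lemma span_veronese:
  assumes "S \<subseteq> PP m"
  shows "cvs.span (\<Union>(veronese m d ` S)) = cvs.span (veronese_vec m d ` S)"
proof
  show "cvs.span (\<Union>(veronese m d ` S)) \<subseteq> cvs.span (veronese_vec m d ` S)"
  proof (rule cvs.span_minimal)
    show "\<Union>(veronese m d ` S) \<subseteq> cvs.span (veronese_vec m d ` S)"
    proof
      fix x assume "x \<in> \<Union>(veronese m d ` S)"
      then obtain p where p: "p \<in> S" "x \<in> veronese m d p" by blast
      then have "x \<in> cvs.span {veronese_vec m d p}" using veronese_rep assms by blast
      then show "x \<in> cvs.span (veronese_vec m d ` S)"
        using cvs.span_mono[of "{veronese_vec m d p}" "veronese_vec m d ` S"] p(1) by blast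
    qed
  qed simp
  show "cvs.span (veronese_vec m d ` S) \<subseteq> cvs.span (\<Union>(veronese m d ` S))"
  proof (rule cvs.span_mono, rule subsetI)
    fix x assume "x \<in> veronese_vec m d ` S"
    then obtain p where p: "p \<in> S" "x = veronese_vec m d p" by blast
    then have "x \<in> veronese m d p" using veronese_rep[of p m d] assms cvs.span_base[of x "{x}"] by blast
    then show "x \<in> \<Union>(veronese m d ` S)" using p by blast
  qed
qed

lemma vspan_iff:
  assumes "S \<subseteq> PP m" "v \<in> coord_space (exps m d)" "v \<noteq> 0"
  shows "point_of v \<in> vspan m d S \<longleftrightarrow> v \<in> cvs.span (veronese_vec m d ` S)"
  using assms(2,3) point_of_subset[OF cvs.subspace_span, of v "veronese_vec m d ` S"]
  by (auto simp: lin_span_def span_veronese[OF assms(1)] proj_def)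

lemma real_span_veronese:
  assumes "S \<subseteq> PP_real m"
  shows "rvs.span (\<Union>(veronese m d ` S) \<inter> real_vecs) = rvs.span (veronese_vec m d ` S)"
proof
  have S: "S \<subseteq> PP m" using assms real_proj_subset by blast
  show "rvs.span (\<Union>(veronese m d ` S) \<inter> real_vecs) \<subseteq> rvs.span (veronese_vec m d ` S)"
  proof (rule rvs.span_minimal)
    show "\<Union>(veronese m d ` S) \<inter> real_vecs \<subseteq> rvs.span (veronese_vec m d ` S)"
    proof
      fix x assume "x \<in> \<Union>(veronese m d ` S) \<inter> real_vecs"
      then obtain p where p: "p \<in> S" "x \<in> veronese m d p" "x \<in> real_vecs" by blast
      then have "x \<in> point_of (veronese_vec m d p) \<inter> real_vecs"
        using veronese_rep S by (auto simp: point_of_def)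
      then have "x \<in> rvs.span {veronese_vec m d p}"
        using point_of_real_vecs veronese_vec_real p(1) assms by blast
      then show "x \<in> rvs.span (veronese_vec m d ` S)"
        using rvs.span_mono[of "{veronese_vec m d p}" "veronese_vec m d ` S"] p(1) by blast
    qed
  qed simp
  show "rvs.span (veronese_vec m d ` S) \<subseteq> rvs.span (\<Union>(veronese m d ` S) \<inter> real_vecs)"
  proof (rule rvs.span_mono, rule subsetI)
    fix x assume "x \<in> veronese_vec m d ` S"
    then obtain p where p: "p \<in> S" "x = veronese_vec m d p" by blast
    then have "x \<in> veronese m d p" using veronese_rep[of p m d] S cvs.span_base[of x "{x}"] by blast
    then show "x \<in> \<Union>(veronese m d ` S) \<inter> real_vecs" using p veronese_vec_real assms by blast
  qed
qed

lemma real_vspan_iff: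
  assumes "S \<subseteq> PP_real m" "v \<in> coord_space (exps m d)" "v \<noteq> 0" "v \<in> real_vecs"
  shows "point_of v \<in> real_vspan m d S \<longleftrightarrow> v \<in> rvs.span (veronese_vec m d ` S)"
proof -
  have "rvs.span {v} \<subseteq> rvs.span A \<longleftrightarrow> v \<in> rvs.span A" for A
    using rvs.span_minimal[of "{v}" "rvs.span A"] rvs.span_base[of v "{v}"] by blast
  moreover have "point_of v \<in> real_proj (exps m d)" using assms by (auto simp: real_proj_def)
  ultimately show ?thesis
    by (simp add: real_lin_span_def real_span_veronese[OF assms(1)] point_of_real_vecs[OF assms(4)])
qed

text \<open>
Turns the definition of the ranks into a comparison with all other spanning sets.
\<close>

lemma card_eq_Least_iff:
  assumes "Q S"
  shows "card S = (LEAST n. \<exists>S'. Q S' \<and> card S' = n) \<longleftrightarrow> (\<forall>S'. Q S' \<longrightarrow> card S \<le> card S')"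
proof -
  let ?n = "LEAST n. \<exists>S'. Q S' \<and> card S' = n"
  have "\<exists>S'. Q S' \<and> card S' = card S" using assms by auto
  then have "\<exists>S'. Q S' \<and> card S' = ?n" by (rule LeastI)
  then obtain S0 where S0: "Q S0" "card S0 = ?n" by (elim exE conjE)
  have le: "?n \<le> card S'" if "Q S'" for S'
    by (rule Least_le) (use that in \<open>intro exI[of _ S'] conjI refl\<close>)
  show ?thesis
  proof
    assume "card S = ?n"
    then show "\<forall>S'. Q S' \<longrightarrow> card S \<le> card S'" using le by simp
  next
    assume "\<forall>S'. Q S' \<longrightarrow> card S \<le> card S'"
    then have "card S \<le> ?n" using S0 by metis
    then show "card S = ?n" using le[OF assms] by simp
  qed
qed

lemma cevinces_iff:
  assumes v: "v \<in> coord_space (exps m d)" "v \<noteq> 0"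
  shows "cevinces m d S (point_of v) \<longleftrightarrow> cvs.spans_minimally (PP m) (veronese_vec m d) S v"
proof -
  define Q where "Q S \<longleftrightarrow> S \<subseteq> PP m \<and> finite S \<and> v \<in> cvs.span (veronese_vec m d ` S)" for S
  have Q: "S \<subseteq> PP m \<and> finite S \<and> point_of v \<in> vspan m d S \<and> R \<longleftrightarrow> Q S \<and> R" for S R
    unfolding Q_def by (cases "S \<subseteq> PP m") (simp_all only: vspan_iff[OF _ v] simp_thms conj_assoc)
  have "cevinces m d S (point_of v) \<longleftrightarrow> Q S \<and> card S = (LEAST n. \<exists>S'. Q S' \<and> card S' = n)"
    unfolding cevinces_def crank_def Q ..
  also have "\<dots> \<longleftrightarrow> Q S \<and> (\<forall>S'. Q S' \<longrightarrow> card S \<le> card S')"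
    using card_eq_Least_iff[of Q S] by blast
  finally show ?thesis by (simp only: cvs.spans_minimally_def Q_def conj_assoc imp_conjL)
qed

lemma revinces_iff:
  assumes v: "v \<in> coord_space (exps m d)" "v \<noteq> 0" "v \<in> real_vecs"
  shows "revinces m d S (point_of v) \<longleftrightarrow> rvs.spans_minimally (PP_real m) (veronese_vec m d) S v"
proof -
  define Q where "Q S \<longleftrightarrow> S \<subseteq> PP_real m \<and> finite S \<and> v \<in> rvs.span (veronese_vec m d ` S)" for S
  have Q: "S \<subseteq> PP_real m \<and> finite S \<and> point_of v \<in> real_vspan m d S \<and> R \<longleftrightarrow> Q S \<and> R" for S R
    unfolding Q_def by (cases "S \<subseteq> PP_real m") (simp_all only: real_vspan_iff[OF _ v] simp_thms conj_assoc)
  have "revinces m d S (point_of v) \<longleftrightarrow> Q S \<and> card S = (LEAST n. \<exists>S'. Q S' \<and> card S' = n)"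
    unfolding revinces_def rrank_def Q ..
  also have "\<dots> \<longleftrightarrow> Q S \<and> (\<forall>S'. Q S' \<longrightarrow> card S \<le> card S')"
    using card_eq_Least_iff[of Q S] by blast
  finally show ?thesis by (simp only: rvs.spans_minimally_def Q_def conj_assoc imp_conjL)
qed

section \<open>Loci defined over the reals\<close>

definition linear_locus :: "nat \<Rightarrow> (nat \<Rightarrow> complex) set \<Rightarrow> nat point set" where
  "linear_locus m V = {p \<in> PP m. p \<subseteq> V}"

lemma linear_locus_iff:
  assumes "cvs.subspace V"
  shows "p \<in> linear_locus m V \<longleftrightarrow> p \<in> PP m \<and> rep p \<in> V"
  unfolding linear_locus_def by (cases "p \<in> PP m") (simp_all add: rep_subspace[OF _ assms])

text \<open>
On real vectors, the real and the imaginary part of a linear form take the real and the imaginary part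
of its values. Both parts vanish on the real spanning set, and one of them is nonzero at \<open>x\<close>.
\<close>

lemma real_linear_form_separating:
  fixes x :: "nat \<Rightarrow> complex"
  assumes B: "B \<subseteq> real_vecs" "B \<subseteq> coord_space {..m}" and x: "x \<in> coord_space {..m}" "x \<notin> cvs.span B"
  shows "\<exists>h. (\<forall>i. h i \<in> \<real>) \<and> (\<forall>y\<in>cvs.span B. (\<Sum>i\<le>m. h i * y i) = 0) \<and> (\<Sum>i\<le>m. h i * x i) \<noteq> 0"
proof -
  obtain \<phi> where \<phi>: "lin_functional \<phi>" "\<forall>v\<in>cvs.span B. \<phi> v = 0" "\<phi> x = 1"
    using functional_vanishing_on_subspace[OF cvs.subspace_span x(2)] by blast
  let ?u = "\<lambda>i. complex_of_real (Re (\<phi> (unit_vec i)))" and ?w = "\<lambda>i. complex_of_real (Im (\<phi> (unit_vec i)))"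
  have split: "\<phi> y = (\<Sum>i\<le>m. ?u i * y i) + \<i> * (\<Sum>i\<le>m. ?w i * y i)" if "y \<in> coord_space {..m}" for y
  proof -
    have "\<phi> (unit_vec i) * y i = ?u i * y i + \<i> * (?w i * y i)" for i
      by (subst complex_eq[of "\<phi> (unit_vec i)"]) (simp only: distrib_right mult.assoc)
    then show ?thesis
      by (simp add: lin_functional_on_coord_space[OF \<phi>(1) that] sum.distrib sum_distrib_left)
  qed
  have zero: "(\<Sum>i\<le>m. ?u i * b i) = 0 \<and> (\<Sum>i\<le>m. ?w i * b i) = 0" if b: "b \<in> B" for b
  proof -
    have "(\<Sum>i\<le>m. ?u i * b i) \<in> \<real>" "(\<Sum>i\<le>m. ?w i * b i) \<in> \<real>"
      using b B(1) by (auto simp: real_vecs_def intro!: sum_in_Reals Reals_mult)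
    then obtain r s where "(\<Sum>i\<le>m. ?u i * b i) = of_real r" "(\<Sum>i\<le>m. ?w i * b i) = of_real s"
      by (auto simp: Reals_def)
    moreover have "\<phi> b = 0" using \<phi>(2) b cvs.span_base by blast
    ultimately show ?thesis using split[of b] B(2) b by (auto simp: complex_eq_iff)
  qed
  have on_span: "\<forall>y\<in>cvs.span B. (\<Sum>i\<le>m. h i * y i) = 0"
    if "\<And>b. b \<in> B \<Longrightarrow> (\<Sum>i\<le>m. h i * b i) = 0" for h :: "nat \<Rightarrow> complex"
    by (rule ballI, rule functionals.linear_eq_0_on_span[OF lin_functional_coefficients]) (rule that)
  have "(\<Sum>i\<le>m. ?u i * x i) \<noteq> 0 \<or> (\<Sum>i\<le>m. ?w i * x i) \<noteq> 0"
    using split[OF x(1)] \<phi>(3) by auto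
  then show ?thesis
  proof
    assume "(\<Sum>i\<le>m. ?u i * x i) \<noteq> 0"
    then show ?thesis using on_span[of ?u] zero by (intro exI[of _ ?u]) auto
  next
    assume "(\<Sum>i\<le>m. ?w i * x i) \<noteq> 0"
    then show ?thesis using on_span[of ?w] zero by (intro exI[of _ ?w]) auto
  qed
qed

lemma real_linear_form_coefficients:
  assumes "\<forall>i. h i \<in> \<real>"
  shows "\<exists>g\<in>coord_space (exps m 1) \<inter> real_vecs. \<forall>x. form_eval m 1 g x = (\<Sum>i\<le>m. h i * x i)"
proof -
  let ?one = "\<lambda>a. if a \<in> exps m 0 then 1 else 0"
  have "?one \<in> coord_space (exps m 0)" "?one \<in> real_vecs" by (auto simp: coord_space_def real_vecs_def)
  then show ?thesis
    using form_eval_mult_linear[of ?one m 0 h] assms by (fastforce simp: form_eval_degree_0)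
qed

lemma form_vanishes_rep:
  assumes "p \<in> PP m" shows "form_vanishes m e f p \<longleftrightarrow> form_eval m e f (rep p) = 0"
proof -
  have p: "p = range (\<lambda>c. cscale c (rep p))"
    using rep_props(2)[OF assms] by (simp add: point_of_def cvs.span_singleton)
  have hom: "form_eval m e f (cscale c (rep p)) = c ^ e * form_eval m e f (rep p)" for c
    by (rule hform_homogeneous[OF hform_form_eval])
  show ?thesis
  proof
    assume "form_vanishes m e f p"
    moreover have "cscale 1 (rep p) \<in> p" by (subst p) (rule rangeI)
    ultimately have "form_eval m e f (cscale 1 (rep p)) = 0" unfolding form_vanishes_def ..
    then show "form_eval m e f (rep p) = 0" using hom[of 1] by simp
  next
    assume 0: "form_eval m e f (rep p) = 0"
    show "form_vanishes m e f p" unfolding form_vanishes_def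
    proof
      fix x assume "x \<in> p"
      then obtain c where "x = cscale c (rep p)" using p by blast
      then show "form_eval m e f x = 0" using hom[of c] 0 by simp
    qed
  qed
qed

text \<open>
Take as equations all real forms that vanish on the locus.
\<close>

lemma defined_over_realsI:
  assumes "Z \<subseteq> PP m"
    and "\<And>p. p \<in> PP m \<Longrightarrow> p \<notin> Z \<Longrightarrow> \<exists>e. \<exists>f\<in>coord_space (exps m e) \<inter> real_vecs.
          (\<forall>q\<in>Z. form_eval m e f (rep q) = 0) \<and> form_eval m e f (rep p) \<noteq> 0"
  shows "defined_over_reals m Z"
proof -
  let ?F = "{(e, f). f \<in> coord_space (exps m e) \<inter> real_vecs \<and> (\<forall>q\<in>Z. form_vanishes m e f q)}"
  have "p \<in> Z" if p: "p \<in> PP m" "\<forall>(e, f)\<in>?F. form_vanishes m e f p" for p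
  proof (rule ccontr)
    assume "p \<notin> Z"
    then obtain e f where ef: "f \<in> coord_space (exps m e) \<inter> real_vecs"
      "\<forall>q\<in>Z. form_eval m e f (rep q) = 0" "form_eval m e f (rep p) \<noteq> 0" using assms(2) p(1) by blast
    have "(e, f) \<in> ?F" using ef(1,2) assms(1) form_vanishes_rep by auto
    then have "form_vanishes m e f p" using p(2) by blast
    then show False using form_vanishes_rep[OF p(1)] ef(3) by blast
  qed
  then have "Z = {p \<in> PP m. \<forall>(e, f)\<in>?F. form_vanishes m e f p}" using assms(1) by blast
  moreover have "\<forall>(e, f)\<in>?F. f \<in> coord_space (exps m e) \<inter> real_vecs" by blast
  ultimately show ?thesis unfolding defined_over_reals_def by blast
qed

lemma linear_locus_separating:
  assumes B: "B \<subseteq> real_vecs" "B \<subseteq> coord_space {..m}" and p: "p \<in> PP m" "p \<notin> linear_locus m (cvs.span B)"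
  shows "\<exists>f\<in>coord_space (exps m 1) \<inter> real_vecs.
     (\<forall>q\<in>linear_locus m (cvs.span B). form_eval m 1 f (rep q) = 0) \<and> form_eval m 1 f (rep p) \<noteq> 0"
proof -
  have "rep p \<notin> cvs.span B" using p linear_locus_iff[OF cvs.subspace_span] by blast
  then obtain h where h: "\<forall>i. h i \<in> \<real>" "\<forall>y\<in>cvs.span B. (\<Sum>i\<le>m. h i * y i) = 0"
    "(\<Sum>i\<le>m. h i * rep p i) \<noteq> 0"
    using real_linear_form_separating[OF B rep_props(3)[OF p(1)]] by blast
  then show ?thesis
    using real_linear_form_coefficients[OF h(1), of m] linear_locus_iff[OF cvs.subspace_span, of _ m B] by metis
qed

lemma real_linear_locus:
  assumes B: "B \<subseteq> real_vecs" "B \<subseteq> coord_space {..m}" "cvs.independent B" "card B = k + 1"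
  shows "linear_subvariety m k (linear_locus m (cvs.span B))"
    and "defined_over_reals m (linear_locus m (cvs.span B))"
proof -
  have "cvs.span B \<subseteq> coord_space {..m}" using B(2) coord_space_subspace cvs.span_minimal by blast
  moreover have "cvs.dim (cvs.span B) = k + 1" using cvs.dim_span_eq_card_independent[OF B(3)] B(4) by simp
  ultimately show "linear_subvariety m k (linear_locus m (cvs.span B))"
    unfolding linear_subvariety_def linear_locus_def by (intro exI[of _ "cvs.span B"]) simp
  show "defined_over_reals m (linear_locus m (cvs.span B))"
    by (rule defined_over_realsI) (use linear_locus_separating[OF B(1,2)] in \<open>auto simp: linear_locus_def\<close>)
qed

lemma linear_subvariety_line:
  assumes "is_line m l"
  shows "\<exists>V\<in>lines. l = linear_locus m V"
proof -
  obtain V where V: "cvs.subspace V" "cvs.dim V = 2" "l = linear_locus m V"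
    using assms unfolding linear_subvariety_def linear_locus_def by auto
  obtain B where B: "B \<subseteq> V" "cvs.independent B" "V \<subseteq> cvs.span B" "card B = 2"
    using cvs.basis_exists[of V] V(2) by metis
  then obtain u v where "B = {u, v}" by (auto simp: card_2_iff)
  moreover have "V = cvs.span B" using B V(1) cvs.span_minimal by blast
  ultimately show ?thesis using V(3) unfolding lines_def by blast
qed

lemma independent_triple:
  assumes "\<not> in_line X"
  shows "\<exists>x y z. {x, y, z} \<subseteq> X \<and> cvs.independent {x, y, z} \<and> card {x, y, z} = 3"
proof -
  have out: "\<exists>z\<in>X. z \<notin> cvs.span {u, v}" for u v
    using assms unfolding in_line_def lines_def by blast
  obtain x where x: "x \<in> X" "x \<notin> cvs.span {0, 0}" using out by blast
  obtain y where y: "y \<in> X" "y \<notin> cvs.span {x, x}" using out by blast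
  obtain z where z: "z \<in> X" "z \<notin> cvs.span {x, y}" using out by blast
  have "x \<noteq> 0" using x(2) cvs.span_zero by metis
  then have "cvs.independent {x}" by simp
  then have "cvs.independent {y, x}" using y(2) cvs.independent_insertI[of y "{x}"] by simp
  then have "cvs.independent {z, x, y}" using z(2) cvs.independent_insertI[of z "{x, y}"] by (simp add: insert_commute)
  moreover have "y \<noteq> x" "z \<noteq> x" "z \<noteq> y" using y(2) z(2) cvs.span_base by blast+
  ultimately show ?thesis using x(1) y(1) z(1) by (intro exI[of _ z] exI[of _ x] exI[of _ y]) auto
qed

section \<open>Relations between Veronese images\<close>

lemma sum_apply: "(\<Sum>p\<in>D. F p) a = (\<Sum>p\<in>D. F p a)"
  by (induction D rule: infinite_finite_induct) auto

lemma forms_of_veronese_relation: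
  assumes "D \<subseteq> PP m" "(\<Sum>p\<in>D. cscale (c p) (veronese_vec m d p)) = 0" "hform d f"
  shows "(\<Sum>p\<in>D. c p * f (rep p)) = 0"
proof -
  obtain g where g: "\<forall>x\<in>coord_space {..m}. f x = form_eval m d g x"
    using hform_has_coefficients[OF assms(3)] by blast
  have "(\<Sum>p\<in>D. c p * f (rep p)) = (\<Sum>p\<in>D. \<Sum>a\<in>exps m d. g a * (c p * veronese_vec m d p a))"
  proof (rule sum.cong[OF refl])
    fix p assume "p \<in> D"
    then have "rep p \<in> coord_space {..m}" using assms(1) rep_props(3) by blast
    then have "f (rep p) = (\<Sum>a\<in>exps m d. g a * veronese_vec m d p a)"
      using g by (simp add: form_eval_monomials veronese_vec_def)
    then show "c p * f (rep p) = (\<Sum>a\<in>exps m d. g a * (c p * veronese_vec m d p a))"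
      by (simp add: sum_distrib_left mult.left_commute)
  qed
  also have "\<dots> = (\<Sum>a\<in>exps m d. g a * (\<Sum>p\<in>D. cscale (c p) (veronese_vec m d p)) a)"
    by (subst sum.swap) (simp add: sum_apply sum_distrib_left cscale_def)
  finally show ?thesis by (simp add: assms(2))
qed

lemma inj_on_rep: "inj_on rep (PP m)"
proof (rule inj_onI)
  fix p q assume pq: "p \<in> PP m" "q \<in> PP m" "rep p = rep q"
  then have "rep q \<in> cvs.span {rep p}" by (simp add: cvs.span_base)
  then show "p = q" using rep_eqI[of p "{..m}" q] pq(1,2) by blast
qed

lemma proj_distinct_rep:
  assumes D: "D \<subseteq> PP m" "finite D"
  shows "proj_distinct (rep ` D)"
proof -
  have "rep p \<noteq> 0" if "p \<in> D" for p using rep_props(1) D(1) that by blast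
  moreover have "rep q = rep p" if "p \<in> D" "q \<in> D" "rep q \<in> cvs.span {rep p}" for p q
    using rep_eqI[of p "{..m}" q] D(1) that by blast
  ultimately show ?thesis using D(2) unfolding proj_distinct_def by auto
qed

text \<open>
A form that vanishes at all but one of the points leaves one term of the evaluated relation.
\<close>

lemma cayley_bacharach_of_relation:
  assumes D: "D \<subseteq> PP m" "finite D" and rel: "(\<Sum>p\<in>D. cscale (c p) (veronese_vec m d p)) = 0"
    and c: "\<And>p. p \<in> D \<Longrightarrow> c p \<noteq> 0"
  shows "cayley_bacharach d (rep ` D)"
  unfolding cayley_bacharach_def
proof (intro ballI allI impI)
  fix x f assume x: "x \<in> rep ` D" and f: "hform d f" "\<forall>y\<in>rep ` D - {x}. f y = 0"
  then obtain p where p: "p \<in> D" "x = rep p" by blast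
  have "0 = (\<Sum>q\<in>D. c q * f (rep q))"
    using forms_of_veronese_relation[OF D(1) rel f(1)] by simp
  also have "\<dots> = (\<Sum>q\<in>{p}. c q * f (rep q))"
  proof (rule sum.mono_neutral_right)
    show "\<forall>q\<in>D - {p}. c q * f (rep q) = 0"
    proof
      fix q assume q: "q \<in> D - {p}"
      then have "rep q \<noteq> rep p" using inj_onD[OF inj_on_rep, of q p m] p D(1) by blast
      then have "rep q \<in> rep ` D - {x}" using q p by simp
      then show "c q * f (rep q) = 0" using f(2) by simp
    qed
  qed (use D(2) p in auto)
  finally have "c p * f x = 0" using p(2) by simp
  then show "f x = 0" using c[OF p(1)] by simp
qed

lemma veronese_relation_of_forms:
  assumes "\<And>f. hform d f \<Longrightarrow> (\<Sum>p\<in>D. c p * f (rep p)) = \<kappa> * f Q"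
  shows "(\<Sum>p\<in>D. cscale (c p) (veronese_vec m d p)) = cscale \<kappa> (monomials m d Q)"
proof
  fix a
  show "(\<Sum>p\<in>D. cscale (c p) (veronese_vec m d p)) a = cscale \<kappa> (monomials m d Q) a"
    using assms[OF hform_monomial, of a m]
    by (cases "a \<in> exps m d") (auto simp: sum_apply cscale_def veronese_vec_def monomials_def)
qed

lemma span_pair:
  assumes "x \<in> cvs.span {e, q}" shows "\<exists>s t. x = cscale s e + cscale t q"
proof -
  obtain s where "x - cscale s e \<in> cvs.span {q}" using assms cvs.span_breakdown_eq by blast
  then obtain t where "x - cscale s e = cscale t q" by (auto simp: cvs.span_singleton)
  then have "x = cscale s e + cscale t q" by (simp add: algebra_simps)
  then show ?thesis by blast
qed

lemma linear_to_line:
  assumes "lin_functional \<phi>" "lin_functional \<psi>"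
  shows "Vector_Spaces.linear cscale cscale (\<lambda>x. cscale (\<phi> x) e + cscale (\<psi> x) q)"
  using assms by (simp add: Vector_Spaces.linear_iff cvs.vector_space_axioms)
    (simp add: lin_functional_arith cvs.scale_left_distrib cvs.scale_right_distrib)

text \<open>
A linear map that is the identity on the line \<open>V2\<close> and shrinks \<open>V1\<close> to the intersection: for disjoint
subspaces the projection that kills \<open>V1\<close>, otherwise a projection along a direction in \<open>V1\<close>. The common
point is represented by \<open>Q\<close>, and \<open>Q = 0\<close> encodes that there is none.
\<close>

lemma ex_projection_onto_line:
  assumes V1: "cvs.subspace V1" and e: "e \<notin> V1" and f: "f \<notin> cvs.span {e}"
  defines "V2 \<equiv> cvs.span {e, f}"
  shows "\<exists>Q \<pi>. Vector_Spaces.linear cscale cscale \<pi> \<and> (\<forall>x\<in>V2. \<pi> x = x) \<and>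
     (\<forall>x\<in>V1. \<exists>t. \<pi> x = cscale t Q) \<and> Q \<in> V2 \<and> (V1 \<inter> V2 \<subseteq> {0} \<longrightarrow> Q = 0)"
proof -
  have e0: "e \<noteq> 0" using e V1 cvs.subspace_0 by blast
  have ind: "cvs.independent {f, e}" using f e0 cvs.independent_insertI[of f "{e}"] by simp
  have id: "cscale (\<phi> x) e + cscale (\<psi> x) q = x"
    if "lin_functional \<phi>" "lin_functional \<psi>" "\<phi> e = 1" "\<phi> q = 0" "\<psi> e = 0" "\<psi> q = 1" "x \<in> cvs.span {e, q}"
    for \<phi> \<psi> :: "('a \<Rightarrow> complex) \<Rightarrow> complex" and x q
    using span_pair[OF that(7)] that by (auto simp: lin_functional_arith)
  show ?thesis
  proof (cases "V1 \<inter> V2 \<subseteq> {0}")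
    case True
    have out: "x \<notin> cvs.span (insert y V1)" if xy: "{x, y} = {e, f}" "x \<noteq> y" for x y
    proof
      assume "x \<in> cvs.span (insert y V1)"
      then obtain k where k: "x - cscale k y \<in> V1"
        using cvs.span_breakdown_eq[of x y V1] cvs.span_eq_iff[THEN iffD2, OF V1] by auto
      moreover have "x - cscale k y \<in> V2"
        unfolding V2_def xy(1)[symmetric] by (intro cvs.span_diff cvs.span_scale cvs.span_base) auto
      ultimately have "x - cscale k y = 0" using True by blast
      then have "x = cscale k y" by simp
      then have "x \<in> cvs.span {y}" by (simp add: cvs.span_base cvs.span_scale)
      moreover have "{x, y} - {x} = {y}" using xy(2) by auto
      ultimately have "cvs.dependent {x, y}" unfolding cvs.dependent_def by (intro bexI[of _ x]) simp_all
      then have "cvs.dependent {f, e}" using xy(1) by (simp add: insert_commute)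
      then show False using ind by simp
    qed
    have fe: "f \<noteq> e" using f cvs.span_base by blast
    obtain \<phi> where \<phi>: "lin_functional \<phi>" "\<forall>v\<in>cvs.span (insert f V1). \<phi> v = 0" "\<phi> e = 1"
      using functional_vanishing_on_subspace[OF cvs.subspace_span out[of e f]] fe by auto
    obtain \<psi> where \<psi>: "lin_functional \<psi>" "\<forall>v\<in>cvs.span (insert e V1). \<psi> v = 0" "\<psi> f = 1"
      using functional_vanishing_on_subspace[OF cvs.subspace_span out[of f e]] fe by auto
    have z: "\<phi> x = 0" "\<psi> x = 0" if "x \<in> V1" for x
      using \<phi>(2) \<psi>(2) that cvs.span_base by blast+
    have "\<phi> f = 0" "\<psi> e = 0" using \<phi>(2) \<psi>(2) cvs.span_base by blast+
    then show ?thesis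
      using linear_to_line[OF \<phi>(1) \<psi>(1), of e f] id[OF \<phi>(1) \<psi>(1)] \<phi>(3) \<psi>(3) z
      by (intro exI[of _ 0] exI[of _ "\<lambda>x. cscale (\<phi> x) e + cscale (\<psi> x) f"])
        (auto simp: V2_def cvs.span_zero)
  next
    case False
    then obtain q where q: "q \<in> V1" "q \<in> V2" "q \<noteq> 0" by blast
    have qe: "q \<notin> cvs.span {e}"
    proof
      assume "q \<in> cvs.span {e}"
      then obtain t where t: "q = cscale t e" by (auto simp: cvs.span_singleton)
      then have "t \<noteq> 0" using q(3) by auto
      then have "e = cscale (1 / t) q" using t by (simp add: cscale_def fun_eq_iff)
      then show False using e q(1) V1 cvs.subspace_scale by metis
    qed
    have "cvs.independent {q, e}" using qe e0 cvs.independent_insertI[of q "{e}"] by simp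
    moreover have "{q, e} \<subseteq> V2" using q(2) cvs.span_base[of e "{e, f}"] by (simp add: V2_def)
    moreover have "q \<noteq> e" using qe cvs.span_base by blast
    ultimately have V2: "cvs.span {q, e} = V2"
      unfolding V2_def by (intro cvs.independent_spans) (auto simp: card_insert_if)
    obtain \<phi> where \<phi>: "lin_functional \<phi>" "\<forall>v\<in>V1. \<phi> v = 0" "\<phi> e = 1"
      using functional_vanishing_on_subspace[OF V1 e] by blast
    obtain \<psi> where \<psi>: "lin_functional \<psi>" "\<forall>v\<in>cvs.span {e}. \<psi> v = 0" "\<psi> q = 1"
      using functional_vanishing_on_subspace[OF cvs.subspace_span qe] by blast
    have "\<phi> q = 0" "\<psi> e = 0" using \<phi>(2) \<psi>(2) q(1) cvs.span_base by blast+
    then have "cscale (\<phi> x) e + cscale (\<psi> x) q = x" if "x \<in> V2" for x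
      using id[OF \<phi>(1) \<psi>(1) \<phi>(3) _ _ \<psi>(3), of x] that V2 by (simp add: insert_commute)
    moreover have "\<exists>t. cscale (\<phi> x) e + cscale (\<psi> x) q = cscale t q" if "x \<in> V1" for x
      using \<phi>(2) that by auto
    ultimately show ?thesis
      using linear_to_line[OF \<phi>(1) \<psi>(1), of e q] q(2) False
      by (intro exI[of _ q] exI[of _ "\<lambda>x. cscale (\<phi> x) e + cscale (\<psi> x) q"]) simp
  qed
qed

lemma line_through:
  assumes "V \<in> lines" "x \<in> V" "y \<in> V" "x \<noteq> 0" "y \<notin> cvs.span {x}"
  shows "V = cvs.span {x, y}" "cvs.independent {x, y}" "card {x, y} = 2"
proof -
  have "cvs.independent {y, x}" using assms(4,5) cvs.independent_insertI[of y "{x}"] by simp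
  then show ind: "cvs.independent {x, y}" by (simp add: insert_commute)
  have "x \<noteq> y" using assms(5) cvs.span_base by blast
  then show card: "card {x, y} = 2" by simp
  obtain u w where V: "V = cvs.span {u, w}" using assms(1) unfolding lines_def by blast
  have "card {u, w} \<le> 2" by (simp add: card_insert_if)
  then show "V = cvs.span {x, y}"
    using cvs.independent_spans[OF ind, of "{u, w}"] assms(2,3) card V by auto
qed

lemma real_line_through:
  assumes V: "V \<in> lines" and p: "p \<in> PP_real m" "q \<in> PP_real m" "p \<noteq> q" "rep p \<in> V" "rep q \<in> V"
  shows "V = cvs.span {rep p, rep q}" "is_line m (linear_locus m V)" "defined_over_reals m (linear_locus m V)"
proof -
  have PP: "p \<in> PP m" "q \<in> PP m" using p real_proj_subset by blast+
  have "rep q \<notin> cvs.span {rep p}" using rep_eqI[OF PP] p(3) by blast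
  note t = line_through[OF V p(4,5) rep_props(1)[OF PP(1)] this]
  then show Veq: "V = cvs.span {rep p, rep q}" by simp
  have "{rep p, rep q} \<subseteq> real_vecs" "{rep p, rep q} \<subseteq> coord_space {..m}"
    using rep_real p(1,2) rep_props(3) PP by auto
  from real_linear_locus[OF this t(2)] t(3) Veq
  show "is_line m (linear_locus m V)" "defined_over_reals m (linear_locus m V)" by auto
qed

section \<open>The difference of two decompositions\<close>

text \<open>
Two shortest decompositions of the same vector, with complex and with real coefficients. The strict
inequality between the cardinalities is the hypothesis that the ranks differ.
\<close>

locale two_decompositions =
  fixes m d :: nat and v :: "(nat \<Rightarrow> nat) \<Rightarrow> complex" and SC SR :: "nat point set"
    and a :: "nat point \<Rightarrow> complex" and b :: "nat point \<Rightarrow> real"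
  assumes minC: "cvs.spans_minimally (PP m) (veronese_vec m d) SC (\<Sum>p\<in>SC. cscale (a p) (veronese_vec m d p))"
    and minR: "rvs.spans_minimally (PP_real m) (veronese_vec m d) SR (\<Sum>p\<in>SR. rscale (b p) (veronese_vec m d p))"
    and vC: "v = (\<Sum>p\<in>SC. cscale (a p) (veronese_vec m d p))"
    and vR: "v = (\<Sum>p\<in>SR. rscale (b p) (veronese_vec m d p))"
    and fewer: "card SC < card SR"
    and bound: "card SC + card SR < 3 * d"
begin

abbreviation \<nu> :: "nat point \<Rightarrow> (nat \<Rightarrow> nat) \<Rightarrow> complex" where "\<nu> \<equiv> veronese_vec m d"

lemma SC: "SC \<subseteq> PP m" "finite SC" using minC by (auto simp: cvs.spans_minimally_def)

lemma SR: "SR \<subseteq> PP_real m" "finite SR" "SR \<subseteq> PP m"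
  using minR real_proj_subset by (auto simp: rvs.spans_minimally_def)

text \<open>
The coefficients of the difference of the two decompositions.
\<close>

definition c :: "nat point \<Rightarrow> complex" where
  "c p = (if p \<in> SC then a p else 0) - (if p \<in> SR then of_real (b p) else 0)"

definition T :: "nat point set" where "T = {p \<in> SC \<union> SR. c p \<noteq> 0}"

lemma T: "T \<subseteq> SC \<union> SR" "T \<subseteq> PP m" "finite T"
  using SC SR by (auto simp: T_def)

text \<open>
A shortest decomposition has nonzero coefficients only, so a point belonging to just one of the two sets
has a nonzero coefficient in the difference.
\<close>

lemma agree_off_T: "SC - T = SR - T"
proof -
  have "a p \<noteq> 0" if "p \<in> SC" for p using cvs.spans_minimally_coefficient[OF minC that] .
  moreover have "b p \<noteq> 0" if "p \<in> SR" for p using rvs.spans_minimally_coefficient[OF minR that] .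
  ultimately show ?thesis by (auto simp: T_def c_def)
qed

text \<open>
The vectors from which the points \<open>P\<^sub>l\<close>, \<open>P\<^sub>C\<close>, \<open>O\<^sub>\<Gamma>\<close>, \<open>O\<^sub>l\<close> and \<open>O\<^sub>r\<close> of the theorem arise.
\<close>

definition part :: "nat point set \<Rightarrow> (nat \<Rightarrow> nat) \<Rightarrow> complex" where
  "part Y = (\<Sum>p\<in>SC \<inter> Y. cscale (a p) (\<nu> p))"

lemma relation_part:
  "(\<Sum>p\<in>T \<inter> Y. cscale (c p) (\<nu> p)) = part Y - (\<Sum>p\<in>SR \<inter> Y. rscale (b p) (\<nu> p))"
proof -
  let ?W = "(SC \<union> SR) \<inter> Y"
  have fin: "finite ?W" using SC SR by auto
  have "(\<Sum>p\<in>T \<inter> Y. cscale (c p) (\<nu> p)) = (\<Sum>p\<in>?W. cscale (c p) (\<nu> p))"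
    using fin by (intro sum.mono_neutral_left) (auto simp: T_def)
  also have "\<dots> = (\<Sum>p\<in>?W. cscale (if p \<in> SC then a p else 0) (\<nu> p))
                - (\<Sum>p\<in>?W. cscale (if p \<in> SR then of_real (b p) else 0) (\<nu> p))"
    by (simp add: c_def cvs.scale_left_diff_distrib sum_subtractf)
  also have "(\<Sum>p\<in>?W. cscale (if p \<in> SC then a p else 0) (\<nu> p)) = part Y"
    unfolding part_def using fin by (intro sum.mono_neutral_cong_right) auto
  also have "(\<Sum>p\<in>?W. cscale (if p \<in> SR then of_real (b p) else 0) (\<nu> p)) = (\<Sum>p\<in>SR \<inter> Y. rscale (b p) (\<nu> p))"
    using fin by (intro sum.mono_neutral_cong_right) (auto simp: rscale_cscale)
  finally show ?thesis .
qed

lemma relation: "(\<Sum>p\<in>T. cscale (c p) (\<nu> p)) = 0"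
  using relation_part[of UNIV] vC vR by (simp add: part_def)

definition X :: "(nat \<Rightarrow> complex) set" where "X = rep ` T"

lemma inj_rep: "inj_on rep T"
  using inj_on_rep T(2) inj_on_subset by blast

lemma X_proj_distinct: "proj_distinct X"
  unfolding X_def by (rule proj_distinct_rep[OF T(2,3)])

lemma X_cayley_bacharach: "cayley_bacharach d X"
  unfolding X_def by (rule cayley_bacharach_of_relation[OF T(2,3) relation]) (simp add: T_def)

lemma T_cards:
  shows "card X = card T" "T \<noteq> {}" "card T \<le> card (SC \<inter> T) + card (SR \<inter> T)"
    "card (SC \<inter> T) < card (SR \<inter> T)" "card (SC \<inter> T) + card (SR \<inter> T) < 3 * d"
proof -
  show "card X = card T" unfolding X_def by (rule card_image[OF inj_rep])
  have split: "card S = card (S \<inter> T) + card (S - T)" if "finite S" for S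
    using that by (rule card_Int_Diff)
  show lt: "card (SC \<inter> T) < card (SR \<inter> T)" and "card (SC \<inter> T) + card (SR \<inter> T) < 3 * d"
    using split[OF SC(2)] split[OF SR(2)] agree_off_T fewer bound by auto
  show "T \<noteq> {}" using lt by auto
  have "T = (SC \<inter> T) \<union> (SR \<inter> T)" using T(1) by blast
  then show "card T \<le> card (SC \<inter> T) + card (SR \<inter> T)" by (metis card_Un_le)
qed

lemma X_small: "card X < 3 * d" using T_cards by simp

lemma X_finite: "finite X" using X_proj_distinct by (rule proj_distinct_finite)

lemma X_residual_line:
  assumes "V \<in> lines"
  shows "cayley_bacharach (d - 1) (X - V)" "proj_distinct (X - V)"
  using cayley_bacharach_off_subspace[OF X_cayley_bacharach X_finite lines_subspace[OF assms]]
    X_small proj_distinct_subset[OF X_proj_distinct] by auto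

lemma not_in_line_card:
  assumes "\<not> in_line X" shows "card X \<ge> 2 * d + 2" "d \<ge> 3"
  using cayley_bacharach_in_line[OF X_cayley_bacharach X_proj_distinct] assms X_small by linarith+

lemma agree_outside:
  assumes "T \<subseteq> Y"
  shows "SC - (SC \<inter> Y) = SR - (SR \<inter> Y)" "card (SC \<inter> Y) < card (SR \<inter> Y)" "card T \<le> card ((SC \<inter> Y) \<union> (SR \<inter> Y))"
proof -
  show eq: "SC - (SC \<inter> Y) = SR - (SR \<inter> Y)" using agree_off_T assms by blast
  have split: "card S = card (S \<inter> Y) + card (S - (S \<inter> Y))" if "finite S" for S
    using that by (simp add: card_Diff_subset card_mono)
  show "card (SC \<inter> Y) < card (SR \<inter> Y)"
    using split[OF SC(2)] split[OF SR(2)] eq fewer by simp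
  show "card T \<le> card ((SC \<inter> Y) \<union> (SR \<inter> Y))" using SC(2) SR(2) T(1) assms by (intro card_mono) auto
qed

text \<open>
If the relation restricted to \<open>Y\<close> is still a relation, then the parts of both decompositions in \<open>Y\<close>
have the same sum. This sum is real, because the second decomposition is, and both parts are shortest.
\<close>

lemma part_evinced:
  assumes rel: "(\<Sum>p\<in>T \<inter> Y. cscale (c p) (\<nu> p)) = 0" and ne: "T \<inter> Y \<noteq> {}"
  shows "point_of (part Y) \<in> real_proj (exps m d)" "part Y \<in> coord_space (exps m d)" "part Y \<noteq> 0"
    "cevinces m d (SC \<inter> Y) (point_of (part Y))" "revinces m d (SR \<inter> Y) (point_of (part Y))"
    "point_of (part Y) \<in> vspan m d (SC \<inter> Y)" "point_of (part Y) \<in> vspan m d (SR \<inter> Y)"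
proof -
  have eq: "part Y = (\<Sum>p\<in>SR \<inter> Y. rscale (b p) (\<nu> p))" using relation_part[of Y] rel by simp
  have mC: "cvs.spans_minimally (PP m) \<nu> (SC \<inter> Y) (part Y)"
    unfolding part_def by (rule cvs.spans_minimally_part[OF minC])
  have mR: "rvs.spans_minimally (PP_real m) \<nu> (SR \<inter> Y) (part Y)"
    unfolding eq by (rule rvs.spans_minimally_part[OF minR])
  have "SC \<inter> Y \<noteq> {} \<or> SR \<inter> Y \<noteq> {}" using ne T(1) by blast
  then show nz: "part Y \<noteq> 0"
    using cvs.spans_minimally_nonzero[OF mC] rvs.spans_minimally_nonzero[OF mR] by blast
  have "\<nu> p \<in> coord_space (exps m d)" for p by (simp add: veronese_vec_def monomials_coord_space)
  then show coord: "part Y \<in> coord_space (exps m d)"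
    unfolding part_def by (intro cvs.subspace_sum cvs.subspace_scale coord_space_subspace)
  have real: "part Y \<in> real_vecs"
    unfolding eq using veronese_vec_real SR(1)
    by (intro rvs.subspace_sum rvs.subspace_scale real_vecs_subspace) auto
  show "point_of (part Y) \<in> real_proj (exps m d)" using nz coord real by (auto simp: real_proj_def)
  show "cevinces m d (SC \<inter> Y) (point_of (part Y))" using cevinces_iff[OF coord nz] mC by simp
  show "revinces m d (SR \<inter> Y) (point_of (part Y))" using revinces_iff[OF coord nz real] mR by simp
  have "part Y \<in> rvs.span (\<nu> ` (SR \<inter> Y))" using mR by (simp add: rvs.spans_minimally_def)
  then have "part Y \<in> cvs.span (\<nu> ` (SR \<inter> Y))" using rvs_span_subset_cvs_span by blast
  then show "point_of (part Y) \<in> vspan m d (SR \<inter> Y)" using vspan_iff[OF _ coord nz] SR(3) by blast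
  show "point_of (part Y) \<in> vspan m d (SC \<inter> Y)"
    using vspan_iff[OF _ coord nz] SC(1) mC by (simp add: cvs.spans_minimally_def)
qed

lemma whole_part_evinced:
  assumes "T \<subseteq> Y"
  shows "(\<Sum>p\<in>T \<inter> Y. cscale (c p) (\<nu> p)) = 0" "T \<inter> Y \<noteq> {}"
  using relation assms T_cards(2) by (auto simp: Int_absorb2)

lemma T_in_locus: "cvs.subspace V \<Longrightarrow> X \<subseteq> V \<Longrightarrow> T \<subseteq> linear_locus m V"
  unfolding X_def using linear_locus_iff[of V _ m] T(2) by (simp add: subset_iff)

lemma two_real_points:
  assumes "card (SR \<inter> D) \<ge> 2"
  shows "\<exists>p q. p \<in> SR \<inter> D \<and> q \<in> SR \<inter> D \<and> p \<noteq> q"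
proof -
  obtain Y where Y: "Y \<subseteq> SR \<inter> D" "card Y = 2" using obtain_subset_with_card_n[OF assms] by metis
  then obtain p q where "Y = {p, q}" "p \<noteq> q" by (auto simp only: card_2_iff)
  then show ?thesis using Y(1) by (intro exI[of _ p] exI[of _ q]) simp
qed

text \<open>
Of the at least \<open>d + 2\<close> points on the line more than half belong to the real decomposition, so the line
has two real points.
\<close>

lemma collinear_case:
  assumes "in_line X"
  shows "\<exists>l. is_line m l \<and> defined_over_reals m l \<and>
        SC - (SC \<inter> l) = SR - (SR \<inter> l) \<and>
        (\<exists>P\<^sub>l \<in> vspan m d (SC \<inter> l) \<inter> vspan m d (SR \<inter> l).
           P\<^sub>l \<in> real_proj (exps m d) \<and>
           cevinces m d (SC \<inter> l) P\<^sub>l \<and> revinces m d (SR \<inter> l) P\<^sub>l) \<and>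
        card ((SC \<inter> l) \<union> (SR \<inter> l)) \<ge> d + 2 \<and>
        card (SC \<inter> l) < card (SR \<inter> l)"
proof -
  obtain V where V: "V \<in> lines" "X \<subseteq> V" using assms unfolding in_line_def by blast
  have "X \<noteq> {}" using T_cards(2) by (simp add: X_def)
  then have large: "card T \<ge> d + 2"
    using cayley_bacharach_card[OF X_cayley_bacharach X_proj_distinct] T_cards(1) by simp
  then have "card (SR \<inter> T) \<ge> 2" using T_cards X_small by linarith
  then obtain p q where pq: "p \<in> SR \<inter> T" "q \<in> SR \<inter> T" "p \<noteq> q" using two_real_points by blast
  then have "rep p \<in> V" "rep q \<in> V" using V(2) by (auto simp: X_def)
  note line = real_line_through[OF V(1) _ _ pq(3) this, of m]
  have TV: "T \<subseteq> linear_locus m V" using T_in_locus[OF lines_subspace[OF V(1)] V(2)] .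
  note agree = agree_outside[OF TV] and ev = part_evinced[OF whole_part_evinced[OF TV]]
  show ?thesis
  proof (intro exI[of _ "linear_locus m V"] conjI)
    show "is_line m (linear_locus m V)" "defined_over_reals m (linear_locus m V)"
      using line pq SR(1) by auto
    show "\<exists>P\<^sub>l \<in> vspan m d (SC \<inter> linear_locus m V) \<inter> vspan m d (SR \<inter> linear_locus m V).
           P\<^sub>l \<in> real_proj (exps m d) \<and>
           cevinces m d (SC \<inter> linear_locus m V) P\<^sub>l \<and> revinces m d (SR \<inter> linear_locus m V) P\<^sub>l"
      using ev by (intro bexI[of _ "point_of (part (linear_locus m V))"]) auto
    show "card ((SC \<inter> linear_locus m V) \<union> (SR \<inter> linear_locus m V)) \<ge> d + 2"
      using agree(3) large by linarith
  qed (use agree in auto)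
qed

end

lemma coord_space_span: "B \<subseteq> coord_space I \<Longrightarrow> cvs.span B \<subseteq> coord_space I"
  using coord_space_subspace cvs.span_minimal by blast

lemma linear_locus_Union:
  assumes "cvs.subspace V" "V \<subseteq> coord_space {..m}" "x \<in> V" "x \<noteq> 0"
  shows "x \<in> \<Union>(linear_locus m V)"
proof -
  have "point_of x \<in> PP m" using assms by (auto simp: proj_def)
  moreover have "point_of x \<subseteq> V" using point_of_subset[OF assms(1)] assms(3) by simp
  moreover have "x \<in> point_of x" by (simp add: point_of_def cvs.span_base)
  ultimately show ?thesis unfolding linear_locus_def by blast
qed

context two_decompositions
begin

lemma X_off_line: "V \<in> lines \<Longrightarrow> X - V = rep ` (T - linear_locus m V)"
  unfolding X_def using linear_locus_iff[OF lines_subspace, of V _ m] T(2) by auto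

lemma card_off_line:
  assumes "\<not> in_line X" "V \<in> lines"
  shows "card (T - linear_locus m V) \<ge> d + 1" "card (X - V) \<ge> d + 1"
proof -
  have "X - V \<noteq> {}" using assms unfolding in_line_def by blast
  then have "card (X - V) \<ge> (d - 1) + 2"
    by (rule cayley_bacharach_card[OF X_residual_line[OF assms(2)]])
  then show "card (X - V) \<ge> d + 1" by simp
  moreover have "card (X - V) \<le> card (T - linear_locus m V)"
    unfolding X_off_line[OF assms(2)] using T(3) by (intro card_image_le) simp
  ultimately show "card (T - linear_locus m V) \<ge> d + 1" by simp
qed

section \<open>Points on a conic\<close>

text \<open>
The conic is reduced, since otherwise its points would be on a line. If it is a union of two lines, the
points off one of the lines form a nonempty Cayley--Bacharach set of degree \<open>d - 1\<close>.
\<close>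

lemma conic_case:
  assumes B: "B \<subseteq> real_vecs" "B \<subseteq> coord_space {..m}" "cvs.independent B" "card B = 3"
    and XB: "X \<subseteq> cvs.span B" and g: "g \<in> coord_space (exps m 2)" "g \<in> real_vecs"
    and gE: "\<exists>x\<in>cvs.span B. form_eval m 2 g x \<noteq> 0" and gX: "\<forall>x\<in>X. form_eval m 2 g x = 0"
    and nl: "\<not> in_line X"
  shows "\<exists>C. reduced_conic m C \<and> defined_over_reals m C \<and>
        SC - (SC \<inter> C) = SR - (SR \<inter> C) \<and>
        (\<exists>P\<^sub>C \<in> vspan m d (SC \<inter> C) \<inter> vspan m d (SR \<inter> C).
           P\<^sub>C \<in> real_proj (exps m d) \<and>
           cevinces m d (SC \<inter> C) P\<^sub>C \<and> revinces m d (SR \<inter> C) P\<^sub>C) \<and>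
        card ((SC \<inter> C) \<union> (SR \<inter> C)) \<ge> 2 * d + 2 \<and>
        card (SC \<inter> C) < card (SR \<inter> C) \<and>
        (\<forall>l1 l2 Q. is_line m l1 \<longrightarrow> is_line m l2 \<longrightarrow> C = l1 \<union> l2 \<longrightarrow> l1 \<inter> l2 = {Q} \<longrightarrow>
           card ((SC \<union> SR) \<inter> (l1 - {Q})) \<ge> d + 1 \<and>
           card ((SC \<union> SR) \<inter> (l2 - {Q})) \<ge> d + 1)"
proof -
  define E where "E = linear_locus m (cvs.span B)"
  define C where "C = {p \<in> E. form_vanishes m 2 g p}"
  have sub: "cvs.subspace (cvs.span B)" by simp
  have coord: "cvs.span B \<subseteq> coord_space {..m}" using coord_space_span[OF B(2)] .
  have E: "is_plane m E" unfolding E_def by (rule real_linear_locus(1)[OF B(1-3)]) (simp add: B(4))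
  have EP: "E \<subseteq> PP m" by (auto simp: E_def linear_locus_def)
  have TE: "T \<subseteq> E" unfolding E_def by (rule T_in_locus[OF sub XB])
  have TC: "T \<subseteq> C"
  proof
    fix p assume p: "p \<in> T"
    then have "form_vanishes m 2 g p" using form_vanishes_rep[of p m] T(2) gX by (auto simp: X_def)
    then show "p \<in> C" using p TE by (auto simp: C_def)
  qed
  obtain x0 where x0: "x0 \<in> cvs.span B" "form_eval m 2 g x0 \<noteq> 0" using gE by blast
  have "x0 \<noteq> 0" using x0(2) hform_at_zero[OF hform_form_eval[of 2 m g]] by auto
  then have x0E: "x0 \<in> \<Union>E" unfolding E_def by (rule linear_locus_Union[OF sub coord x0(1)])
  have "\<not> (\<exists>c. \<exists>h \<in> coord_space (exps m 1). \<forall>x \<in> \<Union>E. form_eval m 2 g x = c * (form_eval m 1 h x)\<^sup>2)"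
  proof
    assume "\<exists>c. \<exists>h \<in> coord_space (exps m 1). \<forall>x \<in> \<Union>E. form_eval m 2 g x = c * (form_eval m 1 h x)\<^sup>2"
    then obtain c h where sq: "\<forall>x \<in> \<Union>E. form_eval m 2 g x = c * (form_eval m 1 h x)\<^sup>2" by blast
    have nz: "c \<noteq> 0" "form_eval m 1 h x0 \<noteq> 0" using sq x0E x0(2) by auto
    obtain x y z where t: "{x, y, z} \<subseteq> X" "cvs.independent {x, y, z}" "card {x, y, z} = 3"
      using independent_triple[OF nl] by blast
    have "finite B" using B(4) by (intro card_ge_0_finite) simp
    then have span: "cvs.span {x, y, z} = cvs.span B"
      using t XB B(4) by (intro cvs.independent_spans) auto
    have zero: "form_eval m 1 h w = 0" if w: "w \<in> {x, y, z}" for w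
    proof -
      have "w \<in> X" using w t(1) by blast
      then have "w \<in> cvs.span B" "w \<noteq> 0" "form_eval m 2 g w = 0"
        using XB gX X_proj_distinct by (auto simp: proj_distinct_def)
      then have "w \<in> \<Union>E" unfolding E_def by (intro linear_locus_Union[OF sub coord])
      then have "c * (form_eval m 1 h w)\<^sup>2 = 0" using sq \<open>form_eval m 2 g w = 0\<close> by metis
      then show ?thesis using nz(1) by simp
    qed
    have "form_eval m 1 h x0 = 0"
      using x0(1) unfolding span[symmetric]
      by (rule functionals.linear_eq_0_on_span[OF hform_1_linear[OF hform_form_eval], rotated]) (rule zero)
    then show False using nz(2) by simp
  qed
  then have red: "reduced_conic m C"
    unfolding reduced_conic_def using E g(1) C_def x0E x0(2) by blast
  have real: "defined_over_reals m C"
  proof (rule defined_over_realsI)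
    show "C \<subseteq> PP m" using EP by (auto simp: C_def)
    fix p assume p: "p \<in> PP m" "p \<notin> C"
    show "\<exists>e. \<exists>f\<in>coord_space (exps m e) \<inter> real_vecs.
          (\<forall>q\<in>C. form_eval m e f (rep q) = 0) \<and> form_eval m e f (rep p) \<noteq> 0"
    proof (cases "p \<in> E")
      case True
      then have "form_eval m 2 g (rep p) \<noteq> 0" using p form_vanishes_rep[OF p(1)] by (simp add: C_def)
      moreover have "\<forall>q\<in>C. form_eval m 2 g (rep q) = 0" using form_vanishes_rep EP by (auto simp: C_def)
      ultimately show ?thesis using g by (intro exI[of _ 2] bexI[of _ g]) auto
    next
      case False
      then obtain f where f: "f \<in> coord_space (exps m 1) \<inter> real_vecs"
        "\<forall>q\<in>E. form_eval m 1 f (rep q) = 0" "form_eval m 1 f (rep p) \<noteq> 0"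
        using linear_locus_separating[OF B(1,2) p(1)] unfolding E_def by blast
      then show ?thesis by (intro exI[of _ 1] bexI[of _ f]) (auto simp: C_def)
    qed
  qed
  have side: "d + 1 \<le> card ((SC \<union> SR) \<inter> (l - {Q}))"
    if l: "is_line m l'" "C = l \<union> l'" "Q \<in> l'" for l l' Q
  proof -
    obtain V where V: "V \<in> lines" "l' = linear_locus m V" using linear_subvariety_line[OF l(1)] by blast
    have "T - l' \<subseteq> (SC \<union> SR) \<inter> (l - {Q})" using T(1) TC l by blast
    then have "card (T - l') \<le> card ((SC \<union> SR) \<inter> (l - {Q}))" using SC(2) SR(2) by (intro card_mono) auto
    then show ?thesis using card_off_line(1)[OF nl V(1)] V(2) by simp
  qed
  note agree = agree_outside[OF TC] and ev = part_evinced[OF whole_part_evinced[OF TC]]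
  show ?thesis
  proof (intro exI[of _ C] conjI allI impI)
    show "\<exists>P\<^sub>C \<in> vspan m d (SC \<inter> C) \<inter> vspan m d (SR \<inter> C). P\<^sub>C \<in> real_proj (exps m d) \<and>
           cevinces m d (SC \<inter> C) P\<^sub>C \<and> revinces m d (SR \<inter> C) P\<^sub>C"
      using ev by (intro bexI[of _ "point_of (part C)"]) auto
    show "card ((SC \<inter> C) \<union> (SR \<inter> C)) \<ge> 2 * d + 2"
      using agree(3) not_in_line_card(1)[OF nl] T_cards(1) by linarith
    fix l1 l2 Q assume l: "is_line m l1" "is_line m l2" "C = l1 \<union> l2" "l1 \<inter> l2 = {Q}"
    show "d + 1 \<le> card ((SC \<union> SR) \<inter> (l1 - {Q}))" using side[OF l(2)] l by blast
    show "d + 1 \<le> card ((SC \<union> SR) \<inter> (l2 - {Q}))" using side[OF l(1)] l by blast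
  qed (use red real agree in auto)
qed

section \<open>Points on two lines\<close>

text \<open>
Applying the relation to forms composed with a projection of the first line into the second one makes
the first line contribute only a multiple of the value at the common point \<open>Q\<close>. What remains is a
relation between the points of the second line alone and \<open>Q\<close>, and \<open>Q = 0\<close> if the lines do not meet.
\<close>

lemma split_relation:
  assumes V: "V1 \<in> lines" "V2 \<in> lines" "X \<subseteq> V1 \<union> V2" and nl: "\<not> in_line X"
  shows "\<exists>\<kappa> Q. Q \<in> coord_space {..m} \<and> (V1 \<inter> V2 \<subseteq> {0} \<longrightarrow> Q = 0) \<and>
    (\<Sum>p\<in>T - linear_locus m V1. cscale (c p) (\<nu> p)) = cscale \<kappa> (monomials m d Q)"
proof -
  let ?D = "T - linear_locus m V1"
  have off: "rep p \<in> V1 \<longleftrightarrow> p \<in> linear_locus m V1" if "p \<in> T" for p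
    using linear_locus_iff[OF lines_subspace[OF V(1)], of p m] T(2) that by blast
  have "card (X - V1) \<ge> 2" using card_off_line(2)[OF nl V(1)] not_in_line_card(2)[OF nl] by simp
  then obtain Y where "Y \<subseteq> X - V1" "card Y = 2" using obtain_subset_with_card_n by metis
  then obtain e f where ef: "e \<in> X - V1" "f \<in> X - V1" "e \<noteq> f" by (auto simp: card_2_iff)
  then have ef2: "e \<in> V2" "f \<in> V2" "e \<noteq> 0" "f \<notin> cvs.span {e}" "e \<notin> V1"
    using V(3) X_proj_distinct by (auto simp: proj_distinct_def)
  have V2: "V2 = cvs.span {e, f}" using line_through(1)[OF V(2) ef2(1-4)] .
  have "{e, f} \<subseteq> coord_space {..m}" using ef rep_props(3) T(2) by (auto simp: X_def)
  then have V2c: "V2 \<subseteq> coord_space {..m}" unfolding V2 by (rule coord_space_span)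
  obtain Q \<pi> where \<pi>: "Vector_Spaces.linear cscale cscale \<pi>" "\<forall>x\<in>V2. \<pi> x = x"
    "\<forall>x\<in>V1. \<exists>t. \<pi> x = cscale t Q" and Q: "Q \<in> V2" "V1 \<inter> V2 \<subseteq> {0} \<longrightarrow> Q = 0"
    using ex_projection_onto_line[OF lines_subspace[OF V(1)] ef2(5,4)] unfolding V2 by blast
  have vanish: "(\<Sum>p\<in>?D. c p * f (rep p)) = 0" if f: "hform d f" "f Q = 0" for f
  proof -
    have "0 = (\<Sum>p\<in>T. c p * f (\<pi> (rep p)))"
      using forms_of_veronese_relation[OF T(2) relation hform_comp_linear[OF f(1) \<pi>(1)]] by simp
    also have "\<dots> = (\<Sum>p\<in>?D. c p * f (\<pi> (rep p)))"
    proof (rule sum.mono_neutral_right)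
      show "\<forall>p\<in>T - ?D. c p * f (\<pi> (rep p)) = 0"
      proof
        fix p assume "p \<in> T - ?D"
        then have "rep p \<in> V1" using off by blast
        then obtain t where "\<pi> (rep p) = cscale t Q" using \<pi>(3) by blast
        then show "c p * f (\<pi> (rep p)) = 0" using hform_homogeneous[OF f(1), of t Q] f(2) by simp
      qed
    qed (use T(3) in auto)
    also have "\<dots> = (\<Sum>p\<in>?D. c p * f (rep p))"
    proof (rule sum.cong[OF refl])
      fix p assume p: "p \<in> ?D"
      then have "rep p \<in> X" "rep p \<notin> V1" using off by (auto simp: X_def)
      then have "rep p \<in> V2" using V(3) by blast
      then show "c p * f (\<pi> (rep p)) = c p * f (rep p)" using \<pi>(2) by simp
    qed
    finally show ?thesis by simp
  qed
  have "\<exists>\<kappa>. \<forall>f. hform d f \<longrightarrow> (\<Sum>p\<in>?D. c p * f (rep p)) = \<kappa> * f Q"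
  proof (cases "Q = 0")
    case True
    have "f Q = 0" if "hform d f" for f
      using hform_at_zero[OF that] True not_in_line_card(2)[OF nl] by simp
    then show ?thesis using vanish by (intro exI[of _ 0]) auto
  next
    case False
    then obtain f0 where f0: "hform d f0" "f0 Q = 1" using hform_nonvanishing_at by blast
    have "(\<Sum>p\<in>?D. c p * f (rep p)) = (\<Sum>p\<in>?D. c p * f0 (rep p)) * f Q" if f: "hform d f" for f
    proof -
      have "(\<Sum>p\<in>?D. c p * (1 * f (rep p) - f Q * f0 (rep p))) = 0"
        using f0(2) by (intro vanish hform_diff_scale[OF f f0(1)]) simp
      moreover have "(\<Sum>p\<in>?D. c p * (1 * f (rep p) - f Q * f0 (rep p)))
          = (\<Sum>p\<in>?D. c p * f (rep p)) - (\<Sum>p\<in>?D. c p * f0 (rep p)) * f Q"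
        unfolding sum_distrib_right sum_subtractf[symmetric]
        by (intro sum.cong refl) (simp add: algebra_simps)
      ultimately show ?thesis by simp
    qed
    then show ?thesis by blast
  qed
  then obtain \<kappa> where "\<And>f. hform d f \<Longrightarrow> (\<Sum>p\<in>?D. c p * f (rep p)) = \<kappa> * f Q" by blast
  then have "(\<Sum>p\<in>?D. cscale (c p) (\<nu> p)) = cscale \<kappa> (monomials m d Q)"
    by (rule veronese_relation_of_forms)
  then show ?thesis using Q V2c by blast
qed

lemma monomials_zero:
  assumes "d \<ge> 1" shows "monomials m d 0 = 0"
proof
  fix a
  have "(\<Prod>i\<le>m. (0 :: nat \<Rightarrow> complex) i ^ a i) = 0" if "a \<in> exps m d"
    using hform_at_zero[OF hform_monomial[OF that] assms] .
  then show "monomials m d 0 a = 0 a" by (simp add: monomials_def)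
qed

text \<open>
By the split relation, the summands of the complex decomposition off the first line can be replaced by
those of the real decomposition together with the common point. As the complex decomposition is a
shortest one, this bounds the number of its points on the second line by one more than the number of
real ones, and there are at least \<open>d + 1 \<ge> 4\<close> points to be shared out.
\<close>

lemma real_points_on_second_line:
  assumes V: "V1 \<in> lines" "V2 \<in> lines" "X \<subseteq> V1 \<union> V2" and nl: "\<not> in_line X"
  shows "\<exists>p q. p \<in> PP_real m \<and> q \<in> PP_real m \<and> p \<noteq> q \<and> rep p \<in> V2 - V1 \<and> rep q \<in> V2 - V1"
proof -
  define D where "D = T - linear_locus m V1"
  obtain \<kappa> Q where Q: "Q \<in> coord_space {..m}"
    and rel: "(\<Sum>p\<in>D. cscale (c p) (\<nu> p)) = cscale \<kappa> (monomials m d Q)"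
    using split_relation[OF assms] unfolding D_def by blast
  \<comment> \<open>\<open>Q = 0\<close> represents no point and has the Veronese image 0\<close>
  define U where "U = (if Q = 0 then {} else {point_of Q})"
  have d: "d \<ge> 3" using not_in_line_card(2)[OF nl] .
  have U: "U \<subseteq> PP m" "finite U" "card U \<le> 1" using Q by (auto simp: U_def proj_def)
  have MQ: "monomials m d Q \<in> cvs.span (\<nu> ` U)"
  proof (cases "Q = 0")
    case True
    then show ?thesis using monomials_zero d by (simp add: cvs.span_zero)
  next
    case False
    then have "point_of (monomials m d Q) = cvs.span (\<nu> ` U)"
      using veronese_rep[of "point_of Q" m d] U(1) by (simp add: U_def veronese_point_of)
    moreover have "monomials m d Q \<in> point_of (monomials m d Q)" by (simp add: point_of_def cvs.span_base)
    ultimately show ?thesis by simp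
  qed
  have "T \<inter> D = D" by (auto simp: D_def)
  then have "part D = cscale \<kappa> (monomials m d Q) + (\<Sum>p\<in>SR \<inter> D. rscale (b p) (\<nu> p))"
    using relation_part[of D] rel by (simp add: algebra_simps)
  also have "\<dots> \<in> cvs.span (\<nu> ` ((SR \<inter> D) \<union> U))"
  proof (rule cvs.span_add)
    show "cscale \<kappa> (monomials m d Q) \<in> cvs.span (\<nu> ` ((SR \<inter> D) \<union> U))"
      using MQ cvs.span_mono[of "\<nu> ` U" "\<nu> ` ((SR \<inter> D) \<union> U)"] by (intro cvs.span_scale) auto
    show "(\<Sum>p\<in>SR \<inter> D. rscale (b p) (\<nu> p)) \<in> cvs.span (\<nu> ` ((SR \<inter> D) \<union> U))"
      unfolding rscale_cscale by (intro cvs.span_sum cvs.span_scale cvs.span_base) auto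
  qed
  finally have "part D \<in> cvs.span (\<nu> ` ((SR \<inter> D) \<union> U))" .
  moreover have "cvs.spans_minimally (PP m) \<nu> (SC \<inter> D) (part D)"
    unfolding part_def by (rule cvs.spans_minimally_part[OF minC])
  moreover have "(SR \<inter> D) \<union> U \<subseteq> PP m" "finite ((SR \<inter> D) \<union> U)" using SR U by auto
  ultimately have "card (SC \<inter> D) \<le> card ((SR \<inter> D) \<union> U)" unfolding cvs.spans_minimally_def by blast
  also have "\<dots> \<le> card (SR \<inter> D) + 1" using card_Un_le[of "SR \<inter> D" U] U(3) by linarith
  finally have 1: "card (SC \<inter> D) \<le> card (SR \<inter> D) + 1" .
  have "D = (SC \<inter> D) \<union> (SR \<inter> D)" using T(1) by (auto simp: D_def)
  then have "card D \<le> card (SC \<inter> D) + card (SR \<inter> D)" by (metis card_Un_le)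
  then have "card (SR \<inter> D) \<ge> 2" using 1 d card_off_line(1)[OF nl V(1)] by (simp add: D_def)
  then obtain p q where pq: "p \<in> SR \<inter> D" "q \<in> SR \<inter> D" "p \<noteq> q" using two_real_points by blast
  have "rep r \<in> V2 - V1" if "r \<in> D" for r
  proof -
    have "rep r \<in> X - V1" unfolding X_off_line[OF V(1)] using that by (auto simp: D_def)
    then show ?thesis using V(3) by blast
  qed
  then show ?thesis using pq SR(1) by (intro exI[of _ p] exI[of _ q]) auto
qed

end

section \<open>Spans of Veronese images\<close>

text \<open>
Forms act as linear functionals on Veronese images. On the first span \<open>f\<close> and \<open>h\<close> agree, and on the
second one \<open>h\<close> is zero, so every monomial \<open>f\<close> is zero at a common vector.
\<close>

lemma veronese_spans_trivial:
  assumes S: "S \<subseteq> PP m" and Y: "Y \<subseteq> PP m"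
    and sep: "\<And>f. hform d f \<Longrightarrow>
      \<exists>h. hform d h \<and> (\<forall>p\<in>S. h (rep p) = f (rep p)) \<and> (\<forall>p\<in>Y. h (rep p) = 0)"
  shows "cvs.span (veronese_vec m d ` S) \<inter> cvs.span (veronese_vec m d ` Y) \<subseteq> {0}"
proof
  fix z assume z: "z \<in> cvs.span (veronese_vec m d ` S) \<inter> cvs.span (veronese_vec m d ` Y)"
  have "z a = 0" for a
  proof (cases "a \<in> exps m d")
    case True
    obtain h where h: "hform d h" "\<forall>p\<in>S. h (rep p) = (\<Prod>i\<le>m. rep p i ^ a i)" "\<forall>p\<in>Y. h (rep p) = 0"
      using sep[OF hform_monomial[OF True]] by blast
    obtain g where g: "\<forall>x\<in>coord_space {..m}. h x = form_eval m d g x"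
      using hform_has_coefficients[OF h(1)] by blast
    let ?\<psi> = "\<lambda>u. \<Sum>a\<in>exps m d. g a * u a"
    have \<psi>: "lin_functional ?\<psi>" by (rule lin_functional_coefficients)
    have eval: "?\<psi> (veronese_vec m d p) = h (rep p)" if "p \<in> PP m" for p
      using g rep_props(3)[OF that] by (simp add: form_eval_monomials veronese_vec_def)
    have "?\<psi> z = 0"
    proof (rule functionals.linear_eq_0_on_span[OF \<psi>])
      show "z \<in> cvs.span (veronese_vec m d ` Y)" using z by simp
      fix u assume "u \<in> veronese_vec m d ` Y"
      then obtain p where "p \<in> Y" "u = veronese_vec m d p" by blast
      then show "?\<psi> u = 0" using eval[of p] h(3) Y by auto
    qed
    moreover have "z a + (-1) * ?\<psi> z = 0"
    proof (rule functionals.linear_eq_0_on_span[OF lin_functional_combine[OF lin_functional_coordinate \<psi>]])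
      show "z \<in> cvs.span (veronese_vec m d ` S)" using z by simp
      fix u assume "u \<in> veronese_vec m d ` S"
      then obtain p where p: "p \<in> S" "u = veronese_vec m d p" by blast
      then have "u a = h (rep p)" using h(2) True by (simp add: veronese_vec_def monomials_def)
      then show "u a + (-1) * ?\<psi> u = 0" using eval[of p] S p by auto
    qed
    ultimately show ?thesis by simp
  next
    case False
    have "veronese_vec m d ` S \<subseteq> coord_space (exps m d)"
      by (auto simp: veronese_vec_def monomials_coord_space)
    then have "z \<in> coord_space (exps m d)" using coord_space_span z by blast
    then show ?thesis using False by (simp add: coord_space_def)
  qed
  then show "z \<in> {0}" by (simp add: fun_eq_iff)
qed

text \<open>
The shape shared by the three uniqueness assertions about intersections of spans: modulo an independent
subspace, the multiples of \<open>w + s\<close> are the multiples of \<open>w\<close>.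
\<close>

lemma lin_span_meets_in_point:
  assumes S: "S \<subseteq> PP m" and Y: "Y \<subseteq> PP m" and s: "s \<in> cvs.span (veronese_vec m d ` S)"
    and w: "w \<in> cvs.span (veronese_vec m d ` Y)" "w \<noteq> 0"
    and trivial: "cvs.span (veronese_vec m d ` S) \<inter> cvs.span (veronese_vec m d ` Y) \<subseteq> {0}"
  shows "lin_span (exps m d) ({point_of (w + s)} \<union> veronese m d ` S) \<inter> vspan m d Y = {point_of w}"
proof -
  let ?A = "insert (w + s) (veronese_vec m d ` S)"
  have span: "cvs.span (\<Union>({point_of (w + s)} \<union> veronese m d ` S)) = cvs.span ?A"
  proof
    let ?U = "\<Union>({point_of (w + s)} \<union> veronese m d ` S)"
    have "\<Union>(veronese m d ` S) \<subseteq> cvs.span (\<Union>(veronese m d ` S))" by (rule cvs.span_superset)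
    also have "\<dots> = cvs.span (veronese_vec m d ` S)" by (rule span_veronese[OF S])
    also have "\<dots> \<subseteq> cvs.span ?A" by (rule cvs.span_mono) (rule subset_insertI)
    finally have 1: "\<Union>(veronese m d ` S) \<subseteq> cvs.span ?A" .
    have 2: "point_of (w + s) \<subseteq> cvs.span ?A"
      unfolding point_of_def by (rule cvs.span_mono) simp
    have U: "?U = point_of (w + s) \<union> \<Union>(veronese m d ` S)" by simp
    show "cvs.span ?U \<subseteq> cvs.span ?A"
      unfolding U by (rule cvs.span_minimal[OF Un_least[OF 2 1] cvs.subspace_span])
    have "veronese_vec m d ` S \<subseteq> cvs.span (veronese_vec m d ` S)" by (rule cvs.span_superset)
    also have "\<dots> = cvs.span (\<Union>(veronese m d ` S))" by (rule span_veronese[OF S, symmetric])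
    also have "\<dots> \<subseteq> cvs.span ?U" unfolding U by (rule cvs.span_mono) (rule Un_upper2)
    finally have 3: "veronese_vec m d ` S \<subseteq> cvs.span ?U" .
    have "w + s \<in> point_of (w + s)" by (simp add: point_of_def cvs.span_base)
    then have 4: "w + s \<in> cvs.span ?U" unfolding U by (intro cvs.span_base UnI1)
    show "cvs.span ?A \<subseteq> cvs.span ?U"
      by (rule cvs.span_minimal[OF _ cvs.subspace_span]) (simp only: insert_subset 3 4 simp_thms)
  qed
  have coord: "cvs.span (veronese_vec m d ` Y) \<subseteq> coord_space (exps m d)"
    by (rule coord_space_span) (auto simp: veronese_vec_def monomials_coord_space)
  have wc: "w \<in> coord_space (exps m d)" using coord w(1) by blast
  have left: "point_of u \<in> lin_span (exps m d) ({point_of (w + s)} \<union> veronese m d ` S)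
      \<longleftrightarrow> point_of u \<in> proj (exps m d) \<and> u \<in> cvs.span ?A" for u
    unfolding lin_span_def span using point_of_subset[OF cvs.subspace_span, of u ?A] by simp
  show ?thesis
  proof (intro equalityI subsetI)
    fix R assume "R \<in> {point_of w}"
    then have R: "R = point_of w" by simp
    have "point_of w \<in> proj (exps m d)" using wc w(2) by (auto simp: proj_def)
    moreover have "w + s - s \<in> cvs.span ?A"
      using s cvs.span_mono[of "veronese_vec m d ` S" ?A] cvs.span_base[of "w + s" ?A]
      by (intro cvs.span_diff) auto
    ultimately show "R \<in> lin_span (exps m d) ({point_of (w + s)} \<union> veronese m d ` S) \<inter> vspan m d Y"
      using left[of w] vspan_iff[OF Y wc w(2)] w(1) R by simp
  next
    fix R assume R: "R \<in> lin_span (exps m d) ({point_of (w + s)} \<union> veronese m d ` S) \<inter> vspan m d Y"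
    then obtain u where u: "R = point_of u" "u \<in> coord_space (exps m d)" "u \<noteq> 0"
      by (auto simp: lin_span_def proj_def)
    have uY: "u \<in> cvs.span (veronese_vec m d ` Y)" using R vspan_iff[OF Y u(2,3)] u(1) by simp
    have "u \<in> cvs.span ?A" using R left[of u] u(1) by simp
    then obtain k where k: "u - cscale k (w + s) \<in> cvs.span (veronese_vec m d ` S)"
      unfolding cvs.span_breakdown_eq by blast
    have "u - cscale k (w + s) + cscale k s \<in> cvs.span (veronese_vec m d ` S)"
      by (intro cvs.span_add cvs.span_scale k s)
    then have "u - cscale k w \<in> cvs.span (veronese_vec m d ` S)" by (simp add: cvs.scale_right_distrib)
    moreover have "u - cscale k w \<in> cvs.span (veronese_vec m d ` Y)"
      by (intro cvs.span_diff cvs.span_scale uY w(1))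
    ultimately have "u - cscale k w = 0" using trivial by blast
    then have "u = cscale k w" by simp
    then have "u \<in> point_of w" unfolding point_of_def cvs.span_singleton by (rule range_eqI)
    then show "R \<in> {point_of w}" using point_of_eq[OF _ u(3)] u(1) by simp
  qed
qed

context two_decompositions
begin

section \<open>Points on two meeting lines\<close>

text \<open>
Both lines are spanned by real points, hence so is their plane, and the product of a real equation of
each line is the equation of the conic.
\<close>

lemma meeting_lines_on_real_conic:
  assumes V: "V1 \<in> lines" "V2 \<in> lines" "X \<subseteq> V1 \<union> V2" and nl: "\<not> in_line X"
    and meet: "\<not> V1 \<inter> V2 \<subseteq> {0}"
  shows "\<exists>B g. B \<subseteq> real_vecs \<and> B \<subseteq> coord_space {..m} \<and> cvs.independent B \<and> card B = 3 \<and>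
    X \<subseteq> cvs.span B \<and> g \<in> coord_space (exps m 2) \<and> g \<in> real_vecs \<and>
    (\<exists>x\<in>cvs.span B. form_eval m 2 g x \<noteq> 0) \<and> (\<forall>x\<in>X. form_eval m 2 g x = 0)"
proof -
  have V': "X \<subseteq> V2 \<union> V1" using V(3) by blast
  obtain p1 q1 where 1: "p1 \<in> PP_real m" "q1 \<in> PP_real m" "p1 \<noteq> q1" "rep p1 \<in> V1 - V2" "rep q1 \<in> V1 - V2"
    using real_points_on_second_line[OF V(2,1) V' nl] by blast
  obtain p2 q2 where 2: "p2 \<in> PP_real m" "q2 \<in> PP_real m" "p2 \<noteq> q2" "rep p2 \<in> V2 - V1" "rep q2 \<in> V2 - V1"
    using real_points_on_second_line[OF V nl] by blast
  have V1: "V1 = cvs.span {rep p1, rep q1}" using real_line_through(1)[OF V(1) 1(1-3)] 1 by blast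
  have V2: "V2 = cvs.span {rep p2, rep q2}" using real_line_through(1)[OF V(2) 2(1-3)] 2 by blast
  have real: "rep p \<in> real_vecs \<and> rep p \<in> coord_space {..m} \<and> rep p \<noteq> 0" if "p \<in> PP_real m" for p
    using rep_real[OF that] rep_props[of p] real_proj_subset that by blast
  define B where "B = {rep p2, rep p1, rep q1}"
  have B: "B \<subseteq> real_vecs" "B \<subseteq> coord_space {..m}" using real 1 2 by (auto simp: B_def)
  have "p1 \<in> PP m" "q1 \<in> PP m" using 1 real_proj_subset by blast+
  then have "rep q1 \<notin> cvs.span {rep p1}" using rep_eqI 1(3) by blast
  then have "cvs.independent {rep p1, rep q1}" "card {rep p1, rep q1} = 2"
    using line_through(2,3)[OF V(1), of "rep p1" "rep q1"] 1 real by blast+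
  moreover have "rep p2 \<notin> cvs.span {rep p1, rep q1}" using 2(4) V1 by blast
  moreover from this have "rep p2 \<notin> {rep p1, rep q1}" using cvs.span_base by metis
  ultimately have Bi: "cvs.independent B" "card B = 3"
    unfolding B_def using cvs.independent_insertI[of "rep p2" "{rep p1, rep q1}"] by simp_all
  have V1B: "V1 \<subseteq> cvs.span B" unfolding V1 B_def by (rule cvs.span_mono) blast
  obtain Q where Q: "Q \<in> V1" "Q \<in> V2" "Q \<noteq> 0" using meet by blast
  have "rep p2 \<notin> cvs.span {Q}"
    using 2(4) Q(1) cvs.span_minimal[of "{Q}" V1] lines_subspace[OF V(1)] by auto
  then have "V2 = cvs.span {Q, rep p2}" using line_through(1)[OF V(2) Q(2) _ Q(3)] 2(4) by blast
  moreover have "{Q, rep p2} \<subseteq> cvs.span B" using Q(1) V1B cvs.span_base[of "rep p2" B] by (auto simp: B_def)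
  ultimately have V2B: "V2 \<subseteq> cvs.span B" by (simp add: cvs.span_minimal)
  have pair: "\<exists>h. (\<forall>i. h i \<in> \<real>) \<and> (\<forall>y\<in>cvs.span {rep p, rep q}. (\<Sum>i\<le>m. h i * y i) = 0) \<and> (\<Sum>i\<le>m. h i * x i) \<noteq> 0"
    if "p \<in> PP_real m" "q \<in> PP_real m" "x \<in> coord_space {..m}" "x \<notin> cvs.span {rep p, rep q}" for p q x
    using real that by (intro real_linear_form_separating) auto
  obtain h1 where h1: "\<forall>i. h1 i \<in> \<real>" "\<forall>y\<in>V1. (\<Sum>i\<le>m. h1 i * y i) = 0" "(\<Sum>i\<le>m. h1 i * rep p2 i) \<noteq> 0"
    using pair[OF 1(1,2), of "rep p2"] real[OF 2(1)] 2(4) unfolding V1[symmetric] by blast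
  obtain h2 where h2: "\<forall>i. h2 i \<in> \<real>" "\<forall>y\<in>V2. (\<Sum>i\<le>m. h2 i * y i) = 0" "(\<Sum>i\<le>m. h2 i * rep p1 i) \<noteq> 0"
    using pair[OF 2(1,2), of "rep p1"] real[OF 1(1)] 1(4) unfolding V2[symmetric] by blast
  obtain g2 where g2: "g2 \<in> coord_space (exps m 1) \<inter> real_vecs" "\<forall>x. form_eval m 1 g2 x = (\<Sum>i\<le>m. h2 i * x i)"
    using real_linear_form_coefficients[OF h2(1)] by blast
  obtain g where g: "g \<in> coord_space (exps m (Suc 1))" "g \<in> real_vecs"
    "\<forall>x. (\<Sum>i\<le>m. h1 i * x i) * form_eval m 1 g2 x = form_eval m (Suc 1) g x"
    using form_eval_mult_linear[of g2 m 1 h1] g2(1) h1(1) by blast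
  have geval: "form_eval m 2 g x = (\<Sum>i\<le>m. h1 i * x i) * (\<Sum>i\<le>m. h2 i * x i)" for x
    using g(3) g2(2) by (simp add: numeral_2_eq_2)
  have "rep p2 \<in> cvs.span B" "rep p1 \<in> cvs.span B" by (auto simp: B_def cvs.span_base)
  then have "\<exists>x\<in>cvs.span B. form_eval m 2 g x \<noteq> 0"
    unfolding geval using h1(3) h2(3)
    by (intro product_nonzero_on_subspace lin_functional_coefficients) auto
  moreover have "\<forall>x\<in>X. form_eval m 2 g x = 0" unfolding geval using V(3) h1(2) h2(2) by auto
  moreover have "X \<subseteq> cvs.span B" using V(3) V1B V2B by blast
  ultimately show ?thesis using B Bi g(1,2) by (intro exI[of _ B] exI[of _ g]) (simp add: numeral_2_eq_2)
qed

section \<open>Points in a plane\<close>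

text \<open>
The points outside the real decomposition are fewer than \<open>3 d / 2\<close>, so a Cayley--Bacharach set of
degree \<open>d - 1\<close> or \<open>d - 2\<close> among them is collinear. If the points of the real decomposition were on a line, \<open>T\<close> would therefore lie in two
lines. So they span the plane. Likewise, a conic through the real points contains all of \<open>T\<close>: the
points off it would be at least \<open>d\<close> points on a line, leaving so few others that these are collinear,
too. The real and the imaginary part of an equation of the conic through \<open>T\<close> both vanish at the real
points, and one of them is a nonzero form on the plane.
\<close>

lemma plane_set_on_real_conic:
  assumes n2: "\<not> in_two_lines X"
  shows "\<exists>B g. B \<subseteq> real_vecs \<and> B \<subseteq> coord_space {..m} \<and> cvs.independent B \<and> card B = 3 \<and>
    X \<subseteq> cvs.span B \<and> g \<in> coord_space (exps m 2) \<and> g \<in> real_vecs \<and>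
    (\<exists>x\<in>cvs.span B. form_eval m 2 g x \<noteq> 0) \<and> (\<forall>x\<in>X. form_eval m 2 g x = 0)"
proof -
  \<comment> \<open>every residual set that turns out to be collinear puts \<open>X\<close> into two lines\<close>
  have line_cover: "\<not> (V \<in> lines \<and> in_line (X - V))" for V
  proof
    assume V: "V \<in> lines \<and> in_line (X - V)"
    then obtain V' where "V' \<in> lines" "X - V \<subseteq> V'" unfolding in_line_def by blast
    moreover from this have "X \<subseteq> V \<union> V'" by blast
    ultimately show False using n2 V unfolding in_two_lines_def by metis
  qed
  have nl: "\<not> in_line X"
  proof
    assume "in_line X"
    then obtain V where "V \<in> lines" "X - V = {}" unfolding in_line_def by blast
    then show False using line_cover[of V] unfolding in_line_def by (metis empty_subsetI)
  qed
  note d = not_in_line_card(2)[OF nl]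
  obtain E where E: "E \<in> planes" "X \<subseteq> E"
    using cayley_bacharach_in_plane_or_two_lines[OF X_cayley_bacharach X_proj_distinct X_small] n2 by blast
  have nE: "\<not> in_line E" using nl E(2) unfolding in_line_def by blast
  obtain q where q: "hform 2 q" "\<exists>x\<in>E. q x \<noteq> 0" "\<forall>x\<in>X. q x = 0"
    using cayley_bacharach_on_conic[OF X_cayley_bacharach X_proj_distinct X_small planes_subspace[OF E(1)] nE E(2)]
    by blast
  define A where "A = rep ` (SC \<inter> T)"
  define R where "R = rep ` (SR \<inter> T)"
  have XAR: "X \<subseteq> A \<union> R" "R \<subseteq> X" "finite A" using T(1) SC(2) by (auto simp: X_def A_def R_def)
  have A_card: "2 * card A + 2 \<le> 3 * d"
    using T_cards(4,5) card_image_le[of "SC \<inter> T" rep] SC(2) unfolding A_def by fastforce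
  have nR: "\<not> in_line R"
  proof
    assume "in_line R"
    then obtain V where V: "V \<in> lines" "R \<subseteq> V" unfolding in_line_def by blast
    then have "card (X - V) \<le> card A" using XAR by (intro card_mono) auto
    then have "card (X - V) \<le> 2 * (d - 1) + 1" using A_card d by linarith
    then have "in_line (X - V)" by (rule cayley_bacharach_in_line[OF X_residual_line[OF V(1)]])
    then show False using line_cover V(1) by blast
  qed
  obtain x y z where t: "{x, y, z} \<subseteq> R" "cvs.independent {x, y, z}" "card {x, y, z} = 3"
    using independent_triple[OF nR] by blast
  define B where "B = {x, y, z}"
  have "R \<subseteq> real_vecs" "R \<subseteq> coord_space {..m}"
    unfolding R_def using rep_real[of _ "{..m}"] SR(1) rep_props(3)[of _ "{..m}"] SR(3)
    by (auto simp del: One_nat_def)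
  then have B: "B \<subseteq> real_vecs" "B \<subseteq> coord_space {..m}" and R: "R \<subseteq> real_vecs" using t(1) by (auto simp: B_def)
  obtain u1 u2 u3 where E_eq: "E = cvs.span {u1, u2, u3}" using E(1) unfolding planes_def by blast
  have "card {u1, u2, u3} \<le> 3" by (simp add: card_insert_if)
  then have EB: "cvs.span B = E"
    unfolding E_eq B_def using t XAR(2) E(2) E_eq by (intro cvs.independent_spans) auto
  have Ec: "E \<subseteq> coord_space {..m}" using coord_space_span[OF B(2)] EB by simp
  obtain g where g: "g \<in> coord_space (exps m 2)" "\<forall>x\<in>coord_space {..m}. q x = form_eval m 2 g x"
    using hform_has_coefficients[OF q(1)] by blast
  let ?u = "\<lambda>a. complex_of_real (Re (g a))" and ?w = "\<lambda>a. complex_of_real (Im (g a))"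
  have split: "form_eval m 2 g x = form_eval m 2 ?u x + \<i> * form_eval m 2 ?w x" for x
  proof -
    have "g a * k = ?u a * k + \<i> * (?w a * k)" for a k
      by (subst complex_eq[of "g a"]) (simp only: distrib_right mult.assoc)
    then show ?thesis by (simp add: form_eval_def sum.distrib sum_distrib_left)
  qed
  have uw: "?u \<in> coord_space (exps m 2)" "?u \<in> real_vecs" "?w \<in> coord_space (exps m 2)" "?w \<in> real_vecs"
    using g(1) by (auto simp: coord_space_def real_vecs_def)
  have zero: "form_eval m 2 ?u r = 0 \<and> form_eval m 2 ?w r = 0" if r: "r \<in> R" for r
  proof -
    have real: "form_eval m 2 k r \<in> \<real>" if "k \<in> real_vecs" for k
      using that r R by (auto simp: form_eval_def real_vecs_def intro!: sum_in_Reals Reals_mult prod_in_Reals Reals_power)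
    obtain s t where "form_eval m 2 ?u r = of_real s" "form_eval m 2 ?w r = of_real t"
      using real[OF uw(2)] real[OF uw(4)] by (auto simp: Reals_def)
    moreover have "form_eval m 2 g r = 0" using g(2) q(3) r XAR(2) E(2) Ec by (metis subsetD)
    ultimately show ?thesis using split[of r] by (auto simp: complex_eq_iff)
  qed
  have main: "\<forall>x\<in>X. form_eval m 2 k x = 0" if k: "\<forall>r\<in>R. form_eval m 2 k r = 0" for k
  proof (rule ccontr)
    assume neg: "\<not> ?thesis"
    let ?Y = "{x \<in> X. form_eval m 2 k x \<noteq> 0}"
    have cb: "cayley_bacharach (d - 2) ?Y"
      using cayley_bacharach_residual[OF X_cayley_bacharach hform_form_eval] d by simp
    have pd: "proj_distinct ?Y" by (rule proj_distinct_subset[OF X_proj_distinct]) auto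
    have "?Y \<subseteq> A" using k XAR(1) by auto
    then have "card ?Y \<le> card A" using XAR(3) by (intro card_mono)
    then have "card ?Y \<le> 2 * (d - 2) + 1" using A_card d by linarith
    then obtain V where V: "V \<in> lines" "?Y \<subseteq> V"
      using cayley_bacharach_in_line[OF cb pd] unfolding in_line_def by blast
    have "card ?Y \<ge> (d - 2) + 2" using cayley_bacharach_card[OF cb pd] neg by blast
    moreover have "card ?Y \<le> card (X \<inter> V)" using V(2) X_finite by (intro card_mono) auto
    moreover have "card X = card (X \<inter> V) + card (X - V)"
      using X_finite by (rule card_Int_Diff)
    ultimately have "card (X - V) \<le> 2 * (d - 1) + 1" using X_small d by linarith
    then have "in_line (X - V)" by (rule cayley_bacharach_in_line[OF X_residual_line[OF V(1)]])
    then show False using line_cover V(1) by blast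
  qed
  have "\<exists>k. k \<in> coord_space (exps m 2) \<and> k \<in> real_vecs \<and> (\<exists>x\<in>E. form_eval m 2 k x \<noteq> 0) \<and> (\<forall>r\<in>R. form_eval m 2 k r = 0)"
  proof -
    obtain x where x: "x \<in> E" "q x \<noteq> 0" using q(2) by blast
    then have "form_eval m 2 g x \<noteq> 0" using g(2) Ec by force
    then have "form_eval m 2 ?u x \<noteq> 0 \<or> form_eval m 2 ?w x \<noteq> 0" using split[of x] by auto
    then show ?thesis
    proof
      assume "form_eval m 2 ?u x \<noteq> 0"
      then show ?thesis using uw(1,2) zero x(1) by (intro exI[of _ ?u]) auto
    next
      assume "form_eval m 2 ?w x \<noteq> 0"
      then show ?thesis using uw(3,4) zero x(1) by (intro exI[of _ ?w]) auto
    qed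
  qed
  then obtain k where "k \<in> coord_space (exps m 2)" "k \<in> real_vecs" "\<exists>x\<in>E. form_eval m 2 k x \<noteq> 0"
    "\<forall>r\<in>R. form_eval m 2 k r = 0" by blast
  then show ?thesis
    using B t(2,3) E(2) EB main by (intro exI[of _ B] exI[of _ k]) (simp add: B_def)
qed

end

section \<open>Points on two disjoint lines\<close>

lemma veronese_spans_of_disjoint_lines:
  assumes "d \<ge> 1" "V1 \<in> lines" "V2 \<in> lines" "V1 \<inter> V2 \<subseteq> {0}"
    and e: "e \<in> V1" "f \<in> V1" "e \<noteq> 0" "f \<notin> cvs.span {e}"
  shows "cvs.span (veronese_vec m d ` linear_locus m V1) \<inter> cvs.span (veronese_vec m d ` linear_locus m V2) \<subseteq> {0}"
proof (rule veronese_spans_trivial)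
  show "linear_locus m V1 \<subseteq> PP m" "linear_locus m V2 \<subseteq> PP m" by (auto simp: linear_locus_def)
  have V1: "V1 = cvs.span {e, f}" using line_through(1)[OF assms(2) e] .
  have "e \<notin> V2" using e(1,3) assms(4) by blast
  moreover have "V2 \<inter> V1 \<subseteq> {0}" using assms(4) by blast
  ultimately obtain \<pi> where \<pi>: "Vector_Spaces.linear cscale cscale \<pi>" "\<forall>x\<in>V1. \<pi> x = x"
    "\<forall>x\<in>V2. \<exists>t. \<pi> x = cscale t 0"
    using ex_projection_onto_line[OF lines_subspace[OF assms(3)] _ e(4)] unfolding V1 by metis
  fix k :: "(nat \<Rightarrow> complex) \<Rightarrow> complex" assume k: "hform d k"
  show "\<exists>h. hform d h \<and> (\<forall>p\<in>linear_locus m V1. h (rep p) = k (rep p)) \<and>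
      (\<forall>p\<in>linear_locus m V2. h (rep p) = 0)"
  proof (intro exI[of _ "\<lambda>x. k (\<pi> x)"] conjI ballI)
    show "hform d (\<lambda>x. k (\<pi> x))" by (rule hform_comp_linear[OF k \<pi>(1)])
    fix p
    show "k (\<pi> (rep p)) = k (rep p)" if "p \<in> linear_locus m V1"
      using that \<pi>(2) linear_locus_iff[OF lines_subspace[OF assms(2)]] by simp
    show "k (\<pi> (rep p)) = 0" if p: "p \<in> linear_locus m V2"
    proof -
      have "rep p \<in> V2" using p linear_locus_iff[OF lines_subspace[OF assms(3)]] by simp
      then have "\<pi> (rep p) = 0" using \<pi>(3) by auto
      then show ?thesis using hform_at_zero[OF k assms(1)] by simp
    qed
  qed
qed

text \<open>
Two linear factors take care of the lines. In degree \<open>d - 2\<close>, fewer than \<open>d\<close> points impose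
independent conditions, because a Cayley--Bacharach set of that degree has at least \<open>d\<close> points.
\<close>

lemma interpolation_off_lines:
  assumes V: "V1 \<in> lines" "V2 \<in> lines" and F: "proj_distinct F" "F \<inter> V1 = {}" "F \<inter> V2 = {}"
    and d: "d \<ge> 2" "card F < d" and k: "hform d k"
  shows "\<exists>h. hform d h \<and> (\<forall>x\<in>F. h x = k x) \<and> (\<forall>x\<in>V1 \<union> V2. h x = 0)"
proof -
  have fin: "finite F" using F(1) by (rule proj_distinct_finite)
  obtain \<phi> where \<phi>: "lin_functional \<phi>" "\<forall>v\<in>V1. \<phi> v = 0" "\<forall>x\<in>F. \<phi> x \<noteq> 0"
    using functional_separating_finite[OF lines_subspace[OF V(1)] fin F(2)] by blast
  obtain \<psi> where \<psi>: "lin_functional \<psi>" "\<forall>v\<in>V2. \<psi> v = 0" "\<forall>x\<in>F. \<psi> x \<noteq> 0"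
    using functional_separating_finite[OF lines_subspace[OF V(2)] fin F(3)] by blast
  have "\<exists>\<delta>. hform d \<delta> \<and> \<delta> x = 1 \<and> (\<forall>y\<in>F - {x}. \<delta> y = 0) \<and> (\<forall>y\<in>V1 \<union> V2. \<delta> y = 0)" if x: "x \<in> F" for x
  proof -
    have "\<exists>f. hform (d - 2) f \<and> (\<forall>y\<in>F - {x}. f y = 0) \<and> f x \<noteq> 0"
    proof (rule ccontr)
      assume "\<not> ?thesis"
      then obtain C where C: "C \<subseteq> F" "x \<in> C" "cayley_bacharach (d - 2) C"
        using ex_cayley_bacharach_subset[OF fin x, of "d - 2"] by blast
      have "card C \<ge> (d - 2) + 2"
        using cayley_bacharach_card[OF C(3) proj_distinct_subset[OF F(1) C(1)]] C(2) by blast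
      then show False using card_mono[OF fin C(1)] d by simp
    qed
    then obtain f where f: "hform (d - 2) f" "\<forall>y\<in>F - {x}. f y = 0" "f x \<noteq> 0" by blast
    let ?f = "\<lambda>y. \<phi> y * (\<psi> y * f y)"
    have "hform (Suc (Suc (d - 2))) ?f" by (intro hform_mult_lin \<phi>(1) \<psi>(1) f(1))
    moreover have "Suc (Suc (d - 2)) = d" using d(1) by simp
    ultimately have "hform d ?f" by simp
    then have "hform d (\<lambda>y. (1 / ?f x) * ?f y)" by (rule hform_scale)
    moreover have "?f x \<noteq> 0" using f(3) \<phi>(3) \<psi>(3) x by auto
    ultimately show ?thesis using f(2) \<phi>(2) \<psi>(2)
      by (intro exI[of _ "\<lambda>y. (1 / ?f x) * ?f y"]) auto
  qed
  then have "\<forall>x\<in>F. \<exists>\<delta>. hform d \<delta> \<and> \<delta> x = 1 \<and> (\<forall>y\<in>F - {x}. \<delta> y = 0) \<and> (\<forall>y\<in>V1 \<union> V2. \<delta> y = 0)" ..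
  from bchoice[OF this] obtain \<delta> where "\<forall>x\<in>F. hform d (\<delta> x) \<and> \<delta> x x = 1 \<and>
    (\<forall>y\<in>F - {x}. \<delta> x y = 0) \<and> (\<forall>y\<in>V1 \<union> V2. \<delta> x y = 0)" ..
  then have \<delta>: "\<And>x. x \<in> F \<Longrightarrow> hform d (\<delta> x)" "\<And>x. x \<in> F \<Longrightarrow> \<delta> x x = 1"
    "\<And>x y. x \<in> F \<Longrightarrow> y \<in> F - {x} \<Longrightarrow> \<delta> x y = 0" "\<And>x y. x \<in> F \<Longrightarrow> y \<in> V1 \<union> V2 \<Longrightarrow> \<delta> x y = 0"
    by simp_all
  let ?h = "\<lambda>y. \<Sum>x\<in>F. k x * \<delta> x y"
  have "hform d ?h" by (intro hform_sum hform_scale \<delta>(1))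
  moreover have "?h y = k y" if y: "y \<in> F" for y
  proof -
    have "?h y = k y * \<delta> y y + (\<Sum>x\<in>F - {y}. k x * \<delta> x y)" by (rule sum.remove[OF fin y])
    also have "(\<Sum>x\<in>F - {y}. k x * \<delta> x y) = 0" using \<delta>(3) y by (intro sum.neutral) auto
    finally show ?thesis using \<delta>(2)[OF y] by simp
  qed
  moreover have "?h y = 0" if "y \<in> V1 \<union> V2" for y using \<delta>(4) that by (intro sum.neutral) auto
  ultimately show ?thesis by (intro exI[of _ ?h]) simp
qed

lemma coord_space_dim:
  assumes "cvs.independent B" "B \<subseteq> coord_space {..m}" shows "card B \<le> m + 1"
proof -
  have "x \<in> cvs.span (unit_vec ` {..m})" if "x \<in> coord_space {..m}" for x
    by (subst coord_space_unit_vec[OF that]) (intro cvs.span_sum cvs.span_scale cvs.span_base imageI)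
  then have "B \<subseteq> cvs.span (unit_vec ` {..m})" using assms(2) by blast
  then have "card B \<le> card (unit_vec ` {..m})"
    using cvs.independent_span_bound[OF _ assms(1), of "unit_vec ` {..m}"] by simp
  also have "\<dots> \<le> card {..m}" by (rule card_image_le) simp
  finally show ?thesis by simp
qed

context two_decompositions
begin

text \<open>
There is no common point, so the relation splits into relations on each of the lines.
\<close>

lemma disjoint_lines_relation:
  assumes V: "V1 \<in> lines" "V2 \<in> lines" "X \<subseteq> V1 \<union> V2" and nl: "\<not> in_line X"
    and disj: "V1 \<inter> V2 \<subseteq> {0}"
  shows "(\<Sum>p\<in>T \<inter> linear_locus m V2. cscale (c p) (\<nu> p)) = 0"
    and "T \<inter> linear_locus m V2 \<noteq> {}"
    and "card ((SC \<inter> linear_locus m V2) \<union> (SR \<inter> linear_locus m V2)) \<ge> d + 2"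
proof -
  let ?D = "T \<inter> linear_locus m V2"
  have D: "T - linear_locus m V1 = ?D"
  proof -
    have "p \<notin> linear_locus m V1 \<longleftrightarrow> p \<in> linear_locus m V2" if p: "p \<in> T" for p
    proof -
      have "p \<in> PP m" "rep p \<in> V1 \<union> V2" using p T(2) V(3) by (auto simp: X_def)
      moreover from this have "rep p \<noteq> 0" using rep_props(1) by blast
      moreover from this have "\<not> (rep p \<in> V1 \<and> rep p \<in> V2)" using disj by blast
      ultimately show ?thesis
        using linear_locus_iff[OF lines_subspace[OF V(1)], of p m] linear_locus_iff[OF lines_subspace[OF V(2)], of p m]
        by blast
    qed
    then show ?thesis by blast
  qed
  have d: "d \<ge> 3" using not_in_line_card(2)[OF nl] .
  obtain \<kappa> where "(\<Sum>p\<in>?D. cscale (c p) (\<nu> p)) = cscale \<kappa> (monomials m d 0)"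
    using split_relation[OF V nl] disj unfolding D by blast
  then show rel: "(\<Sum>p\<in>?D. cscale (c p) (\<nu> p)) = 0" using monomials_zero d by simp
  show ne: "?D \<noteq> {}" using card_off_line(1)[OF nl V(1)] unfolding D by fastforce
  have D': "?D \<subseteq> PP m" "finite ?D" using T by auto
  have "cayley_bacharach d (rep ` ?D)"
    by (rule cayley_bacharach_of_relation[OF D' rel]) (simp add: T_def)
  then have "d + 2 \<le> card (rep ` ?D)"
    by (rule cayley_bacharach_card) (use proj_distinct_rep[OF D'] ne in simp_all)
  also have "\<dots> \<le> card ?D" using D'(2) by (rule card_image_le)
  also have "\<dots> \<le> card ((SC \<inter> linear_locus m V2) \<union> (SR \<inter> linear_locus m V2))"
    using T(1) SC(2) SR(2) by (intro card_mono) auto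
  finally show "card ((SC \<inter> linear_locus m V2) \<union> (SR \<inter> linear_locus m V2)) \<ge> d + 2" .
qed

lemma disjoint_lines_case:
  assumes V: "V1 \<in> lines" "V2 \<in> lines" "X \<subseteq> V1 \<union> V2" and nl: "\<not> in_line X"
    and disj: "V1 \<inter> V2 \<subseteq> {0}"
  shows "m \<ge> 3 \<and>
      (\<exists>l r. is_line m l \<and> defined_over_reals m l \<and> is_line m r \<and> defined_over_reals m r \<and>
        l \<inter> r = {} \<and>
        (\<exists>\<Gamma> S'. \<Gamma> = l \<union> r \<and>
          SC - (SC \<inter> \<Gamma>) = S' \<and> SR - (SR \<inter> \<Gamma>) = S' \<and>
          card ((SC \<inter> l) \<union> (SR \<inter> l)) \<ge> d + 2 \<and>
          card ((SC \<inter> r) \<union> (SR \<inter> r)) \<ge> d + 2 \<and>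
          (\<exists>O\<^sub>\<Gamma> \<in> real_proj (exps m d).
            lin_span (exps m d) ({point_of v} \<union> veronese m d ` S') \<inter> vspan m d \<Gamma> = {O\<^sub>\<Gamma>} \<and>
            cevinces m d (SC \<inter> \<Gamma>) O\<^sub>\<Gamma> \<and> revinces m d (SR \<inter> \<Gamma>) O\<^sub>\<Gamma> \<and>
            (\<exists>O\<^sub>l \<in> real_proj (exps m d).
              lin_span (exps m d) ({O\<^sub>\<Gamma>} \<union> veronese m d ` r) \<inter> vspan m d l = {O\<^sub>l} \<and>
              cevinces m d (SC \<inter> l) O\<^sub>l \<and> revinces m d (SR \<inter> l) O\<^sub>l) \<and>
            (\<exists>O\<^sub>r \<in> real_proj (exps m d).
              lin_span (exps m d) ({O\<^sub>\<Gamma>} \<union> veronese m d ` l) \<inter> vspan m d r = {O\<^sub>r} \<and>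
              cevinces m d (SC \<inter> r) O\<^sub>r \<and> revinces m d (SR \<inter> r) O\<^sub>r))))"
proof -
  have V': "X \<subseteq> V2 \<union> V1" and disj': "V2 \<inter> V1 \<subseteq> {0}" using V(3) disj by auto
  have d: "d \<ge> 3" using not_in_line_card(2)[OF nl] .
  obtain p1 q1 where 1: "p1 \<in> PP_real m" "q1 \<in> PP_real m" "p1 \<noteq> q1" "rep p1 \<in> V1" "rep q1 \<in> V1"
    using real_points_on_second_line[OF V(2,1) V' nl] by blast
  obtain p2 q2 where 2: "p2 \<in> PP_real m" "q2 \<in> PP_real m" "p2 \<noteq> q2" "rep p2 \<in> V2" "rep q2 \<in> V2"
    using real_points_on_second_line[OF V nl] by blast
  note line1 = real_line_through[OF V(1) 1] and line2 = real_line_through[OF V(2) 2]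
  have PP: "p1 \<in> PP m" "q1 \<in> PP m" "p2 \<in> PP m" "q2 \<in> PP m" using 1 2 real_proj_subset by blast+
  have ind: "rep q1 \<notin> cvs.span {rep p1}" "rep q2 \<notin> cvs.span {rep p2}"
    using rep_eqI[OF PP(1,2)] rep_eqI[OF PP(3,4)] 1(3) 2(3) by blast+
  have nz: "rep p1 \<noteq> 0" "rep p2 \<noteq> 0" using rep_props(1) PP by blast+
  define l where "l = linear_locus m V1"
  define r where "r = linear_locus m V2"
  define \<Gamma> where "\<Gamma> = l \<union> r"
  define S' where "S' = SC - (SC \<inter> \<Gamma>)"
  have lr: "l \<subseteq> PP m" "r \<subseteq> PP m" "\<Gamma> \<subseteq> PP m" by (auto simp: l_def r_def \<Gamma>_def linear_locus_def)
  have mem: "p \<in> l \<longleftrightarrow> rep p \<in> V1" "p \<in> r \<longleftrightarrow> rep p \<in> V2" if "p \<in> PP m" for p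
    using linear_locus_iff[OF lines_subspace[OF V(1)], of p m] linear_locus_iff[OF lines_subspace[OF V(2)], of p m] that
    by (simp_all add: l_def r_def)
  have lr_disj: "l \<inter> r = {}"
  proof (rule ccontr)
    assume "l \<inter> r \<noteq> {}"
    then obtain p where p: "p \<in> l" "p \<in> r" by blast
    then have "p \<in> PP m" using lr by blast
    then show False using mem[of p] p rep_props(1)[of p] disj by blast
  qed
  have T\<Gamma>: "T \<subseteq> \<Gamma>"
  proof
    fix p assume p: "p \<in> T"
    then have "rep p \<in> V1 \<union> V2" "p \<in> PP m" using V(3) T(2) by (auto simp: X_def)
    then show "p \<in> \<Gamma>" using mem[of p] by (auto simp: \<Gamma>_def)
  qed
  note agree = agree_outside[OF T\<Gamma>]
  have m3: "m \<ge> 3"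
  proof -
    have p2: "rep p2 \<notin> cvs.span {rep p1, rep q1}"
      using nz(2) 2(4) disj unfolding line1(1)[symmetric] by blast
    have q2: "rep q2 \<notin> cvs.span {rep p2, rep p1, rep q1}"
    proof
      assume "rep q2 \<in> cvs.span {rep p2, rep p1, rep q1}"
      then obtain k where k: "rep q2 - cscale k (rep p2) \<in> V1"
        unfolding cvs.span_breakdown_eq[of _ "rep p2"] line1(1)[symmetric] by blast
      have "rep q2 - cscale k (rep p2) \<in> V2"
        using 2(4,5) lines_subspace[OF V(2)] by (simp add: cvs.subspace_diff cvs.subspace_scale)
      then have "rep q2 - cscale k (rep p2) = 0" using k disj by blast
      then have "rep q2 = cscale k (rep p2)" by simp
      then have "rep q2 \<in> cvs.span {rep p2}" by (simp add: cvs.span_base cvs.span_scale)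
      then show False using ind(2) by simp
    qed
    have t: "cvs.independent {rep p1, rep q1}" "card {rep p1, rep q1} = 2"
      using line_through(2,3)[OF V(1) 1(4,5) nz(1) ind(1)] by auto
    have "rep p2 \<notin> {rep p1, rep q1}" "rep q2 \<notin> {rep p2, rep p1, rep q1}"
      using p2 q2 cvs.span_base by metis+
    then have "card {rep q2, rep p2, rep p1, rep q1} = 4" using t(2) by simp
    moreover have "cvs.independent {rep q2, rep p2, rep p1, rep q1}"
      using cvs.independent_insertI[OF q2 cvs.independent_insertI[OF p2 t(1)]] .
    moreover have "{rep q2, rep p2, rep p1, rep q1} \<subseteq> coord_space {..m}" using rep_props(3)[of _ "{..m}"] PP by simp
    ultimately show ?thesis using coord_space_dim by fastforce
  qed
  have rel_r: "(\<Sum>p\<in>T \<inter> r. cscale (c p) (\<nu> p)) = 0" "T \<inter> r \<noteq> {}" "card ((SC \<inter> r) \<union> (SR \<inter> r)) \<ge> d + 2"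
    unfolding r_def by (rule disjoint_lines_relation[OF V nl disj])+
  have rel_l: "(\<Sum>p\<in>T \<inter> l. cscale (c p) (\<nu> p)) = 0" "T \<inter> l \<noteq> {}" "card ((SC \<inter> l) \<union> (SR \<inter> l)) \<ge> d + 2"
    unfolding l_def by (rule disjoint_lines_relation[OF V(2,1) V' nl disj'])+
  note ev_l = part_evinced[OF rel_l(1,2)] and ev_r = part_evinced[OF rel_r(1,2)]
    and ev_\<Gamma> = part_evinced[OF whole_part_evinced[OF T\<Gamma>]]
  have part_\<Gamma>: "part \<Gamma> = part l + part r"
  proof -
    have "SC \<inter> \<Gamma> = (SC \<inter> l) \<union> (SC \<inter> r)" by (auto simp: \<Gamma>_def)
    moreover have "(SC \<inter> l) \<inter> (SC \<inter> r) = {}" using lr_disj by blast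
    ultimately show ?thesis unfolding part_def using SC(2) by (simp add: sum.union_disjoint)
  qed
  have part_span: "part Y \<in> cvs.span (\<nu> ` Y)" for Y
    unfolding part_def by (intro cvs.span_sum cvs.span_scale cvs.span_base) auto
  define s where "s = (\<Sum>p\<in>S'. cscale (a p) (\<nu> p))"
  have v: "v = part \<Gamma> + s"
    unfolding vC part_def s_def S'_def using sum.Int_Diff[OF SC(2), of _ \<Gamma>] by (simp add: Diff_Int)
  have s: "s \<in> cvs.span (\<nu> ` S')"
    unfolding s_def by (intro cvs.span_sum cvs.span_scale cvs.span_base) auto
  have S': "S' \<subseteq> PP m" "finite S'" "S' \<inter> \<Gamma> = {}" using SC by (auto simp: S'_def)
  have S'_card: "card S' < d"
  proof -
    have "card S = card (S \<inter> \<Gamma>) + card (S - (S \<inter> \<Gamma>))" if "finite S" for S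
      using that by (simp add: card_Diff_subset card_mono)
    from this[OF SC(2)] this[OF SR(2)]
    have "card SC = card (SC \<inter> \<Gamma>) + card S'" "card SR = card (SR \<inter> \<Gamma>) + card S'"
      unfolding S'_def agree(1) by simp_all
    moreover have "2 * d + 2 \<le> card (SC \<inter> \<Gamma>) + card (SR \<inter> \<Gamma>)"
      using agree(3) card_Un_le[of "SC \<inter> \<Gamma>" "SR \<inter> \<Gamma>"] not_in_line_card(1)[OF nl] T_cards(1) by linarith
    ultimately show ?thesis using bound by linarith
  qed
  have triv_\<Gamma>: "cvs.span (\<nu> ` S') \<inter> cvs.span (\<nu> ` \<Gamma>) \<subseteq> {0}"
  proof (rule veronese_spans_trivial[OF S'(1) lr(3)])
    fix k :: "(nat \<Rightarrow> complex) \<Rightarrow> complex" assume k: "hform d k"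
    have off: "rep p \<notin> V1 \<and> rep p \<notin> V2" if "p \<in> S'" for p
      using mem[of p] that S' by (auto simp: \<Gamma>_def)
    then have "rep ` S' \<inter> V1 = {}" "rep ` S' \<inter> V2 = {}" by auto
    moreover have "card (rep ` S') < d" using card_image_le[OF S'(2), of rep] S'_card by simp
    ultimately obtain h where h: "hform d h" "\<forall>x\<in>rep ` S'. h x = k x" "\<forall>x\<in>V1 \<union> V2. h x = 0"
      using interpolation_off_lines[OF V(1,2) proj_distinct_rep[OF S'(1,2)] _ _ _ _ k] d by auto
    then show "\<exists>h. hform d h \<and> (\<forall>p\<in>S'. h (rep p) = k (rep p)) \<and> (\<forall>p\<in>\<Gamma>. h (rep p) = 0)"
      using mem lr by (intro exI[of _ h]) (auto simp: \<Gamma>_def)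
  qed
  have triv: "cvs.span (\<nu> ` r) \<inter> cvs.span (\<nu> ` l) \<subseteq> {0}" "cvs.span (\<nu> ` l) \<inter> cvs.span (\<nu> ` r) \<subseteq> {0}"
    unfolding l_def r_def
    using veronese_spans_of_disjoint_lines[OF _ V(2,1) disj' 2(4,5) nz(2) ind(2), of d m]
      veronese_spans_of_disjoint_lines[OF _ V(1,2) disj 1(4,5) nz(1) ind(1), of d m] d by auto
  have meet_\<Gamma>: "lin_span (exps m d) ({point_of v} \<union> veronese m d ` S') \<inter> vspan m d \<Gamma> = {point_of (part \<Gamma>)}"
    unfolding v by (rule lin_span_meets_in_point[OF S'(1) lr(3) s part_span ev_\<Gamma>(3) triv_\<Gamma>])
  have meet_l: "lin_span (exps m d) ({point_of (part \<Gamma>)} \<union> veronese m d ` r) \<inter> vspan m d l = {point_of (part l)}"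
    unfolding part_\<Gamma> by (rule lin_span_meets_in_point[OF lr(2,1) part_span part_span ev_l(3) triv(1)])
  have meet_r: "lin_span (exps m d) ({point_of (part \<Gamma>)} \<union> veronese m d ` l) \<inter> vspan m d r = {point_of (part r)}"
    unfolding part_\<Gamma> add.commute[of "part l"]
    by (rule lin_span_meets_in_point[OF lr(1,2) part_span part_span ev_r(3) triv(2)])
  have "\<exists>O\<^sub>\<Gamma> \<in> real_proj (exps m d).
            lin_span (exps m d) ({point_of v} \<union> veronese m d ` S') \<inter> vspan m d \<Gamma> = {O\<^sub>\<Gamma>} \<and>
            cevinces m d (SC \<inter> \<Gamma>) O\<^sub>\<Gamma> \<and> revinces m d (SR \<inter> \<Gamma>) O\<^sub>\<Gamma> \<and>
            (\<exists>O\<^sub>l \<in> real_proj (exps m d).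
              lin_span (exps m d) ({O\<^sub>\<Gamma>} \<union> veronese m d ` r) \<inter> vspan m d l = {O\<^sub>l} \<and>
              cevinces m d (SC \<inter> l) O\<^sub>l \<and> revinces m d (SR \<inter> l) O\<^sub>l) \<and>
            (\<exists>O\<^sub>r \<in> real_proj (exps m d).
              lin_span (exps m d) ({O\<^sub>\<Gamma>} \<union> veronese m d ` l) \<inter> vspan m d r = {O\<^sub>r} \<and>
              cevinces m d (SC \<inter> r) O\<^sub>r \<and> revinces m d (SR \<inter> r) O\<^sub>r)"
    by (intro bexI[of _ "point_of (part \<Gamma>)"] bexI[of _ "point_of (part l)"] bexI[of _ "point_of (part r)"] conjI
        meet_\<Gamma> meet_l meet_r ev_l ev_r ev_\<Gamma>)
  moreover have "is_line m l" "defined_over_reals m l" "is_line m r" "defined_over_reals m r"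
    unfolding l_def r_def by (rule line1 line2)+
  ultimately show ?thesis
    using m3 lr_disj rel_l(3) rel_r(3) agree(1) S'_def \<Gamma>_def
    by (intro conjI exI[of _ l] exI[of _ r] exI[of _ \<Gamma>] exI[of _ S']) simp_all
qed

end

section \<open>Complex and real rank\<close>

theorem theorem1:
  fixes m d :: nat
    and P :: "(nat \<Rightarrow> nat) point"
    and S\<^sub>C S\<^sub>R :: "nat point set"
  assumes "m \<ge> 1" and "d \<ge> 1"
    and "P \<in> real_proj (exps m d)"
    and "crank m d P + rrank m d P \<le> 3 * d - 1"
    and "crank m d P \<noteq> rrank m d P"
    and "cevinces m d S\<^sub>C P"
    and "revinces m d S\<^sub>R P"
  shows
    "(\<exists>l. is_line m l \<and> defined_over_reals m l \<and>
        S\<^sub>C - (S\<^sub>C \<inter> l) = S\<^sub>R - (S\<^sub>R \<inter> l) \<and>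
        (\<exists>P\<^sub>l \<in> vspan m d (S\<^sub>C \<inter> l) \<inter> vspan m d (S\<^sub>R \<inter> l).
           P\<^sub>l \<in> real_proj (exps m d) \<and>
           cevinces m d (S\<^sub>C \<inter> l) P\<^sub>l \<and> revinces m d (S\<^sub>R \<inter> l) P\<^sub>l) \<and>
        card ((S\<^sub>C \<inter> l) \<union> (S\<^sub>R \<inter> l)) \<ge> d + 2 \<and>
        card (S\<^sub>C \<inter> l) < card (S\<^sub>R \<inter> l))
   \<or>
     (\<exists>C. reduced_conic m C \<and> defined_over_reals m C \<and>
        S\<^sub>C - (S\<^sub>C \<inter> C) = S\<^sub>R - (S\<^sub>R \<inter> C) \<and>
        (\<exists>P\<^sub>C \<in> vspan m d (S\<^sub>C \<inter> C) \<inter> vspan m d (S\<^sub>R \<inter> C).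
           P\<^sub>C \<in> real_proj (exps m d) \<and>
           cevinces m d (S\<^sub>C \<inter> C) P\<^sub>C \<and> revinces m d (S\<^sub>R \<inter> C) P\<^sub>C) \<and>
        card ((S\<^sub>C \<inter> C) \<union> (S\<^sub>R \<inter> C)) \<ge> 2 * d + 2 \<and>
        card (S\<^sub>C \<inter> C) < card (S\<^sub>R \<inter> C) \<and>
        (\<forall>l1 l2 Q. is_line m l1 \<longrightarrow> is_line m l2 \<longrightarrow> C = l1 \<union> l2 \<longrightarrow> l1 \<inter> l2 = {Q} \<longrightarrow>
           card ((S\<^sub>C \<union> S\<^sub>R) \<inter> (l1 - {Q})) \<ge> d + 1 \<and>
           card ((S\<^sub>C \<union> S\<^sub>R) \<inter> (l2 - {Q})) \<ge> d + 1))
   \<or>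
     (m \<ge> 3 \<and>
      (\<exists>l r. is_line m l \<and> defined_over_reals m l \<and> is_line m r \<and> defined_over_reals m r \<and>
        l \<inter> r = {} \<and>
        (\<exists>\<Gamma> S'. \<Gamma> = l \<union> r \<and>
          S\<^sub>C - (S\<^sub>C \<inter> \<Gamma>) = S' \<and> S\<^sub>R - (S\<^sub>R \<inter> \<Gamma>) = S' \<and>
          card ((S\<^sub>C \<inter> l) \<union> (S\<^sub>R \<inter> l)) \<ge> d + 2 \<and>
          card ((S\<^sub>C \<inter> r) \<union> (S\<^sub>R \<inter> r)) \<ge> d + 2 \<and>
          (\<exists>O\<^sub>\<Gamma> \<in> real_proj (exps m d).
            lin_span (exps m d) ({P} \<union> veronese m d ` S') \<inter> vspan m d \<Gamma> = {O\<^sub>\<Gamma>} \<and>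
            cevinces m d (S\<^sub>C \<inter> \<Gamma>) O\<^sub>\<Gamma> \<and> revinces m d (S\<^sub>R \<inter> \<Gamma>) O\<^sub>\<Gamma> \<and>
            (\<exists>O\<^sub>l \<in> real_proj (exps m d).
              lin_span (exps m d) ({O\<^sub>\<Gamma>} \<union> veronese m d ` r) \<inter> vspan m d l = {O\<^sub>l} \<and>
              cevinces m d (S\<^sub>C \<inter> l) O\<^sub>l \<and> revinces m d (S\<^sub>R \<inter> l) O\<^sub>l) \<and>
            (\<exists>O\<^sub>r \<in> real_proj (exps m d).
              lin_span (exps m d) ({O\<^sub>\<Gamma>} \<union> veronese m d ` l) \<inter> vspan m d r = {O\<^sub>r} \<and>
              cevinces m d (S\<^sub>C \<inter> r) O\<^sub>r \<and> revinces m d (S\<^sub>R \<inter> r) O\<^sub>r)))))"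
proof -
  obtain v where v: "P = point_of v" "v \<in> coord_space (exps m d)" "v \<in> real_vecs" "v \<noteq> 0"
    using assms(3) by (auto simp: real_proj_def)
  have C: "cvs.spans_minimally (PP m) (veronese_vec m d) S\<^sub>C v"
    using assms(6) cevinces_iff[OF v(2,4)] v(1) by simp
  have R: "rvs.spans_minimally (PP_real m) (veronese_vec m d) S\<^sub>R v"
    using assms(7) revinces_iff[OF v(2,4,3)] v(1) by simp
  have fin: "finite S\<^sub>C" "finite S\<^sub>R" using C R by (auto simp: cvs.spans_minimally_def rvs.spans_minimally_def)
  obtain a where a: "v = (\<Sum>p\<in>S\<^sub>C. cscale (a p) (veronese_vec m d p))"
    using C cvs.span_image_sum[OF fin(1), of v "veronese_vec m d"] by (auto simp: cvs.spans_minimally_def)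
  obtain b where b: "v = (\<Sum>p\<in>S\<^sub>R. rscale (b p) (veronese_vec m d p))"
    using R rvs.span_image_sum[OF fin(2), of v "veronese_vec m d"] by (auto simp: rvs.spans_minimally_def)
  have cards: "card S\<^sub>C = crank m d P" "card S\<^sub>R = rrank m d P"
    using assms(6,7) by (auto simp: cevinces_def revinces_def)
  have "v \<in> cvs.span (veronese_vec m d ` S\<^sub>R)"
    using R rvs_span_subset_cvs_span by (auto simp: rvs.spans_minimally_def)
  moreover have "S\<^sub>R \<subseteq> PP m" using R real_proj_subset by (auto simp: rvs.spans_minimally_def)
  ultimately have "card S\<^sub>C \<le> card S\<^sub>R" using C fin(2) by (simp add: cvs.spans_minimally_def)
  then have "card S\<^sub>C < card S\<^sub>R" "card S\<^sub>C + card S\<^sub>R < 3 * d"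
    using assms(2,4,5) cards by auto
  then interpret two_decompositions m d v S\<^sub>C S\<^sub>R a b
    using C R a b by unfold_locales auto
  show ?thesis
  proof (cases "in_line X")
    case True
    from collinear_case[OF this] show ?thesis by (rule disjI1)
  next
    case nl: False
    show ?thesis
    proof (cases "\<exists>V1\<in>lines. \<exists>V2\<in>lines. X \<subseteq> V1 \<union> V2 \<and> V1 \<inter> V2 \<subseteq> {0}")
      case True
      then obtain V1 V2 where "V1 \<in> lines" "V2 \<in> lines" "X \<subseteq> V1 \<union> V2" "V1 \<inter> V2 \<subseteq> {0}"
        by (elim bexE conjE)
      from disjoint_lines_case[OF this(1-3) nl this(4)] show ?thesis
        unfolding v(1) by (intro disjI2)
    next
      case False
      have "\<exists>B g. B \<subseteq> real_vecs \<and> B \<subseteq> coord_space {..m} \<and> cvs.independent B \<and> card B = 3 \<and>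
        X \<subseteq> cvs.span B \<and> g \<in> coord_space (exps m 2) \<and> g \<in> real_vecs \<and>
        (\<exists>x\<in>cvs.span B. form_eval m 2 g x \<noteq> 0) \<and> (\<forall>x\<in>X. form_eval m 2 g x = 0)"
      proof (cases "in_two_lines X")
        case True
        then obtain V1 V2 where V: "V1 \<in> lines" "V2 \<in> lines" "X \<subseteq> V1 \<union> V2"
          unfolding in_two_lines_def by (elim bexE)
        have "\<not> V1 \<inter> V2 \<subseteq> {0}"
        proof
          assume "V1 \<inter> V2 \<subseteq> {0}"
          with V have "\<exists>V1\<in>lines. \<exists>V2\<in>lines. X \<subseteq> V1 \<union> V2 \<and> V1 \<inter> V2 \<subseteq> {0}"
            by (intro bexI[of _ V1] bexI[of _ V2] conjI)
          with False show False ..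
        qed
        then show ?thesis by (rule meeting_lines_on_real_conic[OF V nl])
      next
        case False
        then show ?thesis by (rule plane_set_on_real_conic)
      qed
      then obtain B g where "B \<subseteq> real_vecs" "B \<subseteq> coord_space {..m}" "cvs.independent B" "card B = 3"
        "X \<subseteq> cvs.span B" "g \<in> coord_space (exps m 2)" "g \<in> real_vecs"
        "\<exists>x\<in>cvs.span B. form_eval m 2 g x \<noteq> 0" "\<forall>x\<in>X. form_eval m 2 g x = 0" by (elim exE conjE)
      from conic_case[OF this nl] show ?thesis by (intro disjI2 disjI1)
    qed
  qed
qed

end
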